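(* Let $J\subset\mathbb{R}$ be a finite interval, $\sigma\ge0$, and $f\in L\log^{(\sigma+1)/2}L(J)$ (so $f$ is supported in $J$). Then for each $L\in\Lambda_1$ with $|L|\ge|J|^{-1}$ there exists a nonnegative function $F_L$ such that for every $\gamma\ge1$ $$|\Delta_Lf|\le C\,F_L*\varphi_{|L|^{-1}},\qquad \left\|\left(\sum_{L\in\Lambda_1,\,|L|\ge|J|^{-1}}|F_L|^2\right)^{1/2}\right\|_{L\log^{\sigma/2}L\left(\gamma J,\frac{dx}{|J|}\right)}\le C\,\|f\|_{L\log^{(\sigma+1)/2}L\left(J,\frac{dx}{|J|}\right)},$$ with $C$ depending only on $\gamma$ and $\sigma$. If in addition $\int_Jf=0$, then the conclusion holds for all $L\in\Lambda_1$, with the summation extending over all $L\in\Lambda_1$. With or without this additional assumption, for $|L|\ge|J|^{-1}$ the functions $F_L$ are supported in $5J$.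
   Context: $\Lambda_1:=\{\pm[2^k,2^{k+1}):k\in\mathbb{Z}\}$. For an interval $J$ and $c>0$, $cJ$ is the interval concentric with $J$ of length $c|J|$. Smooth frequency projections: $M$ is a fixed sufficiently large positive integer, and for each $L\in\Lambda_1$ a function $\phi_L$ is fixed with $\mathrm{supp}(\phi_L)\subseteq\frac54L$ and $\sup_{0\le\alpha\le M}|L|^\alpha\|\partial^\alpha\phi_L\|_{L^\infty}\le10^{10}$; then $\Delta_Lf(x):=\int_{\mathbb{R}}\phi_L(\xi)\hat f(\xi)e^{2\pi ix\xi}\,d\xi$, with $\hat f(\xi)=\int f(x)e^{-2\pi ix\xi}dx$. $\varphi(x):=(1+|x|^2)^{-3/4}$ and $\varphi_\lambda(x):=\lambda^{-1}\varphi(x/\lambda)$ for $\lambda>0$. For $s\ge0$ let $B_s(t):=t(\log(e+t))^s$. For an interval $E$ (here $E=J$ or $E=\gamma J$), $$\|g\|_{L\log^sL\left(E,\frac{dx}{|J|}\right)}:=\inf\left\{\lambda>0:\ \frac1{|J|}\int_EB_s\left(\frac{|g(x)|}{\lambda}\right)dx\le1\right\},$$ and $L\log^sL(J)$ is the space of functions supported in $J$ for which this is finite with $E=J$. *)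

theory Defs
  imports "HOL-Analysis.Analysis"
begin

abbreviation ilength :: "real set \<Rightarrow> real" where
  "ilength J \<equiv> measure lebesgue J"

text \<open>The image form keeps the endpoint type of \<open>J\<close>.\<close>

definition dilate :: "real \<Rightarrow> real set \<Rightarrow> real set" where
  "dilate c J = (let m = (Inf J + Sup J) / 2 in (\<lambda>x. m + c * (x - m)) ` J)"

definition finite_interval :: "real set \<Rightarrow> bool" where
  "finite_interval J \<longleftrightarrow> is_interval J \<and> bounded J \<and> 0 < ilength J"

definition Lambda1 :: "real set set" where
  "Lambda1 = range (\<lambda>k::int. {2 powi k ..< 2 powi (k + 1)})
           \<union> range (\<lambda>k::int. uminus ` {2 powi k ..< 2 powi (k + 1)})"

definition Lambda1_high :: "real set \<Rightarrow> real set set" where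
  "Lambda1_high J = {L \<in> Lambda1. ilength L \<ge> 1 / ilength J}"

text \<open>Iterated derivative of a function of a real variable; \<^const>\<open>deriv\<close> does not
  apply to maps from the reals to the complex numbers.\<close>

definition iter_deriv :: "nat \<Rightarrow> (real \<Rightarrow> complex) \<Rightarrow> real \<Rightarrow> complex" where
  "iter_deriv k f = ((\<lambda>g x. vector_derivative g (at x)) ^^ k) f"

definition C_k :: "nat \<Rightarrow> (real \<Rightarrow> complex) \<Rightarrow> bool" where
  "C_k M f \<longleftrightarrow> (\<forall>k<M. \<forall>x. iter_deriv k f differentiable (at x))
             \<and> continuous_on UNIV (iter_deriv M f)"

definition cutoff_family :: "nat \<Rightarrow> (real set \<Rightarrow> real \<Rightarrow> complex) \<Rightarrow> bool" where
  "cutoff_family M \<phi> \<longleftrightarrow> (\<forall>L\<in>Lambda1.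
     C_k M (\<phi> L)
     \<and> closure {\<xi>. \<phi> L \<xi> \<noteq> 0} \<subseteq> dilate (5/4) L
     \<and> (\<forall>k\<le>M. \<forall>\<xi>. ilength L ^ k * norm (iter_deriv k (\<phi> L) \<xi>) \<le> 10 ^ 10))"

definition fourier :: "(real \<Rightarrow> complex) \<Rightarrow> real \<Rightarrow> complex" where
  "fourier f \<xi> = (LINT x|lebesgue. f x * exp (- 2 * of_real pi * \<i> * of_real x * of_real \<xi>))"

definition freq_proj ::
    "(real set \<Rightarrow> real \<Rightarrow> complex) \<Rightarrow> real set \<Rightarrow> (real \<Rightarrow> complex) \<Rightarrow> real \<Rightarrow> complex" where
  "freq_proj \<phi> L f x =
     (LINT \<xi>|lebesgue. \<phi> L \<xi> * fourier f \<xi> * exp (2 * of_real pi * \<i> * of_real x * of_real \<xi>))"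

definition bump :: "real \<Rightarrow> real" where
  "bump x = (1 + \<bar>x\<bar>\<^sup>2) powr (- 3 / 4)"

definition bump_scaled :: "real \<Rightarrow> real \<Rightarrow> real" where
  "bump_scaled l x = inverse l * bump (x / l)"

definition conv :: "(real \<Rightarrow> real) \<Rightarrow> (real \<Rightarrow> real) \<Rightarrow> real \<Rightarrow> real" where
  "conv F g x = (LINT y|lebesgue. F y * g (x - y))"

text \<open>A Bochner integral that does not converge has value 0; this predicate says that the
  convolution exists at every point.\<close>

definition conv_exists :: "(real \<Rightarrow> real) \<Rightarrow> (real \<Rightarrow> real) \<Rightarrow> bool" where
  "conv_exists F g \<longleftrightarrow> (\<forall>x. integrable lebesgue (\<lambda>y. F y * g (x - y)))"

text \<open>Extends an unbounded increasing function on the nonnegative reals to the value \<open>\<infinity>\<close>.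
  It is needed because an infinite square function can take this value.\<close>

definition ext_top :: "(real \<Rightarrow> real) \<Rightarrow> ennreal \<Rightarrow> ennreal" where
  "ext_top h t = (if t = top then top else ennreal (h (enn2real t)))"

definition B_fun :: "real \<Rightarrow> real \<Rightarrow> real" where
  "B_fun s t = t * ln (exp 1 + t) powr s"

text \<open>The infimum is taken in \<^typ>\<open>ennreal\<close>, so it is \<open>\<infinity>\<close> over the empty set.
  The normalization is always by the length of \<open>J\<close>, also when \<open>E\<close> is a dilate of \<open>J\<close>.\<close>

definition LlogL_norm :: "real \<Rightarrow> real set \<Rightarrow> real set \<Rightarrow> (real \<Rightarrow> ennreal) \<Rightarrow> ennreal" where
  "LlogL_norm s J E g = Inf {ennreal l | l. 0 < l \<and>
     (\<integral>\<^sup>+x\<in>E. ext_top (B_fun s) (g x / ennreal l) \<partial>lebesgue) / ennreal (ilength J) \<le> 1}"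

definition LlogL_space :: "real \<Rightarrow> real set \<Rightarrow> (real \<Rightarrow> complex) set" where
  "LlogL_space s J = {f. f \<in> borel_measurable lebesgue \<and> (\<forall>x. x \<notin> J \<longrightarrow> f x = 0)
     \<and> LlogL_norm s J J (\<lambda>x. ennreal (norm (f x))) < top}"

definition square_fun :: "real set set \<Rightarrow> (real set \<Rightarrow> real \<Rightarrow> real) \<Rightarrow> real \<Rightarrow> ennreal" where
  "square_fun A F x = ext_top sqrt (\<Sum>\<^sub>\<infinity>L\<in>A. ennreal (\<bar>F L x\<bar>\<^sup>2))"

text \<open>\<open>F\<close> is a family of nonnegative measurable functions, indexed by \<open>A\<close>, whose
  convolutions with the rescaled bump functions exist.\<close>

definition admissible_family :: "real set set \<Rightarrow> (real set \<Rightarrow> real \<Rightarrow> real) \<Rightarrow> bool" where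
  "admissible_family A F \<longleftrightarrow> (\<forall>L\<in>A. F L \<in> borel_measurable lebesgue \<and> (\<forall>x. 0 \<le> F L x)
     \<and> conv_exists (F L) (bump_scaled (1 / ilength L)))"

end

theory Submission
  imports Defs "HOL-Complex_Analysis.Cauchy_Integral_Formula"
begin

text \<open>
For a scale \<open>d > 0\<close> let \<open>slide d w x\<close> be the average of \<open>w\<close> over \<open>[x, x + d)\<close>. An average at
scale \<open>d\<close> is the mean of two averages at scale \<open>d / 2\<close>, so along \<open>d, d/2, d/4, \<dots>\<close> the sliding
averages behave like a dyadic martingale, but they belong to no grid and have no boundary effects.
The increment \<open>jump d w\<close> is a convolution of \<open>w\<close>. For \<open>d = 1 / (4 |L|)\<close> its multiplier has no zero
near \<open>L\<close>, so the cutoff of \<open>L\<close> divided by that multiplier is again a bump with two bounded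
derivatives, and \<open>|\<Delta>\<^sub>L w| \<le> R |jump d w| * \<phi>\<close> at scale \<open>1 / |L|\<close> (\<open>freq_proj_le_jump\<close>).

The majorant of \<open>|jump d w|\<close> only has to be right on average, so it may live where \<open>w\<close> lives. Let
\<open>mass d w\<close> be the average of \<open>|w|\<close> and let \<open>trail d r y\<close> average \<open>r\<close> over \<open>(y - d, y]\<close>. The function
\<open>lift d w = |w| trail d (|jump d w| / mass d w)\<close> satisfies \<open>|jump d w| * \<phi> \<le> 3 lift d w * \<phi>\<close>, because
\<open>trail\<close> and \<open>slide\<close> are adjoint and \<open>\<phi>\<close> is almost constant at scale \<open>d\<close> (\<open>lift_convolution\<close>). By
Jensen's inequality the integral of \<open>|w| (trail \<dots>)\<^sup>2\<close> is at most that of \<open>|jump d w|\<^sup>2 / mass d w\<close>. The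
latter is an increment of entropy: the Bellman function \<open>|x|\<^sup>2 / y + 4 y ln y\<close> of the two averages
grows by at least an eighth of it when \<open>d\<close> is halved. Telescoping over the scales bounds the sum by
\<open>C ((n + 1) |w|\<^sub>1 + e\<^sup>-\<^sup>n |J|)\<close> if \<open>|w| \<le> e\<^sup>n\<^sup>+\<^sup>1\<close> is supported in \<open>J\<close> (\<open>energy_sum\<close>).

Normalize \<open>f\<close> so that its norm is about 1, cut it along the sets where \<open>ln (e + |f|)\<close> lies in
\<open>[n, n + 1)\<close>, and add the lifts of the pieces. On the \<open>n\<close>-th set the square function is \<open>|f| \<surd>A\<close>,
where \<open>|f| A / n\<close> has integral at most \<open>C (m\<^sub>n + e\<^sup>-\<^sup>n |J|)\<close> and \<open>m\<^sub>n\<close> is the mass of the piece. With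
\<open>s = \<sigma> / 2\<close> and \<open>S = |f| \<surd>A\<close> one has \<open>S ln\<^sup>s (e + S) \<le> K n\<^sup>s\<^sup>+\<^sup>1\<^sup>/\<^sup>2 |f| (1 + A / n)\<close> there (\<open>B_fun_level\<close>).
Summed over \<open>n\<close>, the right side is controlled by the integral of \<open>|f| ln\<^sup>s\<^sup>+\<^sup>1\<^sup>/\<^sup>2 (e + |f|)\<close>, which is
where the loss of half a logarithm comes from (\<open>square_function_modular\<close>).

If \<open>|L| < 1 / |J|\<close> and \<open>f\<close> has mean zero, the kernel of \<open>\<Delta>\<^sub>L\<close> varies across \<open>J\<close> by at most a
multiple of \<open>|L| |J|\<close> times its size, so the constant \<open>|L| |f|\<^sub>1\<close> on \<open>J\<close> dominates. The squares of
these constants form a geometric series (\<open>freq_proj_mean_zero\<close>, \<open>square_function_pointwise\<close>).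
\<close>

section \<open>An entropy inequality for two-point averages\<close>

text \<open>The tangent of \<open>x ln x\<close> at 1 lies below it with a quadratic gap. The constant \<open>1/4\<close> is small enough
for the difference to decrease on \<open>(0, 1]\<close> and to increase on \<open>[1, 2]\<close>.\<close>

lemma x_ln_x_ge_quadratic:
  fixes x :: real
  assumes "0 \<le> x" "x \<le> 2"
  shows "(x - 1) + (x - 1)\<^sup>2 / 4 \<le> x * ln x"
proof (cases "x = 0")
  case False
  define h where "h = (\<lambda>x::real. x * ln x - (x - 1) - (x - 1)\<^sup>2 / 4)"
  have der: "(h has_real_derivative (ln y - (y - 1) / 2)) (at y)" if "0 < y" for y
    proof -
    have "(h has_real_derivative (1 * ln y + 1 / y * y - 1 - 2 * (y - 1) / 4)) (at y)"
      unfolding h_def using that by (auto intro!: derivative_eq_intros)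
    moreover have "1 * ln y + 1 / y * y - 1 - 2 * (y - 1) / 4 = ln y - (y - 1) / 2"
      using that by simp
    ultimately show ?thesis by metis
  qed
  have x: "0 < x" using False assms by simp
  have ge: "0 \<le> ln y - (y - 1) / 2" if "1 \<le> y" "y \<le> 2" for y :: real
  proof -
    have "1 - 1 / y \<le> ln y" using ln_le_minus_one[of "1 / y"] that by (simp add: ln_div)
    moreover have "(y - 1) / 2 \<le> 1 - 1 / y"
    proof -
      have "0 \<le> (y - 1) * (2 - y)" using that by simp
      thus ?thesis using that by (simp add: field_simps)
    qed
    ultimately show ?thesis by linarith
  qed
  have le: "ln y - (y - 1) / 2 \<le> 0" if "0 < y" "y \<le> 1" for y :: real
    using ln_le_minus_one[of y] that by simp
  have "h 1 \<le> h x"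
  proof (cases "1 \<le> x")
    case True
    show ?thesis
    proof (rule DERIV_nonneg_imp_nondecreasing[OF True])
      fix y assume "1 \<le> y" "y \<le> x"
      thus "\<exists>d. DERIV h y :> d \<and> 0 \<le> d" using der[of y] ge[of y] assms by auto
    qed
  next
    case F: False
    show ?thesis
    proof (rule DERIV_nonpos_imp_nonincreasing[of x 1 h])
      fix y assume "x \<le> y" "y \<le> 1"
      thus "\<exists>d. DERIV h y :> d \<and> d \<le> 0" using der[of y] le[of y] x by auto
    qed (use F in simp)
  qed
  thus ?thesis by (simp add: h_def)
qed (use assms in simp)

text \<open>Rescale both points by their mean: they become \<open>1 + r\<close> and \<open>1 - r\<close> in \<open>[0, 2]\<close>, the linear terms of
the quadratic bound cancel, and the gaps add up.\<close>

lemma entropy_two_point: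
  fixes P Q :: real
  assumes "0 \<le> P" "0 \<le> Q" "0 < P + Q"
  defines "t \<equiv> (P + Q) / 2"
  shows "(P - Q)\<^sup>2 / (16 * t) \<le> (P * ln P + Q * ln Q) / 2 - t * ln t"
proof -
  have t: "0 < t" using assms by simp
  have key: "(R - t) + (R - t)\<^sup>2 / (4 * t) \<le> R * ln R - R * ln t" if "0 \<le> R" "R \<le> 2 * t" for R
  proof (cases "R = 0")
    case False
    have "(R/t - 1) + (R/t - 1)\<^sup>2 / 4 \<le> R/t * ln (R/t)"
      by (rule x_ln_x_ge_quadratic) (use that t in \<open>auto simp: field_simps\<close>)
    hence "t * ((R/t - 1) + (R/t - 1)\<^sup>2 / 4) \<le> t * (R/t * ln (R/t))"
      using t by (intro mult_left_mono) simp_all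
    moreover have "t * (R/t * ln (R/t)) = R * ln R - R * ln t"
      using t that False by (simp add: ln_div algebra_simps)
    moreover have "t * ((R/t - 1) + (R/t - 1)\<^sup>2 / 4) = (R - t) + (R - t)\<^sup>2 / (4 * t)"
      using t by (simp add: field_simps power2_eq_square)
    ultimately show ?thesis by simp
  qed (use t in \<open>simp add: power2_eq_square\<close>)
  have "(P - t) + (P - t)\<^sup>2 / (4 * t) + ((Q - t) + (Q - t)\<^sup>2 / (4 * t))
      \<le> P * ln P - P * ln t + (Q * ln Q - Q * ln t)"
    by (intro add_mono key) (use assms in \<open>auto simp: field_simps\<close>)
  moreover have "(P - t) + (P - t)\<^sup>2 / (4 * t) + ((Q - t) + (Q - t)\<^sup>2 / (4 * t))
     = 2 * ((P - Q)\<^sup>2 / (16 * t))"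
  proof -
    have d: "P - t = (P - Q) / 2" "Q - t = - ((P - Q) / 2)" by (simp_all add: t_def field_simps)
    show ?thesis unfolding d by (simp add: power_divide)
  qed
  moreover have "P * ln P - P * ln t + (Q * ln Q - Q * ln t) = 2 * ((P * ln P + Q * ln Q) / 2 - t * ln t)"
    using t by (simp add: t_def field_simps)
  moreover have "c \<le> d" if "a \<le> b" "a = 2 * c" "b = 2 * d" for a b c d :: real
    using that by simp
  ultimately show ?thesis by blast
qed

text \<open>The Bellman function of a complex average \<open>x\<close> and the average \<open>y \<ge> |x|\<close> of its modulus. The entropy
\<open>y ln y\<close> sees only oscillation of the modulus; the convex term \<open>|x|\<^sup>2 / y\<close> sees that of the phase.\<close>

definition bellman :: "complex \<Rightarrow> real \<Rightarrow> real" where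
  "bellman x y = (norm x)\<^sup>2 / y + 4 * (y * ln y)"

text \<open>The defect of \<open>|x|\<^sup>2 / y\<close> is \<open>|Q p - P q|\<^sup>2 / (4 P Q t)\<close>, and \<open>t (p - q) = (Q p - P q) + e (p + q)\<close> with
\<open>e = (P - Q) / 2\<close>. The second summand is at most \<open>2 |e| t\<close>, which the defect of the entropy absorbs.\<close>

lemma bellman_two_point:
  fixes p q :: complex and P Q :: real
  assumes p: "norm p \<le> P" and q: "norm q \<le> Q"
  defines "t \<equiv> (P + Q) / 2"
  shows "(norm (p - q))\<^sup>2 / t \<le> 8 * ((bellman p P + bellman q Q) / 2 - bellman ((p + q) / 2) t)"
proof (cases "P + Q = 0")
  case True
  hence "P = 0" "Q = 0" using p q norm_ge_zero[of p] norm_ge_zero[of q] by linarith+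
  thus ?thesis using p q by (simp add: bellman_def t_def)
next
  case False
  have P: "0 \<le> P" and Q: "0 \<le> Q" using p q norm_ge_zero order_trans by blast+
  have t: "0 < t" using P Q False by (simp add: t_def)
  define e where "e = (P - Q) / 2"
  have ent: "e\<^sup>2 / t \<le> 4 * ((P * ln P + Q * ln Q) / 2 - t * ln t)"
  proof -
    have "(P - Q)\<^sup>2 / (16 * t) \<le> (P * ln P + Q * ln Q) / 2 - t * ln t"
      using entropy_two_point[of P Q] P Q False unfolding t_def by simp
    moreover have "e\<^sup>2 / t = 4 * ((P - Q)\<^sup>2 / (16 * t))" by (simp add: e_def power_divide)
    moreover have "a \<le> 4 * b" if "u \<le> b" "a = 4 * u" for a u b :: real using that by simp
    ultimately show ?thesis by blast
  qed
  define D where "D = ((norm p)\<^sup>2 / P + (norm q)\<^sup>2 / Q) / 2 - (norm ((p + q) / 2))\<^sup>2 / t"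
  have quad: "(norm (p - q))\<^sup>2 / t \<le> 8 * D + 8 * (e\<^sup>2 / t)"
  proof (cases "P = 0 \<or> Q = 0")
    case True
    hence True': "p = 0 \<and> P = 0 \<or> q = 0 \<and> Q = 0" using p q by auto
    have D0: "D = 0"
      using True' by (auto simp: D_def t_def power_divide norm_divide)
    have "norm (p - q) \<le> 2 * \<bar>e\<bar>"
      using True' p q by (auto simp: e_def)
    hence "(norm (p - q))\<^sup>2 \<le> (2 * \<bar>e\<bar>)\<^sup>2" by (intro power_mono) auto
    hence "(norm (p - q))\<^sup>2 \<le> 4 * e\<^sup>2" by (simp add: power_mult_distrib)
    also have "4 * e\<^sup>2 \<le> 8 * e\<^sup>2" by simp
    finally have "(norm (p - q))\<^sup>2 \<le> 8 * e\<^sup>2" .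
    hence "(norm (p - q))\<^sup>2 / t \<le> 8 * e\<^sup>2 / t" using t by (intro divide_right_mono) auto
    thus ?thesis using D0 by simp
  next
    case F: False
    hence PQ: "0 < P" "0 < Q" using P Q by auto
    define c where "c = of_real Q * p - of_real P * q"
    have Did: "D = (norm c)\<^sup>2 / (4 * P * Q * t)"
    proof -
      define A B G where "A = (norm p)\<^sup>2" and "B = (norm q)\<^sup>2" and "G = Re (p * cnj q)"
      have 1: "(norm (p + q))\<^sup>2 = A + B + 2 * G"
        unfolding A_def B_def G_def cmod_power2 by (simp add: power2_eq_square algebra_simps)
      have 2: "(norm c)\<^sup>2 = Q * Q * A + P * P * B - 2 * P * Q * G"
        unfolding c_def A_def B_def G_def cmod_power2 by (simp add: power2_eq_square algebra_simps)
      have 3: "(A / P + B / Q) / 2 - (A + B + 2 * G) / 4 / t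
          = (Q * Q * A + P * P * B - 2 * P * Q * G) / (4 * P * Q * t)"
      proof -
        have "(A / P + B / Q) / 2 = (Q * A + P * B) / (2 * P * Q)"
          using PQ by (simp add: field_simps)
        also have "\<dots> = (Q * A + P * B) * (2 * t) / (4 * P * Q * t)"
          using nonzero_mult_divide_mult_cancel_right[of "2 * t" "Q * A + P * B" "2 * P * Q"] t
          by (simp add: mult_ac)
        finally have "(A / P + B / Q) / 2 = (Q * A + P * B) * (2 * t) / (4 * P * Q * t)" .
        moreover have "(A + B + 2 * G) / 4 / t = P * Q * (A + B + 2 * G) / (4 * P * Q * t)"
          using PQ by simp
        moreover have "(Q * A + P * B) * (2 * t) - P * Q * (A + B + 2 * G)
            = Q * Q * A + P * P * B - 2 * P * Q * G"
          unfolding t_def by (simp add: algebra_simps)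
        ultimately show ?thesis by (simp only: diff_divide_distrib[symmetric])
      qed
      have 4: "(norm ((p + q) / 2))\<^sup>2 = (A + B + 2 * G) / 4"
        unfolding 1[symmetric] by (simp add: norm_divide power_divide)
      show ?thesis unfolding D_def A_def[symmetric] B_def[symmetric] 2 4 by (rule 3)
    qed
    have "of_real t * (p - q) = c + of_real e * (p + q)"
      by (simp add: complex_eq_iff c_def t_def e_def algebra_simps add_divide_distrib diff_divide_distrib)
    hence "norm (of_real t * (p - q)) \<le> norm c + norm (of_real e * (p + q))"
      using norm_triangle_ineq[of c "of_real e * (p + q)"] by simp
    hence "t * norm (p - q) \<le> norm c + \<bar>e\<bar> * norm (p + q)"
      using t by (simp add: norm_mult)
    also have "\<dots> \<le> norm c + \<bar>e\<bar> * (2 * t)"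
      using p q norm_triangle_ineq[of p q] by (intro add_left_mono mult_left_mono) (auto simp: t_def)
    finally have "(t * norm (p - q))\<^sup>2 \<le> (norm c + \<bar>e\<bar> * (2 * t))\<^sup>2"
      using t by (intro power_mono) auto
    also have "\<dots> \<le> 2 * (norm c)\<^sup>2 + 2 * (\<bar>e\<bar> * (2 * t))\<^sup>2"
      using zero_le_power2[of "norm c - \<bar>e\<bar> * (2 * t)"] by (simp add: power2_sum power2_diff)
    finally have "t\<^sup>2 * (norm (p - q))\<^sup>2 \<le> 2 * (norm c)\<^sup>2 + 8 * t\<^sup>2 * e\<^sup>2"
      by (simp add: power_mult_distrib mult_ac)
    hence "t\<^sup>2 * (norm (p - q))\<^sup>2 / (t * t\<^sup>2) \<le> (2 * (norm c)\<^sup>2 + 8 * t\<^sup>2 * e\<^sup>2) / (t * t\<^sup>2)"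
      using t by (intro divide_right_mono) auto
    also have "t\<^sup>2 * (norm (p - q))\<^sup>2 / (t * t\<^sup>2) = (norm (p - q))\<^sup>2 / t"
      using t by simp
    also have "(2 * (norm c)\<^sup>2 + 8 * t\<^sup>2 * e\<^sup>2) / (t * t\<^sup>2)
        = 2 * (norm c)\<^sup>2 / (t * t\<^sup>2) + 8 * (e\<^sup>2 / t)"
      using t by (simp add: add_divide_distrib)
    also have "2 * (norm c)\<^sup>2 / (t * t\<^sup>2) \<le> 2 * (norm c)\<^sup>2 / (t * (P * Q))"
    proof (intro divide_left_mono mult_left_mono)
      have "0 \<le> (P - Q)\<^sup>2" by simp
      thus "P * Q \<le> t\<^sup>2" unfolding t_def by (simp add: power2_eq_square field_simps)
    qed (use t PQ in auto)
    also have "\<dots> = 8 * D" using t PQ by (simp add: Did field_simps)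
    finally show ?thesis by simp
  qed
  have "(bellman p P + bellman q Q) / 2 - bellman ((p + q) / 2) t
     = D + 4 * ((P * ln P + Q * ln Q) / 2 - t * ln t)"
    by (simp add: bellman_def D_def field_simps)
  moreover have "a \<le> 8 * X" if "X = D + 4 * u" "a \<le> 8 * D + 8 * v" "v \<le> 4 * u" for a u v X :: real
    using that by simp
  ultimately show ?thesis using quad ent by blast
qed

lemma bellman_upper:
  assumes "norm x \<le> y" "y \<le> exp (real n + 1)"
  shows "bellman x y \<le> (4 * real n + 5) * y"
proof (cases "y = 0")
  case False
  have y: "0 < y" using assms False norm_ge_zero[of x] by linarith
  have "(norm x)\<^sup>2 \<le> y * y" using assms y by (simp add: power2_eq_square mult_mono)
  hence "(norm x)\<^sup>2 / y \<le> y" using y by (simp add: field_simps)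
  moreover have "ln y \<le> real n + 1" using assms y by (metis ln_exp ln_le_cancel_iff exp_gt_zero)
  hence "y * ln y \<le> y * (real n + 1)" using y by simp
  ultimately show ?thesis unfolding bellman_def by (simp add: algebra_simps)
qed (simp add: bellman_def)

text \<open>The minimum of \<open>y ln y + n y\<close> is of size \<open>exp (- n)\<close>: where \<open>y\<close> is smaller than that, its logarithm is
not comparable to \<open>n\<close>, and this additive error takes over.\<close>

lemma bellman_lower:
  assumes "norm x \<le> y"
  shows "- bellman x y \<le> 4 * (real n * y + exp (- real n))"
proof (cases "y = 0")
  case False
  have y: "0 < y" using assms False norm_ge_zero[of x] by linarith
  have "ln (exp (- real n) / y) \<le> exp (- real n) / y - 1" using y by (intro ln_le_minus_one) simp
  hence "- real n - ln y \<le> exp (- real n) / y - 1" using y by (simp add: ln_div)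
  hence "y * (- real n - ln y) \<le> y * (exp (- real n) / y - 1)" using y by simp
  hence "- (y * ln y) \<le> real n * y + exp (- real n)" using y by (simp add: algebra_simps)
  moreover have "0 \<le> (norm x)\<^sup>2 / y" using y by simp
  moreover have "- (a + 4 * b) \<le> 4 * d" if "- b \<le> d" "0 \<le> a" for a b d :: real
    using that by simp
  ultimately show ?thesis unfolding bellman_def by blast
qed (simp add: bellman_def)

section \<open>Sliding averages and their energy\<close>

definition slide :: "real \<Rightarrow> (real \<Rightarrow> 'a::{banach,second_countable_topology}) \<Rightarrow> real \<Rightarrow> 'a" where
  "slide d w x = (LINT y|lborel. indicator {x..<x + d} y *\<^sub>R w y) /\<^sub>R d"

lemma indicator_Ico: "indicator {x..<x + d} y = (if x \<le> y \<and> y < x + (d::real) then 1 else 0)"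
  by auto

lemma slide_measurable [measurable]:
  assumes [measurable]: "w \<in> borel_measurable borel"
  shows "slide d w \<in> borel_measurable borel"
  unfolding slide_def indicator_Ico by measurable

lemma integrable_indicator_Ico [simp]:
  fixes w :: "real \<Rightarrow> 'a::{banach,second_countable_topology}"
  assumes "integrable lborel w"
  shows "integrable lborel (\<lambda>y. indicator {x..<x + d} y *\<^sub>R w y)"
  using assms by (intro integrable_mult_indicator) simp_all

lemma slide_nonneg:
  fixes w :: "real \<Rightarrow> real"
  assumes "0 < d" "\<And>y. 0 \<le> w y" shows "0 \<le> slide d w x"
  unfolding slide_def using assms by (auto intro!: integral_nonneg_AE divide_nonneg_nonneg)

lemma norm_slide_le:
  assumes "0 < d" shows "norm (slide d w x) \<le> slide d (\<lambda>y. norm (w y)) x"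
proof -
  have "norm (LINT y|lborel. indicator {x..<x + d} y *\<^sub>R w y)
      \<le> (LINT y|lborel. norm (indicator {x..<x + d} y *\<^sub>R w y))" by (rule integral_norm_bound)
  thus ?thesis using assms by (simp add: slide_def divide_right_mono)
qed

lemma slide_le_bound:
  fixes w :: "real \<Rightarrow> real"
  assumes d: "0 < d" and w: "integrable lborel w" and W: "\<And>y. w y \<le> W"
  shows "slide d w x \<le> W"
proof -
  have "(LINT y|lborel. indicator {x..<x + d} y *\<^sub>R w y) \<le> (LINT y|lborel. indicator {x..<x + d} y *\<^sub>R W)"
  proof (rule integral_mono)
    have "integrable lborel (indicator {x..<x + d} :: real \<Rightarrow> real)"
      by (rule integrable_real_indicator) (use d in simp_all)
    thus "integrable lborel (\<lambda>y. indicator {x..<x + d} y *\<^sub>R W)" by simp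
  qed (use integrable_indicator_Ico[OF w] W in \<open>auto intro: mult_left_mono\<close>)
  also have "\<dots> = W * d" using d by simp
  finally show ?thesis using d by (simp add: slide_def field_simps)
qed

lemma slide_eq_0:
  assumes "\<And>y. y \<notin> {a..b} \<Longrightarrow> w y = 0" "x \<notin> {a - d..b}"
  shows "slide d w x = 0"
proof -
  have "(\<lambda>y. indicator {x..<x + d} y *\<^sub>R w y) = (\<lambda>y. 0)"
  proof
    fix y show "indicator {x..<x + d} y *\<^sub>R w y = 0"
      using assms(1)[of y] assms(2) by (cases "y \<in> {a..b}") (auto simp: indicator_def)
  qed
  thus ?thesis by (simp add: slide_def)
qed

text \<open>Half-open windows make the averages at scale \<open>d / 2\<close> split the one at scale \<open>d\<close> exactly.\<close>

lemma slide_halve: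
  assumes d: "0 < d" and w: "integrable lborel w"
  shows "slide d w x = (slide (d / 2) w x + slide (d / 2) w (d / 2 + x)) /\<^sub>R 2"
proof -
  have "indicator {x..<x + d} y *\<^sub>R w y = indicator {x..<x + d / 2} y *\<^sub>R w y
      + indicator {(d / 2 + x)..<(d / 2 + x) + d / 2} y *\<^sub>R w y" for y
    using d by (auto simp: indicator_def)
  hence "(LINT y|lborel. indicator {x..<x + d} y *\<^sub>R w y)
     = (LINT y|lborel. indicator {x..<x + d / 2} y *\<^sub>R w y)
      + (LINT y|lborel. indicator {(d / 2 + x)..<(d / 2 + x) + d / 2} y *\<^sub>R w y)"
    by (simp only:) (intro Bochner_Integration.integral_add integrable_indicator_Ico w)
  thus ?thesis by (simp add: slide_def scaleR_add_right inverse_eq_divide)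
qed

lemma ennreal_slide:
  fixes w :: "real \<Rightarrow> real"
  assumes d: "0 < d" and w: "integrable lborel w" and nn: "\<And>y. 0 \<le> w y"
  shows "ennreal (slide d w x) = ennreal (1 / d) * (\<integral>\<^sup>+y. indicator {x..<x + d} y * ennreal (w y) \<partial>lborel)"
proof -
  have "(\<integral>\<^sup>+y. indicator {x..<x + d} y * ennreal (w y) \<partial>lborel)
      = (\<integral>\<^sup>+y. ennreal (indicator {x..<x + d} y *\<^sub>R w y) \<partial>lborel)"
    by (intro nn_integral_cong) (auto simp: indicator_def)
  also have "\<dots> = ennreal (LINT y|lborel. indicator {x..<x + d} y *\<^sub>R w y)"
    by (intro nn_integral_eq_integral integrable_indicator_Ico w) (use nn in \<open>auto simp: indicator_def\<close>)
  finally show ?thesis using d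
    by (simp add: slide_def ennreal_mult'[symmetric] inverse_eq_divide)
qed

lemma nn_integral_Ico_flip:
  assumes "0 < d"
  shows "(\<integral>\<^sup>+x. indicator {x..<x + d} y \<partial>lborel) = ennreal d"
proof -
  have "(\<integral>\<^sup>+x. indicator {x..<x + d} y \<partial>lborel) = (\<integral>\<^sup>+x. indicator {y - d<..y} x \<partial>lborel)"
    by (intro nn_integral_cong) (auto simp: indicator_def)
  thus ?thesis using assms by simp
qed

lemma nn_integral_slide:
  fixes w :: "real \<Rightarrow> real"
  assumes d: "0 < d" and w: "integrable lborel w" and nn: "\<And>y. 0 \<le> w y"
  shows "(\<integral>\<^sup>+x. ennreal (slide d w x) \<partial>lborel) = (\<integral>\<^sup>+y. ennreal (w y) \<partial>lborel)"
proof -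
  have [measurable]: "w \<in> borel_measurable borel" using w by auto
  have "(\<integral>\<^sup>+x. ennreal (slide d w x) \<partial>lborel)
     = (\<integral>\<^sup>+x. ennreal (1 / d) * (\<integral>\<^sup>+y. indicator {x..<x + d} y * ennreal (w y) \<partial>lborel) \<partial>lborel)"
    by (simp add: ennreal_slide[OF d w nn])
  also have "\<dots> = ennreal (1 / d) * (\<integral>\<^sup>+x. (\<integral>\<^sup>+y. indicator {x..<x + d} y * ennreal (w y) \<partial>lborel) \<partial>lborel)"
    by (rule nn_integral_cmult) (unfold indicator_Ico, measurable)
  also have "(\<integral>\<^sup>+x. (\<integral>\<^sup>+y. indicator {x..<x + d} y * ennreal (w y) \<partial>lborel) \<partial>lborel)
     = (\<integral>\<^sup>+y. (\<integral>\<^sup>+x. indicator {x..<x + d} y * ennreal (w y) \<partial>lborel) \<partial>lborel)"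
    by (rule lborel_pair.Fubini') (unfold indicator_Ico, measurable)
  also have "\<dots> = (\<integral>\<^sup>+y. ennreal d * ennreal (w y) \<partial>lborel)"
  proof (rule nn_integral_cong)
    fix y
    have "(\<integral>\<^sup>+x. indicator {x..<x + d} y * ennreal (w y) \<partial>lborel)
       = (\<integral>\<^sup>+x. indicator {x..<x + d} y \<partial>lborel) * ennreal (w y)"
      by (rule nn_integral_multc) (unfold indicator_Ico, measurable)
    thus "(\<integral>\<^sup>+x. indicator {x..<x + d} y * ennreal (w y) \<partial>lborel) = ennreal d * ennreal (w y)"
      by (simp add: nn_integral_Ico_flip[OF d])
  qed
  also have "\<dots> = ennreal d * (\<integral>\<^sup>+y. ennreal (w y) \<partial>lborel)" by (rule nn_integral_cmult) measurable
  finally show ?thesis using d by (simp add: mult.assoc[symmetric] ennreal_mult'[symmetric])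
qed

text \<open>Averaging preserves the integral; this is what makes the total potential below comparable at all
scales.\<close>

lemma integrable_slide:
  fixes w :: "real \<Rightarrow> real"
  assumes d: "0 < d" and w: "integrable lborel w" and nn: "\<And>y. 0 \<le> w y"
  shows "integrable lborel (slide d w)" "(LINT x|lborel. slide d w x) = (LINT y|lborel. w y)"
proof -
  have [measurable]: "w \<in> borel_measurable borel" using w by auto
  have eq: "(\<integral>\<^sup>+x. ennreal (slide d w x) \<partial>lborel) = ennreal (LINT y|lborel. w y)"
    using nn_integral_slide[OF assms] nn_integral_eq_integral[OF w] nn by simp
  show "integrable lborel (slide d w)"
    by (rule integrableI_nonneg) (use slide_nonneg[OF d] nn eq in auto)
  show "(LINT x|lborel. slide d w x) = (LINT y|lborel. w y)"
    by (subst integral_eq_nn_integral) (use slide_nonneg[OF d] nn eq in \<open>auto intro!: integral_nonneg_AE\<close>)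
qed

text \<open>The difference of the two averages at scale \<open>d / 2\<close> that make up \<open>slide d w x\<close>: up to a
factor, the martingale difference at scale \<open>d\<close>.\<close>

definition jump :: "real \<Rightarrow> (real \<Rightarrow> complex) \<Rightarrow> real \<Rightarrow> complex" where
  "jump d w x = slide (d / 2) w (d / 2 + x) - slide (d / 2) w x"

abbreviation mass :: "real \<Rightarrow> (real \<Rightarrow> complex) \<Rightarrow> real \<Rightarrow> real" where
  "mass d w \<equiv> slide d (\<lambda>y. norm (w y))"

lemma jump_measurable [measurable]:
  assumes [measurable]: "w \<in> borel_measurable borel"
  shows "jump d w \<in> borel_measurable borel"
  unfolding jump_def by measurable

lemma norm_jump_le:
  assumes d: "0 < d" and w: "integrable lborel w"
  shows "norm (jump d w x) \<le> 2 * mass d w x"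
proof -
  have "norm (jump d w x) \<le> norm (slide (d / 2) w (d / 2 + x)) + norm (slide (d / 2) w x)"
    unfolding jump_def by (rule norm_triangle_ineq4)
  also have "\<dots> \<le> mass (d / 2) w (d / 2 + x) + mass (d / 2) w x"
    by (intro add_mono norm_slide_le) (use d in auto)
  also have "\<dots> = 2 * mass d w x"
    using slide_halve[OF d integrable_norm[OF w], of x] by simp
  finally show ?thesis .
qed

definition potential :: "(real \<Rightarrow> complex) \<Rightarrow> real \<Rightarrow> real" where
  "potential w d = (LINT x|lborel. bellman (slide d w x) (mass d w x))"

lemma bellman_measurable [measurable]:
  assumes [measurable]: "f \<in> borel_measurable M" "g \<in> borel_measurable M"
  shows "(\<lambda>x. bellman (f x) (g x)) \<in> borel_measurable M"
  unfolding bellman_def by measurable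

lemma bellman_abs_le:
  assumes "norm x \<le> y" "y \<le> exp (real n + 1)"
  shows "\<bar>bellman x y\<bar> \<le> (8 * real n + 5) * y + 4 * exp (- real n)"
proof -
  have y: "0 \<le> y" using assms(1) norm_ge_zero order_trans by blast
  have "bellman x y \<le> (4 * real n + 5) * y" "- bellman x y \<le> 4 * (real n * y + exp (- real n))"
    by (rule bellman_upper bellman_lower assms)+
  moreover have "0 \<le> real n * y" using y by simp
  moreover have "0 < exp (- real n)" by simp
  ultimately show ?thesis unfolding abs_le_iff distrib_left distrib_right mult.assoc using y by linarith
qed

text \<open>The bound from below sees the length of the support of the averages, which spills over \<open>[a, b]\<close> by
\<open>d\<close>: the error \<open>exp (- n)\<close> is paid at each of its points.\<close>

lemma
  fixes w :: "real \<Rightarrow> complex" and n :: nat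
  assumes w: "integrable lborel w" and supp: "\<And>y. y \<notin> {a..b} \<Longrightarrow> w y = 0"
    and bd: "\<And>y. norm (w y) \<le> exp (real n + 1)" and ab: "a \<le> b" and d: "0 < d"
  shows integrable_potential: "integrable lborel (\<lambda>x. bellman (slide d w x) (mass d w x))"
    and potential_upper: "potential w d \<le> (4 * real n + 5) * (LINT y|lborel. norm (w y))"
    and potential_lower: "- potential w d
        \<le> 4 * (real n * (LINT y|lborel. norm (w y)) + exp (- real n) * (b - a + d))"
proof -
  have [measurable]: "w \<in> borel_measurable borel" using w by auto
  have nw: "integrable lborel (\<lambda>y. norm (w y))" using w by (rule integrable_norm)
  have le: "norm (slide d w x) \<le> mass d w x" for x by (rule norm_slide_le[OF d])
  have m: "mass d w x \<le> exp (real n + 1)" for x by (rule slide_le_bound[OF d nw bd])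
  have im: "integrable lborel (mass d w)" and mi: "(LINT x|lborel. mass d w x) = (LINT y|lborel. norm (w y))"
    by (rule integrable_slide[OF d nw]; simp)+
  have ind: "integrable lborel (indicator {a - d..b} :: real \<Rightarrow> real)"
    by (rule integrable_real_indicator) (simp_all add: emeasure_lborel_Icc_eq)
  have out: "slide d w x = 0" "mass d w x = 0" if "x \<notin> {a - d..b}" for x
    by (rule slide_eq_0[of a b, OF _ that], use supp in simp)+
  have ab': "\<bar>bellman (slide d w x) (mass d w x)\<bar>
      \<le> (8 * real n + 5) * mass d w x + 4 * exp (- real n) * indicator {a - d..b} x" for x
  proof (cases "x \<in> {a - d..b}")
    case True
    thus ?thesis using bellman_abs_le[OF le m, of x] by simp
  next
    case False
    thus ?thesis by (simp add: out bellman_def)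
  qed
  have mn: "0 \<le> mass d w x" for x by (rule slide_nonneg[OF d]) simp
  show int: "integrable lborel (\<lambda>x. bellman (slide d w x) (mass d w x))"
  proof (rule Bochner_Integration.integrable_bound)
    show "integrable lborel (\<lambda>x. (8 * real n + 5) * mass d w x + 4 * exp (- real n) * indicator {a - d..b} x)"
      by (intro Bochner_Integration.integrable_add integrable_mult_right im ind)
    show "AE x in lborel. norm (bellman (slide d w x) (mass d w x))
        \<le> norm ((8 * real n + 5) * mass d w x + 4 * exp (- real n) * indicator {a - d..b} x)"
      using ab' mn by (intro AE_I2) (metis abs_ge_self order_trans real_norm_def)
  qed measurable
  have "potential w d \<le> (LINT x|lborel. (4 * real n + 5) * mass d w x)"
    unfolding potential_def
    by (intro integral_mono int integrable_mult_right im bellman_upper le m)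
  thus "potential w d \<le> (4 * real n + 5) * (LINT y|lborel. norm (w y))" using mi by simp
  have "(LINT x|lborel. - bellman (slide d w x) (mass d w x))
     \<le> (LINT x|lborel. 4 * real n * mass d w x + 4 * exp (- real n) * indicator {a - d..b} x)"
  proof (intro integral_mono integrable_minus int Bochner_Integration.integrable_add integrable_mult_right im ind)
    fix x show "- bellman (slide d w x) (mass d w x) \<le> 4 * real n * mass d w x + 4 * exp (- real n) * indicator {a - d..b} x"
    proof (cases "x \<in> {a - d..b}")
      case True
      thus ?thesis using bellman_lower[OF le, of x n] by simp
    next
      case False
      thus ?thesis by (simp add: out bellman_def)
    qed
  qed
  also have "\<dots> = 4 * real n * (LINT y|lborel. norm (w y)) + 4 * exp (- real n) * (b - a + d)"
    using ab d mi im ind by simp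
  finally show "- potential w d
        \<le> 4 * (real n * (LINT y|lborel. norm (w y)) + exp (- real n) * (b - a + d))"
    unfolding potential_def by (simp add: algebra_simps)
qed

text \<open>By translation invariance both averages at scale \<open>d / 2\<close> have the same total potential, so the
two-point inequality integrates to a difference of potentials.\<close>

lemma energy_step:
  fixes w :: "real \<Rightarrow> complex" and n :: nat
  assumes w: "integrable lborel w" and supp: "\<And>y. y \<notin> {a..b} \<Longrightarrow> w y = 0"
    and bd: "\<And>y. norm (w y) \<le> exp (real n + 1)" and ab: "a \<le> b" and d: "0 < d"
  shows "integrable lborel (\<lambda>x. (norm (jump d w x))\<^sup>2 / mass d w x)"
    "(LINT x|lborel. (norm (jump d w x))\<^sup>2 / mass d w x) \<le> 8 * (potential w (d / 2) - potential w d)"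
proof -
  have [measurable]: "w \<in> borel_measurable borel" using w by auto
  have d2: "0 < d / 2" using d by simp
  define \<Psi> where "\<Psi> = (\<lambda>d x. bellman (slide d w x) (mass d w x))"
  have i1: "integrable lborel (\<Psi> d)" unfolding \<Psi>_def by (rule integrable_potential[OF w supp bd ab d])
  have i2: "integrable lborel (\<Psi> (d / 2))" unfolding \<Psi>_def by (rule integrable_potential[OF w supp bd ab d2])
  have i3: "integrable lborel (\<lambda>x. \<Psi> (d / 2) (d / 2 + x))"
    using lborel_integrable_real_affine[OF i2, of 1 "d / 2"] by simp
  have e3: "(LINT x|lborel. \<Psi> (d / 2) (d / 2 + x)) = (LINT x|lborel. \<Psi> (d / 2) x)"
    using lborel_integral_real_affine[of 1 "\<Psi> (d / 2)" "d / 2"] by simp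
  define R where "R = (\<lambda>x. 8 * ((\<Psi> (d / 2) (d / 2 + x) + \<Psi> (d / 2) x) / 2 - \<Psi> d x))"
  have iR: "integrable lborel R" unfolding R_def using i1 i2 i3 by simp
  have le: "(norm (jump d w x))\<^sup>2 / mass d w x \<le> R x" for x
  proof -
    have e1: "slide d w x = (slide (d / 2) w (d / 2 + x) + slide (d / 2) w x) / 2"
      using slide_halve[OF d w, of x] by (simp add: add.commute scaleR_conv_of_real)
    have e2: "mass d w x = (mass (d / 2) w (d / 2 + x) + mass (d / 2) w x) / 2"
      using slide_halve[OF d integrable_norm[OF w], of x] by simp
    show ?thesis unfolding R_def \<Psi>_def jump_def e1 e2
      by (rule bellman_two_point[OF norm_slide_le[OF d2] norm_slide_le[OF d2]])
  qed
  have mn: "0 \<le> mass d w x" for x by (rule slide_nonneg[OF d]) simp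
  show i: "integrable lborel (\<lambda>x. (norm (jump d w x))\<^sup>2 / mass d w x)"
  proof (rule Bochner_Integration.integrable_bound[OF iR])
    show "AE x in lborel. norm ((norm (jump d w x))\<^sup>2 / mass d w x) \<le> norm (R x)"
    proof (rule AE_I2)
      fix x
      have "0 \<le> (norm (jump d w x))\<^sup>2 / mass d w x" using mn by simp
      thus "norm ((norm (jump d w x))\<^sup>2 / mass d w x) \<le> norm (R x)" using le[of x] by simp
    qed
  qed measurable
  have "(LINT x|lborel. (norm (jump d w x))\<^sup>2 / mass d w x) \<le> (LINT x|lborel. R x)"
    by (rule integral_mono[OF i iR le])
  also have "\<dots> = 8 * (potential w (d / 2) - potential w d)"
    unfolding R_def using i1 i2 i3 e3 by (simp add: potential_def \<Psi>_def)
  finally show "(LINT x|lborel. (norm (jump d w x))\<^sup>2 / mass d w x) \<le> 8 * (potential w (d / 2) - potential w d)" .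
qed

text \<open>The potentials telescope. The last one is bounded through \<open>ln |w| \<le> n + 1\<close> and the first one through
the minimum of the entropy; no limit of the averages is taken.\<close>

lemma energy_sum:
  fixes w :: "real \<Rightarrow> complex" and n :: nat
  assumes w: "integrable lborel w" and supp: "\<And>y. y \<notin> {a..b} \<Longrightarrow> w y = 0"
    and bd: "\<And>y. norm (w y) \<le> exp (real n + 1)" and ab: "a < b" and d: "0 < d" "d \<le> b - a"
  shows "(\<Sum>j<N. LINT x|lborel. (norm (jump (d / 2 ^ j) w x))\<^sup>2 / mass (d / 2 ^ j) w x)
     \<le> (64 * real n + 40) * (LINT y|lborel. norm (w y)) + 64 * exp (- real n) * (b - a)"
proof -
  have "(\<Sum>j<N. LINT x|lborel. (norm (jump (d / 2 ^ j) w x))\<^sup>2 / mass (d / 2 ^ j) w x)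
     \<le> (\<Sum>j<N. 8 * (potential w (d / 2 ^ Suc j) - potential w (d / 2 ^ j)))"
  proof (rule sum_mono)
    fix j
    have "0 < d / 2 ^ j" using d by simp
    from energy_step(2)[OF w supp bd less_imp_le[OF ab] this]
    show "(LINT x|lborel. (norm (jump (d / 2 ^ j) w x))\<^sup>2 / mass (d / 2 ^ j) w x)
      \<le> 8 * (potential w (d / 2 ^ Suc j) - potential w (d / 2 ^ j))" by (simp add: mult.commute)
  qed
  also have "\<dots> = 8 * (potential w (d / 2 ^ N) - potential w d)"
    unfolding sum_distrib_left[symmetric] sum_lessThan_telescope[of "\<lambda>j. potential w (d / 2 ^ j)"] by simp
  also have "\<dots> \<le> 8 * ((4 * real n + 5) * (LINT y|lborel. norm (w y))
       + 4 * (real n * (LINT y|lborel. norm (w y)) + exp (- real n) * (b - a + d)))"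
  proof -
    have "potential w (d / 2 ^ N) \<le> (4 * real n + 5) * (LINT y|lborel. norm (w y))"
      by (rule potential_upper[OF w supp bd less_imp_le[OF ab]]) (use d in simp_all)
    moreover have "- potential w d
      \<le> 4 * (real n * (LINT y|lborel. norm (w y)) + exp (- real n) * (b - a + d))"
      by (rule potential_lower[OF w supp bd less_imp_le[OF ab] d(1)])
    ultimately show ?thesis by simp
  qed
  also have "\<dots> \<le> 8 * ((4 * real n + 5) * (LINT y|lborel. norm (w y))
       + 4 * (real n * (LINT y|lborel. norm (w y)) + exp (- real n) * (2 * (b - a))))"
    using d by simp
  finally show ?thesis by (simp add: algebra_simps)
qed

section \<open>Lifting the increments of sliding averages\<close>

text \<open>The window lies behind the point, in contrast to \<open>slide\<close>: this makes the two averages adjoint.\<close>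

definition trail :: "real \<Rightarrow> (real \<Rightarrow> real) \<Rightarrow> real \<Rightarrow> real" where
  "trail d r y = (LINT z|lborel. indicator {y - d<..y} z * r z) / d"

definition ratio :: "real \<Rightarrow> (real \<Rightarrow> complex) \<Rightarrow> real \<Rightarrow> real" where
  "ratio d w z = norm (jump d w z) / mass d w z"

text \<open>If \<open>|w|\<close> were constant near \<open>y\<close>, this would be the local average of \<open>|jump d w|\<close>. In general it
moves that average to the places that carry the mass of \<open>w\<close>.\<close>

definition lift :: "real \<Rightarrow> (real \<Rightarrow> complex) \<Rightarrow> real \<Rightarrow> real" where
  "lift d w y = norm (w y) * trail d (ratio d w) y"

lemma indicator_Ioc: "indicator {y - d<..y} z = (if y - d < z \<and> z \<le> (y::real) then 1 else 0)"
  by auto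

lemma trail_measurable [measurable]:
  assumes [measurable]: "r \<in> borel_measurable borel"
  shows "trail d r \<in> borel_measurable borel"
  unfolding trail_def indicator_Ioc by measurable

lemma integrable_trail:
  fixes r :: "real \<Rightarrow> real"
  assumes [measurable]: "r \<in> borel_measurable borel" and r: "\<And>z. \<bar>r z\<bar> \<le> B" and d: "0 < d"
  shows "integrable lborel (\<lambda>z. indicator {y - d<..y} z * r z)"
proof (rule Bochner_Integration.integrable_bound)
  have "integrable lborel (indicator {y - d<..y} :: real \<Rightarrow> real)"
    by (rule integrable_real_indicator) (use d in simp_all)
  thus "integrable lborel (\<lambda>z. indicator {y - d<..y} z * B)" by simp
  show "AE z in lborel. norm (indicator {y - d<..y} z * r z) \<le> norm (indicator {y - d<..y} z * B)"
    using r abs_ge_self[of B] order_trans by (intro AE_I2) (fastforce simp: indicator_def)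
qed measurable

lemma
  assumes [measurable]: "r \<in> borel_measurable borel"
    and r: "\<And>z. 0 \<le> r z" "\<And>z. r z \<le> B" and d: "0 < d"
  shows trail_nonneg: "0 \<le> trail d r y" and trail_le: "trail d r y \<le> B"
    and ennreal_trail: "ennreal (trail d r y) = ennreal (1 / d) * (\<integral>\<^sup>+z. indicator {z..<z + d} y * ennreal (r z) \<partial>lborel)"
    and trail_square: "(trail d r y)\<^sup>2 \<le> trail d (\<lambda>z. (r z)\<^sup>2) y"
proof -
  have ind: "integrable lborel (indicator {y - d<..y} :: real \<Rightarrow> real)"
    by (rule integrable_real_indicator) (use d in simp_all)
  have B: "0 \<le> B" using r order_trans by blast
  have i: "integrable lborel (\<lambda>z. indicator {y - d<..y} z * r z)"
    by (rule integrable_trail[where B = B]) (use r d in auto)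
  have "\<bar>(r z)\<^sup>2\<bar> \<le> B\<^sup>2" for z using r[of z] by (auto intro: power_mono)
  hence i2: "integrable lborel (\<lambda>z. indicator {y - d<..y} z * (r z)\<^sup>2)"
    by (intro integrable_trail[where B = "B\<^sup>2"]) (use d in auto)
  show nn: "0 \<le> trail d r y" unfolding trail_def using r d by (auto intro!: divide_nonneg_nonneg integral_nonneg_AE)
  have "(LINT z|lborel. indicator {y - d<..y} z * r z) \<le> (LINT z|lborel. indicator {y - d<..y} z * B)"
    by (rule integral_mono) (use i ind r in \<open>auto intro: mult_left_mono\<close>)
  also have "\<dots> = d * B" using d by simp
  finally show "trail d r y \<le> B" using d by (simp add: trail_def field_simps)
  have "(\<integral>\<^sup>+z. indicator {z..<z + d} y * ennreal (r z) \<partial>lborel)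
      = (\<integral>\<^sup>+z. ennreal (indicator {y - d<..y} z * r z) \<partial>lborel)"
    by (intro nn_integral_cong) (auto simp: indicator_def)
  also have "\<dots> = ennreal (LINT z|lborel. indicator {y - d<..y} z * r z)"
    by (rule nn_integral_eq_integral[OF i]) (use r in auto)
  finally show "ennreal (trail d r y) = ennreal (1 / d) * (\<integral>\<^sup>+z. indicator {z..<z + d} y * ennreal (r z) \<partial>lborel)"
    using d by (simp add: trail_def ennreal_mult'[symmetric])
  define c where "c = trail d r y"
  have c: "(LINT z|lborel. indicator {y - d<..y} z * r z) = c * d" using d by (simp add: c_def trail_def)
  have "0 \<le> (LINT z|lborel. indicator {y - d<..y} z * (r z - c)\<^sup>2)"
    by (intro integral_nonneg_AE) auto
  also have "\<dots> = (LINT z|lborel. indicator {y - d<..y} z * (r z)\<^sup>2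
       - 2 * c * (indicator {y - d<..y} z * r z) + c\<^sup>2 * indicator {y - d<..y} z)"
    by (intro Bochner_Integration.integral_cong) (auto simp: power2_eq_square algebra_simps)
  also have "\<dots> = (LINT z|lborel. indicator {y - d<..y} z * (r z)\<^sup>2) - 2 * c * (c * d) + c\<^sup>2 * d"
    using i i2 ind d by (simp add: c)
  finally have "c\<^sup>2 * d \<le> (LINT z|lborel. indicator {y - d<..y} z * (r z)\<^sup>2)"
    by (simp add: power2_eq_square algebra_simps)
  thus "(trail d r y)\<^sup>2 \<le> trail d (\<lambda>z. (r z)\<^sup>2) y"
    unfolding c_def[symmetric] using d by (simp add: trail_def field_simps)
qed

text \<open>Both sides integrate over the pairs with \<open>z \<le> y < z + d\<close>.\<close>

lemma trail_adjoint:
  fixes v :: "real \<Rightarrow> ennreal"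
  assumes [measurable]: "r \<in> borel_measurable borel" "v \<in> borel_measurable borel"
    and r: "\<And>z. 0 \<le> r z" "\<And>z. r z \<le> B" and d: "0 < d"
  shows "(\<integral>\<^sup>+y. v y * ennreal (trail d r y) \<partial>lborel)
    = (\<integral>\<^sup>+z. ennreal (r z) * (ennreal (1 / d) * (\<integral>\<^sup>+y. indicator {z..<z + d} y * v y \<partial>lborel)) \<partial>lborel)"
proof -
  have "(\<integral>\<^sup>+y. v y * ennreal (trail d r y) \<partial>lborel)
     = (\<integral>\<^sup>+y. \<integral>\<^sup>+z. ennreal (1 / d) * (indicator {z..<z + d} y * (ennreal (r z) * v y)) \<partial>lborel \<partial>lborel)"
  proof (rule nn_integral_cong)
    fix y
    have "v y * ennreal (trail d r y)
        = (v y * ennreal (1 / d)) * (\<integral>\<^sup>+z. indicator {z..<z + d} y * ennreal (r z) \<partial>lborel)"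
      by (subst ennreal_trail[where B = B]) (use r d in \<open>auto simp: mult_ac\<close>)
    also have "\<dots> = (\<integral>\<^sup>+z. (v y * ennreal (1 / d)) * (indicator {z..<z + d} y * ennreal (r z)) \<partial>lborel)"
      by (rule nn_integral_cmult[symmetric]) (unfold indicator_Ico, measurable)
    finally show "v y * ennreal (trail d r y) =
        (\<integral>\<^sup>+z. ennreal (1 / d) * (indicator {z..<z + d} y * (ennreal (r z) * v y)) \<partial>lborel)"
      by (simp add: mult_ac)
  qed
  also have "\<dots> = (\<integral>\<^sup>+z. \<integral>\<^sup>+y. ennreal (1 / d) * (indicator {z..<z + d} y * (ennreal (r z) * v y)) \<partial>lborel \<partial>lborel)"
    by (rule lborel_pair.Fubini') (unfold indicator_Ico, measurable)
  also have "\<dots> = (\<integral>\<^sup>+z. ennreal (r z) * (ennreal (1 / d) * (\<integral>\<^sup>+y. indicator {z..<z + d} y * v y \<partial>lborel)) \<partial>lborel)"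
  proof (rule nn_integral_cong)
    fix z
    have "ennreal (r z) * (ennreal (1 / d) * (\<integral>\<^sup>+y. indicator {z..<z + d} y * v y \<partial>lborel))
       = (ennreal (r z) * ennreal (1 / d)) * (\<integral>\<^sup>+y. indicator {z..<z + d} y * v y \<partial>lborel)"
      by (simp add: mult_ac)
    also have "\<dots> = (\<integral>\<^sup>+y. (ennreal (r z) * ennreal (1 / d)) * (indicator {z..<z + d} y * v y) \<partial>lborel)"
      by (rule nn_integral_cmult[symmetric]) (unfold indicator_Ico, measurable)
    finally show "(\<integral>\<^sup>+y. ennreal (1 / d) * (indicator {z..<z + d} y * (ennreal (r z) * v y)) \<partial>lborel)
      = ennreal (r z) * (ennreal (1 / d) * (\<integral>\<^sup>+y. indicator {z..<z + d} y * v y \<partial>lborel))"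
      by (simp add: mult_ac)
  qed
  finally show ?thesis .
qed

lemma ratio_measurable [measurable]:
  assumes [measurable]: "w \<in> borel_measurable borel"
  shows "ratio d w \<in> borel_measurable borel"
  unfolding ratio_def by measurable

lemma lift_measurable [measurable]:
  assumes [measurable]: "w \<in> borel_measurable borel"
  shows "lift d w \<in> borel_measurable borel"
  unfolding lift_def by measurable

lemma ratio_bounds:
  assumes d: "0 < d" and w: "integrable lborel w"
  shows "0 \<le> ratio d w z" "ratio d w z \<le> 2" "ratio d w z * mass d w z = norm (jump d w z)"
    "(ratio d w z)\<^sup>2 * mass d w z = (norm (jump d w z))\<^sup>2 / mass d w z"
proof -
  have m: "0 \<le> mass d w z" by (rule slide_nonneg[OF d]) simp
  have j: "norm (jump d w z) \<le> 2 * mass d w z" by (rule norm_jump_le[OF d w])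
  show "0 \<le> ratio d w z" unfolding ratio_def using m by simp
  show "ratio d w z \<le> 2" unfolding ratio_def using m j
    by (cases "mass d w z = 0") (auto simp: divide_le_eq)
  show "ratio d w z * mass d w z = norm (jump d w z)"
    unfolding ratio_def using j by auto
  show "(ratio d w z)\<^sup>2 * mass d w z = (norm (jump d w z))\<^sup>2 / mass d w z"
    unfolding ratio_def by (simp add: power_divide power2_eq_square)
qed

text \<open>Jensen's inequality moves the square inside, and the adjoint average turns \<open>|w|\<close> into \<open>mass d w\<close>,
which cancels one of the two factors in the square of the ratio.\<close>

lemma lift_energy:
  assumes d: "0 < d" and w: "integrable lborel w"
  shows "(\<integral>\<^sup>+y. ennreal (norm (w y) * (trail d (ratio d w) y)\<^sup>2) \<partial>lborel)
    \<le> (\<integral>\<^sup>+z. ennreal ((norm (jump d w z))\<^sup>2 / mass d w z) \<partial>lborel)"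
proof -
  have [measurable]: "w \<in> borel_measurable borel" using w by auto
  note rb = ratio_bounds[OF d w]
  have r4: "(ratio d w z)\<^sup>2 \<le> 4" for z using power_mono[OF rb(2,1), of z 2] by simp
  have "(\<integral>\<^sup>+y. ennreal (norm (w y) * (trail d (ratio d w) y)\<^sup>2) \<partial>lborel)
     \<le> (\<integral>\<^sup>+y. ennreal (norm (w y)) * ennreal (trail d (\<lambda>z. (ratio d w z)\<^sup>2) y) \<partial>lborel)"
    by (intro nn_integral_mono)
       (auto simp: ennreal_mult'[symmetric] intro!: ennreal_leI mult_left_mono trail_square[where B = 2] rb d)
  also have "\<dots> = (\<integral>\<^sup>+z. ennreal ((ratio d w z)\<^sup>2)
      * (ennreal (1 / d) * (\<integral>\<^sup>+y. indicator {z..<z + d} y * ennreal (norm (w y)) \<partial>lborel)) \<partial>lborel)"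
    by (rule trail_adjoint[where B = 4]) (use r4 d in auto)
  also have "\<dots> = (\<integral>\<^sup>+z. ennreal ((norm (jump d w z))\<^sup>2 / mass d w z) \<partial>lborel)"
    by (intro nn_integral_cong)
       (simp add: ennreal_slide[OF d integrable_norm[OF w], symmetric] ennreal_mult'[symmetric] rb(4))
  finally show ?thesis .
qed

lemma bump_pos: "0 < bump x" unfolding bump_def
proof -
  have "0 < 1 + \<bar>x\<bar>\<^sup>2" by (rule add_pos_nonneg) simp_all
  thus "0 < (1 + \<bar>x\<bar>\<^sup>2) powr (- 3 / 4)" by simp
qed

text \<open>\<open>1 + (t + s)\<^sup>2 \<le> 3 (1 + t\<^sup>2)\<close> for \<open>|s| \<le> 1\<close>, and \<open>bump\<close> is a power of exponent above \<open>-1\<close>.\<close>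

lemma bump_shift:
  assumes "\<bar>s\<bar> \<le> 1"
  shows "bump t / 3 \<le> bump (t + s)"
proof -
  have s: "s\<^sup>2 \<le> 1" using assms by (simp add: abs_square_le_1)
  have "0 \<le> (t - s)\<^sup>2" by simp
  hence "1 + (t + s)\<^sup>2 \<le> 3 * (1 + t\<^sup>2)" using s zero_le_square[of t] unfolding power2_eq_square ring_distribs by linarith
  hence "(3 * (1 + t\<^sup>2)) powr (- (3 / 4)) \<le> (1 + (t + s)\<^sup>2) powr (- (3 / 4))"
    by (intro powr_mono2') (auto simp: add_pos_nonneg)
  moreover have "(3 * (1 + t\<^sup>2)) powr (- (3 / 4)) = 3 powr (- (3 / 4)) * bump t"
    unfolding bump_def by (subst powr_mult) simp_all
  moreover have "(3::real) powr (-1) \<le> 3 powr (- (3 / 4))" by (intro powr_mono) auto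
  hence "1 / 3 * bump t \<le> 3 powr (- (3 / 4)) * bump t"
    by (intro mult_right_mono) (auto simp: bump_pos less_imp_le)
  ultimately show ?thesis by (simp add: bump_def)
qed

lemma bump_scaled_pos: "0 < l \<Longrightarrow> 0 < bump_scaled l x"
  unfolding bump_scaled_def by (simp add: bump_pos)

lemma bump_scaled_shift:
  assumes "0 < l" "\<bar>s\<bar> \<le> l"
  shows "bump_scaled l t / 3 \<le> bump_scaled l (t + s)"
proof -
  have "bump (t / l) / 3 \<le> bump (t / l + s / l)"
    by (rule bump_shift) (use assms in simp)
  hence "inverse l * (bump (t / l) / 3) \<le> inverse l * bump (t / l + s / l)"
    using assms by (intro mult_left_mono) auto
  thus ?thesis by (simp add: bump_scaled_def add_divide_distrib)
qed

lemma bump_scaled_measurable [measurable]: "bump_scaled l \<in> borel_measurable borel"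
  unfolding bump_scaled_def bump_def by measurable

text \<open>Over a window of length \<open>d \<le> l\<close> the bump varies by a factor of at most 3. Moving it through the
adjoint average therefore restores \<open>ratio d w z * mass d w z = |jump d w z|\<close>.\<close>

lemma lift_convolution:
  assumes d: "0 < d" "d \<le> l" and w: "integrable lborel w"
  shows "(\<integral>\<^sup>+z. ennreal (norm (jump d w z) * bump_scaled l (x - z)) \<partial>lborel)
    \<le> 3 * (\<integral>\<^sup>+y. ennreal (lift d w y * bump_scaled l (x - y)) \<partial>lborel)"
proof -
  have l: "0 < l" using d by simp
  have [measurable]: "w \<in> borel_measurable borel" using w by auto
  note rb = ratio_bounds[OF d(1) w]
  have bp: "0 \<le> bump_scaled l t" for t using bump_scaled_pos[OF l] less_imp_le by blast
  have "(\<integral>\<^sup>+z. ennreal (norm (jump d w z) * bump_scaled l (x - z)) \<partial>lborel)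
     = (\<integral>\<^sup>+z. ennreal (ratio d w z) * (ennreal (mass d w z) * ennreal (bump_scaled l (x - z))) \<partial>lborel)"
    using rb(1) bp by (intro nn_integral_cong) (simp add: rb(3)[symmetric] ennreal_mult' ennreal_mult'' mult_ac slide_nonneg d)
  also have "\<dots> \<le> (\<integral>\<^sup>+z. ennreal (ratio d w z) * (ennreal (1 / d) *
      (\<integral>\<^sup>+y. indicator {z..<z + d} y * (3 * ennreal (norm (w y) * bump_scaled l (x - y))) \<partial>lborel)) \<partial>lborel)"
  proof (intro nn_integral_mono mult_left_mono)
    fix z
    have "ennreal (mass d w z) * ennreal (bump_scaled l (x - z))
       = ennreal (1 / d) * ((\<integral>\<^sup>+y. indicator {z..<z + d} y * ennreal (norm (w y)) \<partial>lborel)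
          * ennreal (bump_scaled l (x - z)))"
      by (simp add: ennreal_slide[OF d(1) integrable_norm[OF w]] mult.assoc)
    also have "(\<integral>\<^sup>+y. indicator {z..<z + d} y * ennreal (norm (w y)) \<partial>lborel) * ennreal (bump_scaled l (x - z))
       = (\<integral>\<^sup>+y. indicator {z..<z + d} y * ennreal (norm (w y)) * ennreal (bump_scaled l (x - z)) \<partial>lborel)"
      by (rule nn_integral_multc[symmetric]) (unfold indicator_Ico, measurable)
    also have "\<dots> \<le> (\<integral>\<^sup>+y. indicator {z..<z + d} y * (3 * ennreal (norm (w y) * bump_scaled l (x - y))) \<partial>lborel)"
    proof (rule nn_integral_mono)
      fix y
      show "indicator {z..<z + d} y * ennreal (norm (w y)) * ennreal (bump_scaled l (x - z))
          \<le> indicator {z..<z + d} y * (3 * ennreal (norm (w y) * bump_scaled l (x - y)))"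
      proof (cases "y \<in> {z..<z + d}")
        case True
        have "bump_scaled l (x - z) / 3 \<le> bump_scaled l ((x - z) + (z - y))"
          by (rule bump_scaled_shift[OF l]) (use True d in auto)
        hence "bump_scaled l (x - z) \<le> 3 * bump_scaled l (x - y)" by simp
        hence "norm (w y) * bump_scaled l (x - z) \<le> 3 * (norm (w y) * bump_scaled l (x - y))"
          using mult_left_mono[of "bump_scaled l (x - z)" "3 * bump_scaled l (x - y)" "norm (w y)"] by simp
        hence "ennreal (norm (w y) * bump_scaled l (x - z)) \<le> ennreal (3 * (norm (w y) * bump_scaled l (x - y)))"
          by (rule ennreal_leI)
        thus ?thesis using True bp by (simp add: ennreal_mult' ennreal_mult'')
      qed simp
    qed
    finally show "ennreal (mass d w z) * ennreal (bump_scaled l (x - z)) \<le> ennreal (1 / d) *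
      (\<integral>\<^sup>+y. indicator {z..<z + d} y * (3 * ennreal (norm (w y) * bump_scaled l (x - y))) \<partial>lborel)"
      by (simp add: mult_left_mono)
  qed simp
  also have "\<dots> = (\<integral>\<^sup>+y. 3 * ennreal (norm (w y) * bump_scaled l (x - y)) * ennreal (trail d (ratio d w) y) \<partial>lborel)"
    by (rule trail_adjoint[where B = 2, symmetric]) (use rb d in auto)
  also have "\<dots> = (\<integral>\<^sup>+y. 3 * ennreal (lift d w y * bump_scaled l (x - y)) \<partial>lborel)"
    using bp trail_nonneg[OF _ rb(1,2) d(1)]
    by (intro nn_integral_cong) (simp add: lift_def ennreal_mult' ennreal_mult'' mult_ac)
  also have "\<dots> = 3 * (\<integral>\<^sup>+y. ennreal (lift d w y * bump_scaled l (x - y)) \<partial>lborel)"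
    by (rule nn_integral_cmult) measurable
  finally show ?thesis .
qed

section \<open>Decay of oscillatory integrals\<close>

definition osc :: "real \<Rightarrow> complex" where "osc s = exp (\<i> * of_real (2 * pi * s))"

lemma osc_add: "osc (s + t) = osc s * osc t"
  by (simp add: osc_def algebra_simps flip: exp_add)

lemma norm_osc [simp]: "norm (osc s) = 1" by (simp add: osc_def)

lemma osc_0 [simp]: "osc 0 = 1" by (simp add: osc_def)

lemma osc_measurable [measurable]: "osc \<in> borel_measurable borel"
  unfolding osc_def by (intro borel_measurable_continuous_onI continuous_intros)

lemma continuous_on_osc [continuous_intros]: "continuous_on S f \<Longrightarrow> continuous_on S (\<lambda>x. osc (f x))"
  unfolding osc_def by (intro continuous_intros)

lemma osc_has_vector_derivative:
  "((\<lambda>s. osc (x * s)) has_vector_derivative (2 * pi * \<i> * x) * osc (x * s)) (at s within S)"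
proof -
  let ?k = "\<i> * complex_of_real (2 * pi * x)"
  have "((\<lambda>z. exp (?k * z)) has_field_derivative exp (?k * of_real s) * ?k) (at (of_real s))"
    by (auto intro!: derivative_eq_intros)
  hence "((\<lambda>s. exp (?k * of_real s)) has_vector_derivative exp (?k * of_real s) * ?k) (at s within S)"
    by (rule has_vector_derivative_real_field)
  thus ?thesis by (simp add: osc_def mult_ac)
qed

text \<open>The primitive \<open>(a' - c a) e\<^sup>c\<^sup>\<xi>\<close> with \<open>c = 2 \<pi> i x\<close> has derivative \<open>(a'' - c\<^sup>2 a) e\<^sup>c\<^sup>\<xi>\<close> and vanishes at both
ends. It performs the two integrations by parts at once.\<close>

lemma oscillatory_integral_decay:
  fixes a a1 a2 :: "real \<Rightarrow> complex"
  assumes lo: "lo \<le> hi" "hi - lo \<le> 3 / 2 * l" and l: "0 < l"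
    and a: "\<And>\<xi>. \<xi> \<in> {lo..hi} \<Longrightarrow> (a has_vector_derivative a1 \<xi>) (at \<xi> within {lo..hi})"
    and a1: "\<And>\<xi>. \<xi> \<in> {lo..hi} \<Longrightarrow> (a1 has_vector_derivative a2 \<xi>) (at \<xi> within {lo..hi})"
    and a2: "continuous_on {lo..hi} a2"
    and ends: "a lo = 0" "a1 lo = 0" "a hi = 0" "a1 hi = 0"
    and A: "\<And>\<xi>. \<xi> \<in> {lo..hi} \<Longrightarrow> norm (a \<xi>) \<le> A" "\<And>\<xi>. \<xi> \<in> {lo..hi} \<Longrightarrow> norm (a2 \<xi>) \<le> A / l\<^sup>2"
  shows "norm (integral {lo..hi} (\<lambda>\<xi>. a \<xi> * osc (x * \<xi>))) \<le> 3 * l * A / (1 + (l * x)\<^sup>2)"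
proof -
  define c where "c = 2 * pi * \<i> * x"
  define I where "I = integral {lo..hi} (\<lambda>\<xi>. a \<xi> * osc (x * \<xi>))"
  have ca: "continuous_on {lo..hi} a" by (rule continuous_on_vector_derivative[OF a])
  have Apos: "0 \<le> A" by (rule order_trans[OF norm_ge_zero A(1)[of lo]]) (use lo in simp)
  have i1: "(\<lambda>\<xi>. a \<xi> * osc (x * \<xi>)) integrable_on {lo..hi}"
    by (intro integrable_continuous_real continuous_intros ca)
  have i2: "(\<lambda>\<xi>. a2 \<xi> * osc (x * \<xi>)) integrable_on {lo..hi}"
    by (intro integrable_continuous_real continuous_intros a2)
  have ibd: "norm (integral {lo..hi} (\<lambda>\<xi>. h \<xi> * osc (x * \<xi>))) \<le> 3 / 2 * l * H"
    if "(\<lambda>\<xi>. h \<xi> * osc (x * \<xi>)) integrable_on {lo..hi}" "\<And>\<xi>. \<xi> \<in> {lo..hi} \<Longrightarrow> norm (h \<xi>) \<le> H" for h H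
  proof -
    have H: "0 \<le> H" by (rule order_trans[OF norm_ge_zero that(2)[of lo]]) (use lo in simp)
    have "norm (integral {lo..hi} (\<lambda>\<xi>. h \<xi> * osc (x * \<xi>))) \<le> H * (hi - lo)"
      using integrable_bound[OF H, of "\<lambda>\<xi>. h \<xi> * osc (x * \<xi>)" lo hi] that lo
      by (simp add: norm_mult)
    also have "\<dots> \<le> H * (3 / 2 * l)" using lo H by (intro mult_left_mono) auto
    finally show ?thesis by (simp add: mult_ac)
  qed
  have e: "((\<lambda>s. osc (x * s)) has_vector_derivative c * osc (x * \<xi>)) (at \<xi> within S)" for \<xi> S
    unfolding c_def by (rule osc_has_vector_derivative)
  have "((\<lambda>\<xi>. a2 \<xi> * osc (x * \<xi>) - c\<^sup>2 * (a \<xi> * osc (x * \<xi>))) has_integral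
      (a1 hi - c * a hi) * osc (x * hi) - (a1 lo - c * a lo) * osc (x * lo)) {lo..hi}"
  proof (rule fundamental_theorem_of_calculus[OF lo(1)])
    fix \<xi> assume \<xi>: "\<xi> \<in> {lo..hi}"
    have "((\<lambda>\<xi>. (a1 \<xi> - c * a \<xi>) * osc (x * \<xi>)) has_vector_derivative
       ((a1 \<xi> - c * a \<xi>) * (c * osc (x * \<xi>)) + (a2 \<xi> - c * a1 \<xi>) * osc (x * \<xi>))) (at \<xi> within {lo..hi})"
      by (intro has_vector_derivative_mult has_vector_derivative_diff has_vector_derivative_mult_right a a1 e \<xi>)
    thus "((\<lambda>\<xi>. (a1 \<xi> - c * a \<xi>) * osc (x * \<xi>)) has_vector_derivative
       a2 \<xi> * osc (x * \<xi>) - c\<^sup>2 * (a \<xi> * osc (x * \<xi>))) (at \<xi> within {lo..hi})"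
      by (simp add: algebra_simps power2_eq_square)
  qed
  hence "integral {lo..hi} (\<lambda>\<xi>. a2 \<xi> * osc (x * \<xi>) - c\<^sup>2 * (a \<xi> * osc (x * \<xi>))) = 0"
    using ends by (simp add: integral_unique)
  hence c: "c\<^sup>2 * I = integral {lo..hi} (\<lambda>\<xi>. a2 \<xi> * osc (x * \<xi>))"
    using i1 i2 integrable_on_mult_right[OF i1, of "c\<^sup>2"]
    by (simp add: Henstock_Kurzweil_Integration.integral_diff I_def)
  have "norm (c\<^sup>2 * I) \<le> 3 / 2 * l * (A / l\<^sup>2)" unfolding c by (rule ibd[OF i2 A(2)])
  moreover have "norm (c\<^sup>2) = (2 * pi)\<^sup>2 * x\<^sup>2" by (simp add: c_def norm_mult norm_power power_mult_distrib)
  moreover have "(1::real)\<^sup>2 \<le> (2 * pi)\<^sup>2" using pi_gt3 by (intro power_mono) auto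
  hence "1 * (x\<^sup>2 * norm I) \<le> (2 * pi)\<^sup>2 * (x\<^sup>2 * norm I)" by (intro mult_right_mono) auto
  ultimately have "x\<^sup>2 * norm I \<le> 3 / 2 * l * (A / l\<^sup>2)" by (simp add: norm_mult mult_ac)
  hence "l\<^sup>2 * (x\<^sup>2 * norm I) \<le> l\<^sup>2 * (3 / 2 * l * (A / l\<^sup>2))" by (intro mult_left_mono) auto
  also have "\<dots> = 3 / 2 * l * A" using l by simp
  finally have 1: "(l * x)\<^sup>2 * norm I \<le> 3 / 2 * l * A" by (simp add: power_mult_distrib mult_ac)
  have 2: "norm I \<le> 3 / 2 * l * A" unfolding I_def by (rule ibd[OF i1 A(1)])
  have "(1 + (l * x)\<^sup>2) * norm I \<le> 3 * l * A" using 1 2 by (simp add: algebra_simps)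
  moreover have "0 < 1 + (l * x)\<^sup>2" by (rule add_pos_nonneg) auto
  ultimately show ?thesis unfolding I_def by (simp add: pos_le_divide_eq mult_ac)
qed

lemma product_kernel_decay:
  fixes f f1 f2 r r1 r2 :: "real \<Rightarrow> complex"
  assumes lo: "lo \<le> hi" "hi - lo \<le> 3 / 2 * l" and l: "0 < l"
    and f: "\<And>\<xi>. (f has_vector_derivative f1 \<xi>) (at \<xi>)"
    and f1: "\<And>\<xi>. (f1 has_vector_derivative f2 \<xi>) (at \<xi>)"
    and f2: "continuous_on UNIV f2"
    and ends: "f lo = 0" "f1 lo = 0" "f hi = 0" "f1 hi = 0"
    and B: "\<And>\<xi>. norm (f \<xi>) \<le> B" "\<And>\<xi>. norm (f1 \<xi>) \<le> B / l" "\<And>\<xi>. norm (f2 \<xi>) \<le> B / l\<^sup>2"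
    and r: "\<And>\<xi>. \<xi> \<in> {lo..hi} \<Longrightarrow> (r has_vector_derivative r1 \<xi>) (at \<xi>)"
    and r1: "\<And>\<xi>. \<xi> \<in> {lo..hi} \<Longrightarrow> (r1 has_vector_derivative r2 \<xi>) (at \<xi>)"
    and r2: "continuous_on {lo..hi} r2"
    and R: "\<And>\<xi>. \<xi> \<in> {lo..hi} \<Longrightarrow> norm (r \<xi>) \<le> R" "\<And>\<xi>. \<xi> \<in> {lo..hi} \<Longrightarrow> norm (r1 \<xi>) \<le> R / l"
      "\<And>\<xi>. \<xi> \<in> {lo..hi} \<Longrightarrow> norm (r2 \<xi>) \<le> R / l\<^sup>2"
  shows "norm (integral {lo..hi} (\<lambda>\<xi>. f \<xi> * r \<xi> * osc (x * \<xi>))) \<le> 12 * B * R * l / (1 + (l * x)\<^sup>2)"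
proof -
  have cf: "continuous_on {lo..hi} f" "continuous_on {lo..hi} f1" "continuous_on {lo..hi} f2"
    using continuous_on_vector_derivative[of "{lo..hi}" f f1] continuous_on_vector_derivative[of "{lo..hi}" f1 f2]
      has_vector_derivative_at_within[OF f] has_vector_derivative_at_within[OF f1] continuous_on_subset[OF f2]
    by auto
  have "continuous_on {lo..hi} r"
    by (rule continuous_on_vector_derivative[OF has_vector_derivative_at_within[OF r]])
  moreover have "continuous_on {lo..hi} r1"
    by (rule continuous_on_vector_derivative[OF has_vector_derivative_at_within[OF r1]])
  ultimately have cont: "continuous_on {lo..hi} f" "continuous_on {lo..hi} f1" "continuous_on {lo..hi} f2"
      "continuous_on {lo..hi} r" "continuous_on {lo..hi} r1"
    using cf by auto
  have B0: "0 \<le> B" by (rule order_trans[OF norm_ge_zero B(1)[of 0]])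
  have R0: "0 \<le> R" by (rule order_trans[OF norm_ge_zero R(1)[of lo]]) (use lo in simp)
  have "norm (integral {lo..hi} (\<lambda>\<xi>. (f \<xi> * r \<xi>) * osc (x * \<xi>))) \<le> 3 * l * (4 * (B * R)) / (1 + (l * x)\<^sup>2)"
  proof (rule oscillatory_integral_decay[OF lo l])
    fix \<xi> assume \<xi>: "\<xi> \<in> {lo..hi}"
    show "((\<lambda>\<xi>. f \<xi> * r \<xi>) has_vector_derivative f \<xi> * r1 \<xi> + f1 \<xi> * r \<xi>) (at \<xi> within {lo..hi})"
      by (intro has_vector_derivative_mult has_vector_derivative_at_within[OF f] has_vector_derivative_at_within[OF r[OF \<xi>]])
    show "((\<lambda>\<xi>. f \<xi> * r1 \<xi> + f1 \<xi> * r \<xi>) has_vector_derivative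
       (f \<xi> * r2 \<xi> + f1 \<xi> * r1 \<xi>) + (f1 \<xi> * r1 \<xi> + f2 \<xi> * r \<xi>)) (at \<xi> within {lo..hi})"
      by (intro has_vector_derivative_mult has_vector_derivative_add has_vector_derivative_at_within[OF f]
         has_vector_derivative_at_within[OF f1] has_vector_derivative_at_within[OF r[OF \<xi>]] has_vector_derivative_at_within[OF r1[OF \<xi>]])
    have "norm (f \<xi> * r \<xi>) \<le> B * R" unfolding norm_mult by (intro mult_mono B R \<xi> B0) auto
    moreover have "0 \<le> B * R" using B0 R0 by simp
    ultimately show "norm (f \<xi> * r \<xi>) \<le> 4 * (B * R)" by linarith
    have "norm (f \<xi> * r2 \<xi>) \<le> B * (R / l\<^sup>2)" "norm (f1 \<xi> * r1 \<xi>) \<le> (B / l) * (R / l)" "norm (f2 \<xi> * r \<xi>) \<le> (B / l\<^sup>2) * R"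
      unfolding norm_mult by (intro mult_mono B R \<xi> B0 divide_nonneg_nonneg; use l in simp)+
    hence "norm (f \<xi> * r2 \<xi>) + norm (f1 \<xi> * r1 \<xi>) + (norm (f1 \<xi> * r1 \<xi>) + norm (f2 \<xi> * r \<xi>)) \<le> 4 * (B * R) / l\<^sup>2"
      by (simp add: power2_eq_square)
    moreover have "norm (f \<xi> * r2 \<xi> + f1 \<xi> * r1 \<xi> + (f1 \<xi> * r1 \<xi> + f2 \<xi> * r \<xi>))
      \<le> norm (f \<xi> * r2 \<xi>) + norm (f1 \<xi> * r1 \<xi>) + (norm (f1 \<xi> * r1 \<xi>) + norm (f2 \<xi> * r \<xi>))"
      by (intro norm_triangle_le add_mono norm_triangle_ineq)
    ultimately show "norm (f \<xi> * r2 \<xi> + f1 \<xi> * r1 \<xi> + (f1 \<xi> * r1 \<xi> + f2 \<xi> * r \<xi>)) \<le> 4 * (B * R) / l\<^sup>2"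
      by linarith
  qed (use ends in \<open>auto intro!: continuous_intros cont r2\<close>)
  thus ?thesis by (simp add: mult_ac)
qed

text \<open>The function \<open>P\<close> is the inverse of the multiplier of \<open>jump\<close> in the variable \<open>\<theta> = \<pi> d \<xi>\<close>. The
multiplier vanishes only at multiples of \<open>2 \<pi>\<close>, so \<open>P\<close> is holomorphic near the compact set in
question, and this bounds it together with its derivatives.\<close>

lemma multiplier_profile:
  obtains P P1 P2 :: "real \<Rightarrow> complex" and R :: real
  where "\<And>\<theta>. 1 / 2 \<le> \<bar>\<theta>\<bar> \<Longrightarrow> \<bar>\<theta>\<bar> \<le> 2 \<Longrightarrow> P \<theta> * ((exp (\<i> * of_real \<theta>) - 1)\<^sup>2 / (\<i> * of_real \<theta>)) = 1"
    "\<And>\<theta>. 1 / 2 \<le> \<bar>\<theta>\<bar> \<Longrightarrow> \<bar>\<theta>\<bar> \<le> 2 \<Longrightarrow> (P has_vector_derivative P1 \<theta>) (at \<theta>)"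
    "\<And>\<theta>. 1 / 2 \<le> \<bar>\<theta>\<bar> \<Longrightarrow> \<bar>\<theta>\<bar> \<le> 2 \<Longrightarrow> (P1 has_vector_derivative P2 \<theta>) (at \<theta>)"
    "continuous_on {\<theta>. 1 / 2 \<le> \<bar>\<theta>\<bar> \<and> \<bar>\<theta>\<bar> \<le> 2} P2"
    "\<And>\<theta>. 1 / 2 \<le> \<bar>\<theta>\<bar> \<Longrightarrow> \<bar>\<theta>\<bar> \<le> 2 \<Longrightarrow> norm (P \<theta>) \<le> R"
    "\<And>\<theta>. 1 / 2 \<le> \<bar>\<theta>\<bar> \<Longrightarrow> \<bar>\<theta>\<bar> \<le> 2 \<Longrightarrow> norm (P1 \<theta>) \<le> R"
    "\<And>\<theta>. 1 / 2 \<le> \<bar>\<theta>\<bar> \<Longrightarrow> \<bar>\<theta>\<bar> \<le> 2 \<Longrightarrow> norm (P2 \<theta>) \<le> R"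
proof -
  define Q where "Q = (\<lambda>z::complex. \<i> * z / (exp (\<i> * z) - 1)\<^sup>2)"
  define S where "S = {z::complex. exp (\<i> * z) \<noteq> 1}"
  define K where "K = {\<theta>::real. 1 / 2 \<le> \<bar>\<theta>\<bar> \<and> \<bar>\<theta>\<bar> \<le> 2}"
  have S: "open S" unfolding S_def by (intro open_Collect_neq continuous_intros)
  have Q: "Q holomorphic_on S" unfolding Q_def S_def by (auto intro!: holomorphic_intros)
  have Q1: "deriv Q holomorphic_on S" by (rule holomorphic_deriv[OF Q S])
  have Q2: "deriv (deriv Q) holomorphic_on S" by (rule holomorphic_deriv[OF Q1 S])
  have KS: "of_real \<theta> \<in> S" if "\<theta> \<in> K" for \<theta>
  proof -
    have "exp (\<i> * of_real \<theta>) \<noteq> 1"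
    proof
      assume "exp (\<i> * of_real \<theta>) = 1"
      then obtain n :: int where "\<theta> = of_int (2 * n) * pi" by (auto simp: exp_eq_1)
      hence t: "\<bar>\<theta>\<bar> = 2 * \<bar>of_int n\<bar> * pi" by (simp add: abs_mult)
      have "n \<noteq> 0" using t that by (auto simp: K_def)
      hence "1 \<le> \<bar>real_of_int n\<bar>" by linarith
      hence "2 * pi \<le> \<bar>\<theta>\<bar>" unfolding t by simp
      thus False using that pi_gt3 by (simp add: K_def)
    qed
    thus ?thesis by (simp add: S_def)
  qed
  have K: "compact K"
  proof -
    have "K = {-2..-(1/2)} \<union> {1/2..2}" by (auto simp: K_def)
    thus ?thesis by (simp add: compact_Un)
  qed
  have co: "continuous_on K (\<lambda>\<theta>. g (complex_of_real \<theta>))" if "g holomorphic_on S" for g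
    by (rule continuous_on_compose2[OF holomorphic_on_imp_continuous_on[OF that]])
      (use KS in \<open>auto intro!: continuous_intros\<close>)
  have bd: "\<exists>B. \<forall>\<theta>\<in>K. norm (g (complex_of_real \<theta>)) \<le> B" if "g holomorphic_on S" for g
    using compact_imp_bounded[OF compact_continuous_image[OF co[OF that] K]] by (auto simp: bounded_iff)
  have der: "((\<lambda>\<theta>. g (complex_of_real \<theta>)) has_vector_derivative deriv g (of_real \<theta>)) (at \<theta>)"
    if "g holomorphic_on S" "\<theta> \<in> K" for g \<theta>
    using has_vector_derivative_real_field[OF holomorphic_derivI[OF that(1) S KS[OF that(2)]]] .
  obtain R0 R1 R2 where R: "\<forall>\<theta>\<in>K. norm (Q (of_real \<theta>)) \<le> R0" "\<forall>\<theta>\<in>K. norm (deriv Q (of_real \<theta>)) \<le> R1"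
      "\<forall>\<theta>\<in>K. norm (deriv (deriv Q) (of_real \<theta>)) \<le> R2"
    using bd[OF Q] bd[OF Q1] bd[OF Q2] by blast
  show ?thesis
  proof (rule that[of "\<lambda>\<theta>. Q (of_real \<theta>)" "\<lambda>\<theta>. deriv Q (of_real \<theta>)" "\<lambda>\<theta>. deriv (deriv Q) (of_real \<theta>)" "max R0 (max R1 R2)"])
    show "continuous_on {\<theta>. 1 / 2 \<le> \<bar>\<theta>\<bar> \<and> \<bar>\<theta>\<bar> \<le> 2} (\<lambda>\<theta>. deriv (deriv Q) (complex_of_real \<theta>))"
      using co[OF Q2] by (simp add: K_def)
  next
    fix \<theta> :: real assume "1 / 2 \<le> \<bar>\<theta>\<bar>" "\<bar>\<theta>\<bar> \<le> 2"
    hence k: "\<theta> \<in> K" by (simp add: K_def)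
    have n: "\<theta> \<noteq> 0" "exp (\<i> * of_real \<theta>) - 1 \<noteq> 0" using k KS[OF k] by (auto simp: K_def S_def)
    show "Q (of_real \<theta>) * ((exp (\<i> * of_real \<theta>) - 1)\<^sup>2 / (\<i> * of_real \<theta>)) = 1"
      using n by (simp add: Q_def)
    show "((\<lambda>\<theta>. Q (of_real \<theta>)) has_vector_derivative deriv Q (of_real \<theta>)) (at \<theta>)" by (rule der[OF Q k])
    show "((\<lambda>\<theta>. deriv Q (of_real \<theta>)) has_vector_derivative deriv (deriv Q) (of_real \<theta>)) (at \<theta>)" by (rule der[OF Q1 k])
    show "norm (Q (of_real \<theta>)) \<le> max R0 (max R1 R2)" "norm (deriv Q (of_real \<theta>)) \<le> max R0 (max R1 R2)"
       "norm (deriv (deriv Q) (of_real \<theta>)) \<le> max R0 (max R1 R2)"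
      using R[THEN bspec, OF k] by linarith+
  qed
qed

section \<open>Fourier transforms of sliding averages\<close>

lemma fourier_eq:
  assumes [measurable]: "f \<in> borel_measurable borel"
  shows "fourier f \<xi> = (LINT x|lborel. f x * osc (- (x * \<xi>)))"
proof -
  have "fourier f \<xi> = (LINT x|lebesgue. f x * osc (- (x * \<xi>)))"
    by (simp add: fourier_def osc_def mult_ac)
  also have "\<dots> = (LINT x|lborel. f x * osc (- (x * \<xi>)))"
    by (rule integral_completion) measurable
  finally show ?thesis .
qed

lemma fourier_measurable [measurable]:
  assumes [measurable]: "f \<in> borel_measurable borel"
  shows "fourier f \<in> borel_measurable borel"
proof -
  have "fourier f = (\<lambda>\<xi>. LINT x|lborel. f x * osc (- (x * \<xi>)))" by (auto simp: fourier_eq)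
  thus ?thesis by simp
qed

lemma multiplier_fubini:
  fixes a g :: "real \<Rightarrow> complex"
  assumes a: "integrable lborel a" and g: "integrable lborel g"
  shows "(LINT \<xi>|lborel. a \<xi> * fourier g \<xi> * osc (x * \<xi>))
       = (LINT y|lborel. g y * (LINT \<xi>|lborel. a \<xi> * osc ((x - y) * \<xi>)))"
proof -
  have [measurable]: "a \<in> borel_measurable borel" "g \<in> borel_measurable borel" using a g by auto
  define h where "h = (\<lambda>\<xi> y. a \<xi> * (g y * osc ((x - y) * \<xi>)))"
  have "(LINT \<xi>|lborel. a \<xi> * fourier g \<xi> * osc (x * \<xi>)) = (LINT \<xi>|lborel. LINT y|lborel. h \<xi> y)"
  proof (rule Bochner_Integration.integral_cong[OF refl])
    fix \<xi>
    have "h \<xi> y = (a \<xi> * osc (x * \<xi>)) * (g y * osc (- (y * \<xi>)))" for y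
      using osc_add[of "x * \<xi>" "- (y * \<xi>)"] by (simp add: h_def algebra_simps)
    thus "a \<xi> * fourier g \<xi> * osc (x * \<xi>) = (LINT y|lborel. h \<xi> y)"
      by (simp add: fourier_eq)
  qed
  also have "\<dots> = (LINT y|lborel. LINT \<xi>|lborel. h \<xi> y)"
  proof (rule lborel_pair.Fubini_integral[symmetric])
    show "integrable (lborel \<Otimes>\<^sub>M lborel) (case_prod h)"
    proof (rule lborel_pair.Fubini_integrable)
      show "case_prod h \<in> borel_measurable (lborel \<Otimes>\<^sub>M lborel)" unfolding h_def by measurable
      show "integrable lborel (\<lambda>\<xi>. LINT y|lborel. norm (case (\<xi>, y) of (\<xi>, y) \<Rightarrow> h \<xi> y))"
        using a by (simp add: h_def norm_mult)
      show "AE \<xi> in lborel. integrable lborel (\<lambda>y. case (\<xi>, y) of (\<xi>, y) \<Rightarrow> h \<xi> y)"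
      proof (rule AE_I2)
        fix \<xi>
        have "integrable lborel (\<lambda>y. g y * osc ((x - y) * \<xi>))"
          by (rule Bochner_Integration.integrable_bound[OF g]) (auto simp: norm_mult)
        thus "integrable lborel (\<lambda>y. case (\<xi>, y) of (\<xi>, y) \<Rightarrow> h \<xi> y)" by (simp add: h_def)
      qed
    qed
  qed
  also have "\<dots> = (LINT y|lborel. g y * (LINT \<xi>|lborel. a \<xi> * osc ((x - y) * \<xi>)))"
  proof (rule Bochner_Integration.integral_cong[OF refl])
    fix y
    have "h \<xi> y = g y * (a \<xi> * osc ((x - y) * \<xi>))" for \<xi> by (simp add: h_def)
    thus "(LINT \<xi>|lborel. h \<xi> y) = g y * (LINT \<xi>|lborel. a \<xi> * osc ((x - y) * \<xi>))" by simp
  qed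
  finally show ?thesis .
qed

lemma integral_supported_Icc:
  fixes h :: "real \<Rightarrow> complex"
  assumes "continuous_on {lo..hi} h" "\<And>\<xi>. \<xi> \<notin> {lo..hi} \<Longrightarrow> h \<xi> = 0"
  shows "integrable lborel h" "(LINT \<xi>|lborel. h \<xi>) = integral {lo..hi} h"
proof -
  have s: "set_integrable lborel {lo..hi} h" by (rule borel_integrable_atLeastAtMost'[OF assms(1)])
  have e: "indicator {lo..hi} \<xi> *\<^sub>R h \<xi> = h \<xi>" for \<xi> using assms(2)[of \<xi>] by (auto simp: indicator_def)
  show "integrable lborel h" using s by (simp add: set_integrable_def e)
  show "(LINT \<xi>|lborel. h \<xi>) = integral {lo..hi} h"
    using set_borel_integral_eq_integral(2)[OF s] by (simp add: set_lebesgue_integral_def e)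
qed

lemma integral_osc_Ioc:
  assumes d: "0 < d" and \<xi>: "\<xi> \<noteq> 0"
  shows "(LINT x|lborel. indicator {y - d<..y} x *\<^sub>R osc (- (x * \<xi>)))
       = osc (- (y * \<xi>)) * ((osc (d * \<xi>) - 1) / (2 * pi * \<i> * \<xi>))"
proof -
  define c where "c = 2 * pi * \<i> * of_real (- \<xi>)"
  have c0: "c \<noteq> 0" using \<xi> by (simp add: c_def)
  have co: "continuous_on {y - d..y} (\<lambda>x. osc ((- \<xi>) * x))" by (intro continuous_intros)
  have "(LINT x|lborel. indicator {y - d<..y} x *\<^sub>R osc (- (x * \<xi>)))
     = (LINT x|lborel. indicator {y - d..y} x *\<^sub>R osc ((- \<xi>) * x))"
  proof (rule integral_cong_AE)
    show "AE x in lborel. indicator {y - d<..y} x *\<^sub>R osc (- (x * \<xi>)) = indicator {y - d..y} x *\<^sub>R osc ((- \<xi>) * x)"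
      using AE_lborel_singleton[of "y - d"] by (rule eventually_mono) (auto simp: indicator_def mult.commute)
  qed measurable
  also have "\<dots> = integral {y - d..y} (\<lambda>x. osc ((- \<xi>) * x))"
    using set_borel_integral_eq_integral(2)[OF borel_integrable_atLeastAtMost'[OF co]]
    by (simp add: set_lebesgue_integral_def)
  also have "\<dots> = osc ((- \<xi>) * y) / c - osc ((- \<xi>) * (y - d)) / c"
  proof (rule integral_unique, rule fundamental_theorem_of_calculus)
    fix x
    have "((\<lambda>s. osc ((- \<xi>) * s) * inverse c) has_vector_derivative (c * osc ((- \<xi>) * x)) * inverse c) (at x within {y - d..y})"
      unfolding c_def by (intro has_vector_derivative_mult_left osc_has_vector_derivative)
    thus "((\<lambda>s. osc ((- \<xi>) * s) / c) has_vector_derivative osc ((- \<xi>) * x)) (at x within {y - d..y})"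
      using c0 by (simp add: field_simps)
  qed (use d in simp)
  also have "osc ((- \<xi>) * (y - d)) = osc (- (y * \<xi>)) * osc (d * \<xi>)"
    unfolding osc_add[symmetric] by (simp add: algebra_simps)
  also have "osc ((- \<xi>) * y) / c - osc (- (y * \<xi>)) * osc (d * \<xi>) / c
      = osc (- (y * \<xi>)) * ((osc (d * \<xi>) - 1) / (- c))"
    using c0 by (simp add: field_simps)
  also have "- c = 2 * pi * \<i> * \<xi>" by (simp add: c_def)
  finally show ?thesis .
qed

lemma integrable_slide_complex:
  fixes w :: "real \<Rightarrow> complex"
  assumes d: "0 < d" and w: "integrable lborel w"
  shows "integrable lborel (slide d w)"
proof (rule Bochner_Integration.integrable_bound)
  have [measurable]: "w \<in> borel_measurable borel" using w by auto
  show "integrable lborel (mass d w)" by (rule integrable_slide[OF d integrable_norm[OF w]]) simp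
  show "slide d w \<in> borel_measurable lborel" by simp
  show "AE x in lborel. norm (slide d w x) \<le> norm (mass d w x)"
    using norm_slide_le[OF d, of w] abs_ge_self order_trans by (intro AE_I2) fastforce
qed

lemma fourier_slide:
  fixes f :: "real \<Rightarrow> complex"
  assumes d: "0 < d" and f: "integrable lborel f" and \<xi>: "\<xi> \<noteq> 0"
  shows "fourier (slide d f) \<xi> = (osc (d * \<xi>) - 1) / (2 * pi * \<i> * d * \<xi>) * fourier f \<xi>"
proof -
  have [measurable]: "f \<in> borel_measurable borel" using f by auto
  define h where "h = (\<lambda>x y. indicator {x..<x + d} y *\<^sub>R (f y * osc (- (x * \<xi>))))"
  have "fourier (slide d f) \<xi> = (LINT x|lborel. (LINT y|lborel. h x y) / d)"
  proof (subst fourier_eq, simp, rule Bochner_Integration.integral_cong[OF refl])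
    fix x
    have "h x y = (indicator {x..<x + d} y *\<^sub>R f y) * osc (- (x * \<xi>))" for y by (simp add: h_def)
    thus "slide d f x * osc (- (x * \<xi>)) = (LINT y|lborel. h x y) / d"
      by (simp add: slide_def scaleR_conv_of_real divide_inverse)
  qed
  also have "\<dots> = (LINT x|lborel. LINT y|lborel. h x y) / d" by simp
  also have "(LINT x|lborel. LINT y|lborel. h x y) = (LINT y|lborel. LINT x|lborel. h x y)"
  proof (rule lborel_pair.Fubini_integral[symmetric])
    have nh: "norm (h x y) = indicator {x..<x + d} y *\<^sub>R norm (f y)" for x y by (simp add: h_def norm_mult)
    show "integrable (lborel \<Otimes>\<^sub>M lborel) (case_prod h)"
    proof (rule lborel_pair.Fubini_integrable)
      show "case_prod h \<in> borel_measurable (lborel \<Otimes>\<^sub>M lborel)" unfolding h_def indicator_Ico by measurable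
      have "(\<lambda>x. LINT y|lborel. norm (case (x, y) of (x, y) \<Rightarrow> h x y)) = (\<lambda>x. d * mass d f x)"
        using d by (auto simp: nh slide_def)
      thus "integrable lborel (\<lambda>x. LINT y|lborel. norm (case (x, y) of (x, y) \<Rightarrow> h x y))"
        using integrable_slide(1)[OF d integrable_norm[OF f]] by simp
      show "AE x in lborel. integrable lborel (\<lambda>y. case (x, y) of (x, y) \<Rightarrow> h x y)"
      proof (rule AE_I2)
        fix x
        have "integrable lborel (\<lambda>y. (indicator {x..<x + d} y *\<^sub>R f y) * osc (- (x * \<xi>)))"
          using integrable_indicator_Ico[OF f] by (rule integrable_mult_left)
        thus "integrable lborel (\<lambda>y. case (x, y) of (x, y) \<Rightarrow> h x y)" by (simp add: h_def)
      qed
    qed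
  qed
  also have "\<dots> = (LINT y|lborel. f y * (osc (- (y * \<xi>)) * ((osc (d * \<xi>) - 1) / (2 * pi * \<i> * \<xi>))))"
  proof (rule Bochner_Integration.integral_cong[OF refl])
    fix y
    have "h x y = f y * (indicator {y - d<..y} x *\<^sub>R osc (- (x * \<xi>)))" for x by (auto simp: h_def indicator_def)
    thus "(LINT x|lborel. h x y) = f y * (osc (- (y * \<xi>)) * ((osc (d * \<xi>) - 1) / (2 * pi * \<i> * \<xi>)))"
      by (simp only: integral_mult_right_zero integral_osc_Ioc[OF d \<xi>])
  qed
  also have "\<dots> = fourier f \<xi> * ((osc (d * \<xi>) - 1) / (2 * pi * \<i> * \<xi>))"
    by (simp add: fourier_eq flip: mult.assoc)
  finally show ?thesis by (simp add: mult_ac)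
qed

lemma fourier_translate:
  assumes [measurable]: "f \<in> borel_measurable borel"
  shows "fourier (\<lambda>x. f (t + x)) \<xi> = osc (t * \<xi>) * fourier f \<xi>"
proof -
  have f: "fourier f \<xi> = (LINT x|lborel. f (t + x) * osc (- ((t + x) * \<xi>)))"
    unfolding fourier_eq[OF assms]
    using lborel_integral_real_affine[of 1 "\<lambda>x. f x * osc (- (x * \<xi>))" t] by simp
  have e: "f (t + x) * osc (- (x * \<xi>)) = osc (t * \<xi>) * (f (t + x) * osc (- ((t + x) * \<xi>)))" for x
  proof -
    have "osc (- (x * \<xi>)) = osc (t * \<xi> + - ((t + x) * \<xi>))" by (simp add: algebra_simps)
    also have "\<dots> = osc (t * \<xi>) * osc (- ((t + x) * \<xi>))" by (rule osc_add)
    finally show ?thesis by (simp only: mult.left_commute)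
  qed
  have "fourier (\<lambda>x. f (t + x)) \<xi> = (LINT x|lborel. f (t + x) * osc (- (x * \<xi>)))"
    by (rule fourier_eq) measurable
  also have "\<dots> = (LINT x|lborel. osc (t * \<xi>) * (f (t + x) * osc (- ((t + x) * \<xi>))))"
    by (rule Bochner_Integration.integral_cong[OF refl e])
  also have "\<dots> = osc (t * \<xi>) * fourier f \<xi>" unfolding f by simp
  finally show ?thesis .
qed

text \<open>One factor \<open>exp (i \<theta>) - 1\<close> comes from the average over a window of length \<open>d / 2\<close>, the other from
the difference of its translates by \<open>d / 2\<close>.\<close>

lemma fourier_jump:
  assumes d: "0 < d" and f: "integrable lborel f" and \<xi>: "\<xi> \<noteq> 0"
  defines "\<theta> \<equiv> pi * d * \<xi>"
  shows "fourier (jump d f) \<xi> = (exp (\<i> * of_real \<theta>) - 1)\<^sup>2 / (\<i> * of_real \<theta>) * fourier f \<xi>"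
proof -
  have [measurable]: "f \<in> borel_measurable borel" using f by auto
  have d2: "0 < d / 2" using d by simp
  let ?s = "slide (d / 2) f"
  have isl: "integrable lborel ?s" by (rule integrable_slide_complex[OF d2 f])
  have it: "integrable lborel (\<lambda>x. ?s (d / 2 + x))"
    using lborel_integrable_real_affine[OF isl, of 1 "d / 2"] by simp
  have io: "integrable lborel (\<lambda>x. g x * osc (- (x * \<xi>)))" if "integrable lborel g" for g :: "real \<Rightarrow> complex"
  proof (rule Bochner_Integration.integrable_bound[OF that])
    have [measurable]: "g \<in> borel_measurable borel" using that by auto
    show "(\<lambda>x. g x * osc (- (x * \<xi>))) \<in> borel_measurable lborel" by measurable
  qed (simp add: norm_mult)
  have "fourier (jump d f) \<xi> = fourier (\<lambda>x. ?s (d / 2 + x)) \<xi> - fourier ?s \<xi>"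
    using io[OF isl] io[OF it] by (simp add: fourier_eq jump_def algebra_simps)
  also have "\<dots> = (osc (d / 2 * \<xi>) - 1) * fourier ?s \<xi>"
    by (subst fourier_translate) (simp_all add: algebra_simps)
  also have "\<dots> = (osc (d / 2 * \<xi>) - 1)\<^sup>2 / (2 * pi * \<i> * of_real (d / 2) * \<xi>) * fourier f \<xi>"
    by (subst fourier_slide[OF d2 f \<xi>]) (simp add: power2_eq_square)
  also have "osc (d / 2 * \<xi>) = exp (\<i> * of_real \<theta>)" by (simp add: osc_def \<theta>_def mult_ac)
  also have "2 * pi * \<i> * of_real (d / 2) * \<xi> = \<i> * of_real \<theta>" by (simp add: \<theta>_def mult_ac)
  finally show ?thesis .
qed

section \<open>Frequency projections in terms of increments\<close>

lemma uminus_Ico: "uminus ` {a..<b} = {- b<..- (a::real)}"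
  by (auto simp: image_iff intro!: bexI[of _ "- _"])

lemma dilate_Ico:
  assumes "(a::real) < b"
  shows "dilate (5/4) {a..<b} \<subseteq> {a - (b - a) / 8 .. b + (b - a) / 8}"
  unfolding dilate_def Let_def using assms by (auto simp: cInf_atLeastLessThan field_simps)

lemma dilate_Ioc:
  assumes "(a::real) < b"
  shows "dilate (5/4) {a<..b} \<subseteq> {a - (b - a) / 8 .. b + (b - a) / 8}"
  unfolding dilate_def Let_def using assms by (auto simp: field_simps)

lemma Lambda1_cases:
  assumes "L \<in> Lambda1"
  obtains k :: int where "L = {2 powi k..<2 powi (k + 1)}" | k :: int where "L = uminus ` {2 powi k..<2 powi (k + 1)}"
  using assms unfolding Lambda1_def by blast

lemma two_powi_Suc: "(2::real) powi (k + 1) = 2 * 2 powi k"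
  by (simp add: power_int_add)

lemma ilength_dyadic:
  "ilength {2 powi k..<2 powi (k + 1)} = 2 powi k"
  "ilength (uminus ` {2 powi k..<2 powi (k + 1)}) = 2 powi k"
  unfolding uminus_Ico by (simp_all add: two_powi_Suc)

text \<open>The interval \<open>{lo..hi}\<close> is wider than the dilate of \<open>L\<close> by an eighth of its length on either side, so
a cutoff vanishes together with its derivative at \<open>lo\<close> and \<open>hi\<close>. It still stays away from 0.\<close>

lemma Lambda1_band:
  assumes "L \<in> Lambda1"
  obtains lo hi where "0 < ilength L" "dilate (5/4) L \<subseteq> {lo + ilength L / 8 .. hi - ilength L / 8}"
    "hi - lo = 3 / 2 * ilength L" "\<And>\<xi>. \<xi> \<in> {lo..hi} \<Longrightarrow> 3 / 4 * ilength L \<le> \<bar>\<xi>\<bar> \<and> \<bar>\<xi>\<bar> \<le> 9 / 4 * ilength L"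
  using assms
proof (cases rule: Lambda1_cases)
  case (1 k)
  define l :: real where "l = 2 powi k"
  have l: "0 < l" by (simp add: l_def)
  have L: "L = {l..<2 * l}" "ilength L = l" using ilength_dyadic(1)[of k] by (simp_all add: 1 l_def two_powi_Suc)
  show ?thesis
    by (rule that[of "3 / 4 * l" "9 / 4 * l"]) (use dilate_Ico[of l "2 * l"] l in \<open>auto simp: L\<close>)
next
  case (2 k)
  define l :: real where "l = 2 powi k"
  have l: "0 < l" by (simp add: l_def)
  have L: "L = {- (2 * l)<..- l}" "ilength L = l" using ilength_dyadic(2)[of k]
    by (simp_all add: 2 l_def two_powi_Suc uminus_Ico)
  show ?thesis
    by (rule that[of "- 9 / 4 * l" "- 3 / 4 * l"]) (use dilate_Ioc[of "- (2 * l)" "- l"] l in \<open>auto simp: L\<close>)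
qed

text \<open>Two derivatives give kernels with quadratic decay, which is faster than the exponent \<open>3/2\<close> of the
bump.\<close>

lemma bump_scaled_ge:
  assumes "0 < l"
  shows "l / (1 + (l * x)\<^sup>2) \<le> bump_scaled (1 / l) x"
proof -
  have p: "1 \<le> 1 + (l * x)\<^sup>2" by simp
  have "(1 + (l * x)\<^sup>2) powr (-1) \<le> (1 + (l * x)\<^sup>2) powr (- 3 / 4)"
    by (rule powr_mono) (use p in auto)
  moreover have "(1 + (l * x)\<^sup>2) powr (-1) = inverse (1 + (l * x)\<^sup>2)"
    using p by (simp add: powr_minus)
  ultimately have "inverse (1 + (l * x)\<^sup>2) \<le> (1 + (l * x)\<^sup>2) powr (- 3 / 4)" by metis
  hence "l * inverse (1 + (l * x)\<^sup>2) \<le> l * (1 + (l * x)\<^sup>2) powr (- 3 / 4)"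
    using assms by (intro mult_left_mono) auto
  moreover have "bump_scaled (1 / l) x = l * (1 + (l * x)\<^sup>2) powr (- 3 / 4)"
    using assms by (simp add: bump_scaled_def bump_def mult.commute)
  ultimately show ?thesis by (simp only: divide_inverse)
qed

lemma vector_derivative_zero_nbhd:
  assumes "open U" "x \<in> U" "\<And>y. y \<in> U \<Longrightarrow> f y = 0" "(f has_vector_derivative d) (at x)"
  shows "d = (0 :: complex)"
proof -
  have "((\<lambda>_. 0) has_vector_derivative d) (at x)"
    by (rule has_vector_derivative_transform_within_open[OF assms(4,1,2)]) (use assms(3) in simp)
  moreover have "((\<lambda>_. 0 :: complex) has_vector_derivative 0) (at x)" by (rule has_vector_derivative_const)
  ultimately show ?thesis using vector_derivative_unique_at by blast
qed

lemma cutoff_calculus: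
  assumes cut: "cutoff_family M \<phi>" and M: "2 \<le> M" and L: "L \<in> Lambda1"
  obtains lo hi f1 f2 where "0 < ilength L" "lo \<le> hi" "hi - lo \<le> 3 / 2 * ilength L"
    "\<forall>\<xi>\<in>{lo..hi}. 3 / 4 * ilength L \<le> \<bar>\<xi>\<bar> \<and> \<bar>\<xi>\<bar> \<le> 9 / 4 * ilength L"
    "\<forall>\<xi>. \<xi> \<notin> {lo..hi} \<longrightarrow> \<phi> L \<xi> = 0"
    "\<forall>\<xi>. (\<phi> L has_vector_derivative f1 \<xi>) (at \<xi>)" "\<forall>\<xi>. (f1 has_vector_derivative f2 \<xi>) (at \<xi>)"
    "continuous_on UNIV f2" "\<phi> L lo = 0" "f1 lo = 0" "\<phi> L hi = 0" "f1 hi = 0"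
    "\<forall>\<xi>. norm (\<phi> L \<xi>) \<le> 10 ^ 10" "\<forall>\<xi>. norm (f1 \<xi>) \<le> 10 ^ 10 / ilength L"
    "\<forall>\<xi>. norm (f2 \<xi>) \<le> 10 ^ 10 / (ilength L)\<^sup>2"
proof -
  define l where "l = ilength L"
  obtain lo hi where b: "0 < l" "dilate (5/4) L \<subseteq> {lo + l / 8 .. hi - l / 8}" "hi - lo = 3 / 2 * l"
     "\<And>\<xi>. \<xi> \<in> {lo..hi} \<Longrightarrow> 3 / 4 * l \<le> \<bar>\<xi>\<bar> \<and> \<bar>\<xi>\<bar> \<le> 9 / 4 * l"
    using Lambda1_band[OF L] unfolding l_def by blast
  define f1 where "f1 = iter_deriv 1 (\<phi> L)"
  define f2 where "f2 = iter_deriv 2 (\<phi> L)"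
  have i0: "iter_deriv 0 (\<phi> L) = \<phi> L" by (simp add: iter_deriv_def)
  have i1: "f1 = (\<lambda>x. vector_derivative (\<phi> L) (at x))" by (simp add: f1_def iter_deriv_def)
  have i2: "f2 = (\<lambda>x. vector_derivative f1 (at x))"
    by (simp add: f1_def f2_def iter_deriv_def numeral_2_eq_2)
  have C: "C_k M (\<phi> L)" "closure {\<xi>. \<phi> L \<xi> \<noteq> 0} \<subseteq> dilate (5/4) L"
     "\<And>k \<xi>. k \<le> M \<Longrightarrow> l ^ k * norm (iter_deriv k (\<phi> L) \<xi>) \<le> 10 ^ 10"
    using cut L by (auto simp: cutoff_family_def l_def)
  have diff: "iter_deriv k (\<phi> L) differentiable (at x)" if "k < M" for k x
    using C(1) that by (simp add: C_k_def)
  have h0: "(\<phi> L has_vector_derivative f1 \<xi>) (at \<xi>)" for \<xi>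
    using diff[of 0 \<xi>] M by (simp add: i0 i1 vector_derivative_works[symmetric])
  have h1: "(f1 has_vector_derivative f2 \<xi>) (at \<xi>)" for \<xi>
  proof -
    have "f1 differentiable (at \<xi>)" unfolding f1_def using diff[of 1 \<xi>] M by linarith
    thus ?thesis by (simp add: i2 vector_derivative_works[symmetric])
  qed
  have c2: "continuous_on UNIV f2"
  proof (cases "M = 2")
    case True
    thus ?thesis using C(1) by (simp add: C_k_def f2_def)
  next
    case False
    hence "f2 differentiable (at x)" for x using diff[of 2 x] M by (simp add: f2_def)
    thus ?thesis by (auto simp: continuous_on_eq_continuous_at intro: differentiable_imp_continuous_within)
  qed
  have z: "\<phi> L \<xi> = 0" if "\<xi> \<notin> {lo + l / 8 .. hi - l / 8}" for \<xi>
  proof (rule ccontr)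
    assume "\<phi> L \<xi> \<noteq> 0"
    hence "\<xi> \<in> closure {\<xi>. \<phi> L \<xi> \<noteq> 0}" by (intro subsetD[OF closure_subset]) simp
    hence "\<xi> \<in> {lo + l / 8 .. hi - l / 8}" by (rule subsetD[OF subset_trans[OF C(2) b(2)]])
    thus False using that by contradiction
  qed
  have e0: "f1 \<xi> = 0" if "\<xi> \<notin> {lo + l / 8 .. hi - l / 8}" for \<xi>
  proof (rule vector_derivative_zero_nbhd[OF _ _ _ h0])
    show "open (- {lo + l / 8 .. hi - l / 8})" by auto
    show "\<xi> \<in> - {lo + l / 8 .. hi - l / 8}" using that by simp
    show "\<phi> L y = 0" if "y \<in> - {lo + l / 8 .. hi - l / 8}" for y by (rule z) (use that in simp)
  qed
  show ?thesis
  proof (rule that[of lo hi f1 f2])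
    show "\<forall>\<xi>. norm (\<phi> L \<xi>) \<le> 10 ^ 10" using C(3)[of 0] by (simp add: i0)
    show "\<forall>\<xi>. norm (f1 \<xi>) \<le> 10 ^ 10 / ilength L"
      using C(3)[of 1] M b(1) by (simp add: f1_def field_simps flip: l_def)
    show "\<forall>\<xi>. norm (f2 \<xi>) \<le> 10 ^ 10 / (ilength L)\<^sup>2"
      using C(3)[of 2] M b(1) by (simp add: f2_def field_simps flip: l_def)
  qed (use b h0 h1 c2 z e0 in \<open>auto simp flip: l_def\<close>)
qed

text \<open>Smoothness at scale \<open>l\<close> up to second order: each derivative costs a factor \<open>1 / l\<close>. The two
derivatives are witnesses, since the factor may be singular outside \<open>S\<close>.\<close>

definition smooth_factor :: "real \<Rightarrow> real set \<Rightarrow> (real \<Rightarrow> complex) \<Rightarrow> real \<Rightarrow> bool" where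
  "smooth_factor l S r R \<longleftrightarrow> (\<exists>r1 r2. continuous_on S r2 \<and>
     (\<forall>\<xi>\<in>S. (r has_vector_derivative r1 \<xi>) (at \<xi>) \<and> (r1 has_vector_derivative r2 \<xi>) (at \<xi>) \<and>
        norm (r \<xi>) \<le> R \<and> norm (r1 \<xi>) \<le> R / l \<and> norm (r2 \<xi>) \<le> R / l\<^sup>2))"

text \<open>The form in which the smoothness of the cutoffs is used: any factor that is smooth at scale \<open>|L|\<close>
on the band may be inserted. One such factor is the inverse of the multiplier of \<open>jump\<close>, the other
a difference of two characters.\<close>

lemma cutoff_kernel_decay:
  assumes cut: "cutoff_family M \<phi>" and M: "2 \<le> M" and L: "L \<in> Lambda1"
  obtains lo hi where "0 < ilength L"
    "\<forall>\<xi>\<in>{lo..hi}. 3 / 4 * ilength L \<le> \<bar>\<xi>\<bar> \<and> \<bar>\<xi>\<bar> \<le> 9 / 4 * ilength L"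
    "\<forall>\<xi>. \<xi> \<notin> {lo..hi} \<longrightarrow> \<phi> L \<xi> = 0" "continuous_on UNIV (\<phi> L)"
    "\<forall>r R x. smooth_factor (ilength L) {lo..hi} r R
      \<longrightarrow> integrable lborel (\<lambda>\<xi>. \<phi> L \<xi> * r \<xi>)
        \<and> norm (LINT \<xi>|lborel. \<phi> L \<xi> * r \<xi> * osc (x * \<xi>)) \<le> 12 * 10 ^ 10 * R * bump_scaled (1 / ilength L) x"
proof (rule cutoff_calculus[OF cut M L])
  define l where "l = ilength L"
  fix lo hi f1 f2
  assume l: "0 < ilength L" and lh: "lo \<le> hi" "hi - lo \<le> 3 / 2 * ilength L"
    and band: "\<forall>\<xi>\<in>{lo..hi}. 3 / 4 * ilength L \<le> \<bar>\<xi>\<bar> \<and> \<bar>\<xi>\<bar> \<le> 9 / 4 * ilength L"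
    and out: "\<forall>\<xi>. \<xi> \<notin> {lo..hi} \<longrightarrow> \<phi> L \<xi> = 0"
    and d1: "\<forall>\<xi>. (\<phi> L has_vector_derivative f1 \<xi>) (at \<xi>)" and d2: "\<forall>\<xi>. (f1 has_vector_derivative f2 \<xi>) (at \<xi>)"
    and c2: "continuous_on UNIV f2" and ends: "\<phi> L lo = 0" "f1 lo = 0" "\<phi> L hi = 0" "f1 hi = 0"
    and B: "\<forall>\<xi>. norm (\<phi> L \<xi>) \<le> 10 ^ 10" "\<forall>\<xi>. norm (f1 \<xi>) \<le> 10 ^ 10 / ilength L"
      "\<forall>\<xi>. norm (f2 \<xi>) \<le> 10 ^ 10 / (ilength L)\<^sup>2"
  have cphi: "continuous_on S (\<phi> L)" for S
    by (rule continuous_on_vector_derivative[OF has_vector_derivative_at_within[OF d1[rule_format]]])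
  show thesis
  proof (rule that[OF l band out cphi], intro allI impI)
    fix r :: "real \<Rightarrow> complex" and R x
    assume "smooth_factor (ilength L) {lo..hi} r R"
    then obtain r1 r2 where r2: "continuous_on {lo..hi} r2"
      and r: "\<forall>\<xi>\<in>{lo..hi}. (r has_vector_derivative r1 \<xi>) (at \<xi>) \<and> (r1 has_vector_derivative r2 \<xi>) (at \<xi>) \<and>
        norm (r \<xi>) \<le> R \<and> norm (r1 \<xi>) \<le> R / ilength L \<and> norm (r2 \<xi>) \<le> R / (ilength L)\<^sup>2"
      unfolding smooth_factor_def by (elim exE conjE)
    have R0: "0 \<le> R" by (rule order_trans[OF norm_ge_zero[of "r lo"]]) (use r lh in auto)
    have "continuous_on {lo..hi} r"
      by (rule continuous_on_vector_derivative[OF has_vector_derivative_at_within]) (use r in blast)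
    hence ca: "continuous_on {lo..hi} (\<lambda>\<xi>. \<phi> L \<xi> * r \<xi>)" by (intro continuous_on_mult cphi)
    have i: "integrable lborel (\<lambda>\<xi>. \<phi> L \<xi> * r \<xi>)"
      by (rule integral_supported_Icc(1)[OF ca]) (use out in simp)
    have "(LINT \<xi>|lborel. \<phi> L \<xi> * r \<xi> * osc (x * \<xi>)) = integral {lo..hi} (\<lambda>\<xi>. \<phi> L \<xi> * r \<xi> * osc (x * \<xi>))"
      by (rule integral_supported_Icc(2)) (use out in \<open>auto intro!: continuous_intros ca\<close>)
    also have "norm \<dots> \<le> 12 * 10 ^ 10 * R * ilength L / (1 + (ilength L * x)\<^sup>2)"
      by (rule product_kernel_decay[OF lh l d1[rule_format] d2[rule_format] c2 ends B[rule_format]])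
         (use r r2 in auto)
    also have "\<dots> = 12 * 10 ^ 10 * R * (ilength L / (1 + (ilength L * x)\<^sup>2))" by simp
    also have "\<dots> \<le> 12 * 10 ^ 10 * R * bump_scaled (1 / ilength L) x"
      using R0 l by (intro mult_left_mono bump_scaled_ge) auto
    finally show "integrable lborel (\<lambda>\<xi>. \<phi> L \<xi> * r \<xi>) \<and>
      norm (LINT \<xi>|lborel. \<phi> L \<xi> * r \<xi> * osc (x * \<xi>)) \<le> 12 * 10 ^ 10 * R * bump_scaled (1 / ilength L) x"
      using i by blast
  qed
qed

lemma freq_proj_eq:
  assumes [measurable]: "\<phi> L \<in> borel_measurable borel" "f \<in> borel_measurable borel"
  shows "freq_proj \<phi> L f x = (LINT \<xi>|lborel. \<phi> L \<xi> * fourier f \<xi> * osc (x * \<xi>))"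
proof -
  have "freq_proj \<phi> L f x = (LINT \<xi>|lebesgue. \<phi> L \<xi> * fourier f \<xi> * osc (x * \<xi>))"
    by (simp add: freq_proj_def osc_def mult_ac)
  also have "\<dots> = (LINT \<xi>|lborel. \<phi> L \<xi> * fourier f \<xi> * osc (x * \<xi>))"
    by (rule integral_completion) measurable
  finally show ?thesis .
qed

lemma ennreal_norm_integral_le:
  fixes h :: "real \<Rightarrow> complex"
  shows "ennreal (norm (LINT y|lborel. h y)) \<le> (\<integral>\<^sup>+y. ennreal (norm (h y)) \<partial>lborel)"
proof (cases "integrable lborel h")
  case True thus ?thesis by (rule integral_norm_bound_ennreal)
next
  case False thus ?thesis by (simp add: not_integrable_integral_eq)
qed

text \<open>Divide the cutoff by the multiplier of \<open>jump d\<close> with \<open>d = 1 / (4 |L|)\<close>. On the band of \<open>L\<close> the modulus of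
\<open>\<theta> = \<pi> \<xi> / (4 |L|)\<close> lies between \<open>3 \<pi> / 16\<close> and \<open>9 \<pi> / 16\<close>, where the multiplier is bounded away
from 0.\<close>

lemma freq_proj_le_jump:
  obtains R :: real where "0 < R"
    "\<And>M \<phi> L f x. cutoff_family M \<phi> \<Longrightarrow> 2 \<le> M \<Longrightarrow> L \<in> Lambda1 \<Longrightarrow> integrable lborel f \<Longrightarrow>
       ennreal (norm (freq_proj \<phi> L f x)) \<le> ennreal R *
         (\<integral>\<^sup>+y. ennreal (norm (jump (1 / (4 * ilength L)) f y) * bump_scaled (1 / ilength L) (x - y)) \<partial>lborel)"
proof -
  obtain P P1 P2 :: "real \<Rightarrow> complex" and R :: real where P:
    "\<And>\<theta>. 1 / 2 \<le> \<bar>\<theta>\<bar> \<Longrightarrow> \<bar>\<theta>\<bar> \<le> 2 \<Longrightarrow> P \<theta> * ((exp (\<i> * of_real \<theta>) - 1)\<^sup>2 / (\<i> * of_real \<theta>)) = 1"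
    and P1: "\<And>\<theta>. 1 / 2 \<le> \<bar>\<theta>\<bar> \<Longrightarrow> \<bar>\<theta>\<bar> \<le> 2 \<Longrightarrow> (P has_vector_derivative P1 \<theta>) (at \<theta>)"
    and P2: "\<And>\<theta>. 1 / 2 \<le> \<bar>\<theta>\<bar> \<Longrightarrow> \<bar>\<theta>\<bar> \<le> 2 \<Longrightarrow> (P1 has_vector_derivative P2 \<theta>) (at \<theta>)"
    and cP2: "continuous_on {\<theta>. 1 / 2 \<le> \<bar>\<theta>\<bar> \<and> \<bar>\<theta>\<bar> \<le> 2} P2"
    and R: "\<And>\<theta>. 1 / 2 \<le> \<bar>\<theta>\<bar> \<Longrightarrow> \<bar>\<theta>\<bar> \<le> 2 \<Longrightarrow> norm (P \<theta>) \<le> R"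
    "\<And>\<theta>. 1 / 2 \<le> \<bar>\<theta>\<bar> \<Longrightarrow> \<bar>\<theta>\<bar> \<le> 2 \<Longrightarrow> norm (P1 \<theta>) \<le> R"
    "\<And>\<theta>. 1 / 2 \<le> \<bar>\<theta>\<bar> \<Longrightarrow> \<bar>\<theta>\<bar> \<le> 2 \<Longrightarrow> norm (P2 \<theta>) \<le> R"
    by (rule multiplier_profile) blast
  have R0: "0 \<le> R" by (rule order_trans[OF norm_ge_zero R(1)[of 1]]) auto
  define R' where "R' = 12 * 10 ^ 10 * R + 1"
  have R': "0 < R'" using R0 by (simp add: R'_def)
  show ?thesis
  proof (rule that[OF R'])
    fix M :: nat and \<phi> L and f :: "real \<Rightarrow> complex" and x :: real
    assume cut: "cutoff_family M \<phi>" and M: "2 \<le> M" and L: "L \<in> Lambda1" and f: "integrable lborel f"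
    define l where "l = ilength L"
    obtain lo hi where l: "0 < l"
      and band: "\<forall>\<xi>\<in>{lo..hi}. 3 / 4 * l \<le> \<bar>\<xi>\<bar> \<and> \<bar>\<xi>\<bar> \<le> 9 / 4 * l"
      and out: "\<forall>\<xi>. \<xi> \<notin> {lo..hi} \<longrightarrow> \<phi> L \<xi> = 0" and cphi: "continuous_on UNIV (\<phi> L)"
      and decay: "\<forall>r R x. smooth_factor l {lo..hi} r R
        \<longrightarrow> integrable lborel (\<lambda>\<xi>. \<phi> L \<xi> * r \<xi>)
          \<and> norm (LINT \<xi>|lborel. \<phi> L \<xi> * r \<xi> * osc (x * \<xi>)) \<le> 12 * 10 ^ 10 * R * bump_scaled (1 / l) x"
      by (rule cutoff_kernel_decay[OF cut M L, folded l_def])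
    define c where "c = pi / (4 * l)"
    have c: "0 < c" "c \<le> 1 / l" using l pi_less_4 by (auto simp: c_def field_simps)
    have th: "1 / 2 \<le> \<bar>c * \<xi>\<bar> \<and> \<bar>c * \<xi>\<bar> \<le> 2" if "\<xi> \<in> {lo..hi}" for \<xi>
    proof -
      have "c * (3 / 4 * l) \<le> c * \<bar>\<xi>\<bar>" "c * \<bar>\<xi>\<bar> \<le> c * (9 / 4 * l)"
        using bspec[OF band that] c by (auto intro: mult_left_mono)
      moreover have "c * l = pi / 4" using l by (simp add: c_def)
      ultimately have "3 / 16 * pi \<le> c * \<bar>\<xi>\<bar>" "c * \<bar>\<xi>\<bar> \<le> 9 / 16 * pi" by (simp_all add: field_simps)
      moreover have "c * \<bar>\<xi>\<bar> = \<bar>c * \<xi>\<bar>" using c by (simp add: abs_mult)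
      moreover have "3 < pi" "pi < 3.2" using pi_gt3 pi_approx by auto
      ultimately show ?thesis by linarith
    qed
    define a where "a = (\<lambda>\<xi>. \<phi> L \<xi> * P (c * \<xi>))"
    define d where "d = 1 / (4 * l)"
    have d: "0 < d" using l by (simp add: d_def)
    have lin: "((*) c has_vector_derivative c) (at \<xi>)" for \<xi>
      using has_vector_derivative_mult_right[OF has_vector_derivative_id, of c] by simp
    have r1: "((\<lambda>\<xi>. P (c * \<xi>)) has_vector_derivative c *\<^sub>R P1 (c * \<xi>)) (at \<xi>)" if "\<xi> \<in> {lo..hi}" for \<xi>
      using vector_diff_chain_at[of "\<lambda>\<xi>. c * \<xi>" c \<xi> P "P1 (c * \<xi>)"] P1[of "c * \<xi>"] th[OF that]
      lin[of \<xi>] by (simp add: o_def)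
    have r2: "((\<lambda>\<xi>. c *\<^sub>R P1 (c * \<xi>)) has_vector_derivative c *\<^sub>R (c *\<^sub>R P2 (c * \<xi>))) (at \<xi>)" if "\<xi> \<in> {lo..hi}" for \<xi>
    proof -
      have "((\<lambda>\<xi>. P1 (c * \<xi>)) has_vector_derivative c *\<^sub>R P2 (c * \<xi>)) (at \<xi>)"
        using vector_diff_chain_at[of "\<lambda>\<xi>. c * \<xi>" c \<xi> P1 "P2 (c * \<xi>)"] P2[of "c * \<xi>"] th[OF that]
        lin[of \<xi>] by (simp add: o_def)
      thus ?thesis by (intro has_vector_derivative_scaleR[OF DERIV_const, simplified])
    qed
    have cr2: "continuous_on {lo..hi} (\<lambda>\<xi>. c *\<^sub>R (c *\<^sub>R P2 (c * \<xi>)))"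
      by (intro continuous_on_scaleR continuous_on_const continuous_on_compose2[OF cP2])
         (use th in \<open>auto intro!: continuous_intros\<close>)
    have rb: "norm (P (c * \<xi>)) \<le> R" "norm (c *\<^sub>R P1 (c * \<xi>)) \<le> R / l" "norm (c *\<^sub>R (c *\<^sub>R P2 (c * \<xi>))) \<le> R / l\<^sup>2"
      if "\<xi> \<in> {lo..hi}" for \<xi>
    proof -
      note t = th[OF that]
      show "norm (P (c * \<xi>)) \<le> R" using R(1) t by blast
      have "c * norm (P1 (c * \<xi>)) \<le> (1 / l) * R" using R(2) t c l by (intro mult_mono) auto
      thus "norm (c *\<^sub>R P1 (c * \<xi>)) \<le> R / l" using c by simp
      have "c * (c * norm (P2 (c * \<xi>))) \<le> (1 / l) * ((1 / l) * R)" using R(3) t c l by (intro mult_mono) auto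
      thus "norm (c *\<^sub>R (c *\<^sub>R P2 (c * \<xi>))) \<le> R / l\<^sup>2" using c by (simp add: power2_eq_square)
    qed
    have sf: "smooth_factor l {lo..hi} (\<lambda>\<xi>. P (c * \<xi>)) R"
      unfolding smooth_factor_def by (intro exI conjI ballI, rule cr2) (rule r1 r2 rb; assumption)+
    have D: "integrable lborel (\<lambda>\<xi>. \<phi> L \<xi> * P (c * \<xi>)) \<and>
      norm (LINT \<xi>|lborel. \<phi> L \<xi> * P (c * \<xi>) * osc (t * \<xi>)) \<le> 12 * 10 ^ 10 * R * bump_scaled (1 / l) t" for t
      by (rule decay[THEN spec, THEN spec, THEN spec, THEN mp, OF sf])
    have ia: "integrable lborel a" unfolding a_def by (rule D[THEN conjunct1])
    have a0: "a \<xi> = 0" if "\<xi> \<notin> {lo..hi}" for \<xi> using out that by (simp add: a_def)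
    have [measurable]: "\<phi> L \<in> borel_measurable borel"
      by (rule borel_measurable_continuous_onI[OF cphi])
    have [measurable]: "f \<in> borel_measurable borel" using f by auto
    have ij: "integrable lborel (jump d f)"
    proof -
      have s: "integrable lborel (slide (d / 2) f)" by (rule integrable_slide_complex) (use d f in auto)
      have "integrable lborel (\<lambda>x. slide (d / 2) f (d / 2 + x))"
        using lborel_integrable_real_affine[OF s, of 1 "d / 2"] by simp
      thus ?thesis using s unfolding jump_def by (rule Bochner_Integration.integrable_diff)
    qed
    have "freq_proj \<phi> L f x = (LINT \<xi>|lborel. a \<xi> * fourier (jump d f) \<xi> * osc (x * \<xi>))"
    proof -
      have m: "\<phi> L \<xi> * fourier f \<xi> * osc (x * \<xi>) = a \<xi> * fourier (jump d f) \<xi> * osc (x * \<xi>)" for \<xi>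
      proof (cases "\<xi> \<in> {lo..hi}")
        case True
        have x0: "\<xi> \<noteq> 0" using bspec[OF band True] l by auto
        have e: "pi * d * \<xi> = c * \<xi>" by (simp add: c_def d_def)
        have "a \<xi> * fourier (jump d f) \<xi> = \<phi> L \<xi> * (P (c * \<xi>) * ((exp (\<i> * of_real (c * \<xi>)) - 1)\<^sup>2 / (\<i> * of_real (c * \<xi>)))) * fourier f \<xi>"
          unfolding fourier_jump[OF d f x0] e a_def by (simp only: mult_ac)
        also have "\<dots> = \<phi> L \<xi> * fourier f \<xi>" using P[of "c * \<xi>"] th[OF True] by simp
        finally show ?thesis by simp
      next
        case False
        thus ?thesis by (simp add: a0 out)
      qed
      show ?thesis by (subst freq_proj_eq) (simp_all only: m, measurable)
    qed
    also have "\<dots> = (LINT y|lborel. jump d f y * (LINT \<xi>|lborel. a \<xi> * osc ((x - y) * \<xi>)))"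
      by (rule multiplier_fubini[OF ia ij])
    finally have eq: "freq_proj \<phi> L f x = (LINT y|lborel. jump d f y * (LINT \<xi>|lborel. a \<xi> * osc ((x - y) * \<xi>)))" .
    have K: "norm (LINT \<xi>|lborel. a \<xi> * osc (t * \<xi>)) \<le> R' * bump_scaled (1 / l) t" for t
    proof -
      have "norm (LINT \<xi>|lborel. a \<xi> * osc (t * \<xi>)) \<le> 12 * 10 ^ 10 * R * bump_scaled (1 / l) t"
        unfolding a_def by (rule D[THEN conjunct2])
      also have "\<dots> \<le> R' * bump_scaled (1 / l) t"
        using l bump_scaled_pos[of "1 / l" t] by (intro mult_right_mono) (auto simp: R'_def)
      finally show ?thesis .
    qed
    have bp: "0 \<le> bump_scaled (1 / l) t" for t using bump_scaled_pos[of "1 / l"] l less_imp_le by auto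
    have "ennreal (norm (freq_proj \<phi> L f x)) \<le>
        (\<integral>\<^sup>+y. ennreal (norm (jump d f y * (LINT \<xi>|lborel. a \<xi> * osc ((x - y) * \<xi>)))) \<partial>lborel)"
      unfolding eq by (rule ennreal_norm_integral_le)
    also have "\<dots> \<le> (\<integral>\<^sup>+y. ennreal R' * ennreal (norm (jump d f y) * bump_scaled (1 / l) (x - y)) \<partial>lborel)"
    proof (rule nn_integral_mono)
      fix y
      have "norm (jump d f y) * norm (LINT \<xi>|lborel. a \<xi> * osc ((x - y) * \<xi>))
          \<le> norm (jump d f y) * (R' * bump_scaled (1 / l) (x - y))"
        by (intro mult_left_mono K) simp
      hence "norm (jump d f y * (LINT \<xi>|lborel. a \<xi> * osc ((x - y) * \<xi>)))
          \<le> R' * (norm (jump d f y) * bump_scaled (1 / l) (x - y))" by (simp only: norm_mult mult.left_commute)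
      thus "ennreal (norm (jump d f y * (LINT \<xi>|lborel. a \<xi> * osc ((x - y) * \<xi>))))
        \<le> ennreal R' * ennreal (norm (jump d f y) * bump_scaled (1 / l) (x - y))"
        using R' bp by (subst ennreal_mult[symmetric]) (auto intro: ennreal_leI)
    qed
    also have "\<dots> = ennreal R' * (\<integral>\<^sup>+y. ennreal (norm (jump d f y) * bump_scaled (1 / l) (x - y)) \<partial>lborel)"
      by (rule nn_integral_cmult) measurable
    finally show "ennreal (norm (freq_proj \<phi> L f x)) \<le> ennreal R' *
         (\<integral>\<^sup>+y. ennreal (norm (jump (1 / (4 * ilength L)) f y) * bump_scaled (1 / ilength L) (x - y)) \<partial>lborel)"
      by (simp add: d_def l_def)
  qed
qed

section \<open>Low frequencies\<close>

lemma norm_osc_minus_1: "norm (osc s - 1) \<le> 2 * pi * \<bar>s\<bar>"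
proof -
  have "norm (osc s - 1) = 2 * \<bar>sin (2 * pi * s / 2)\<bar>" unfolding osc_def by (rule dist_exp_i_1)
  also have "\<dots> \<le> 2 * \<bar>2 * pi * s / 2\<bar>" using abs_sin_x_le_abs_x by (intro mult_left_mono) auto
  finally show ?thesis by (simp add: abs_mult)
qed

text \<open>The mean-zero condition permits subtracting the kernel at a fixed point \<open>c\<close>. The difference has
the symbol of \<open>\<Delta>\<^sub>L\<close> times \<open>exp (2 \<pi> i (c - y) \<xi>) - 1\<close>, which is smooth at scale \<open>|L|\<close> and of size
\<open>|L| |c - y|\<close> on the band.\<close>

lemma freq_proj_mean_zero:
  fixes f :: "real \<Rightarrow> complex"
  assumes cut: "cutoff_family M \<phi>" and M: "2 \<le> M" and L: "L \<in> Lambda1" and f: "integrable lborel f"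
    and supp: "\<And>y. y \<notin> {a..b} \<Longrightarrow> f y = 0" and mean: "(LINT y|lborel. f y) = 0"
    and low: "ilength L * (b - a) \<le> 1" and c: "c \<in> {a..b}"
  shows "norm (freq_proj \<phi> L f x)
    \<le> 480 * 10 ^ 10 * (ilength L * (b - a)) * bump_scaled (1 / ilength L) (x - c) * (LINT y|lborel. norm (f y))"
proof -
  define l where "l = ilength L"
  obtain lo hi where l: "0 < l"
    and band: "\<forall>\<xi>\<in>{lo..hi}. 3 / 4 * l \<le> \<bar>\<xi>\<bar> \<and> \<bar>\<xi>\<bar> \<le> 9 / 4 * l"
    and out: "\<forall>\<xi>. \<xi> \<notin> {lo..hi} \<longrightarrow> \<phi> L \<xi> = 0" and cphi: "continuous_on UNIV (\<phi> L)"
    and decay: "\<forall>r R x. smooth_factor l {lo..hi} r R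
        \<longrightarrow> integrable lborel (\<lambda>\<xi>. \<phi> L \<xi> * r \<xi>)
        \<and> norm (LINT \<xi>|lborel. \<phi> L \<xi> * r \<xi> * osc (x * \<xi>)) \<le> 12 * 10 ^ 10 * R * bump_scaled (1 / l) x"
    by (rule cutoff_kernel_decay[OF cut M L, folded l_def])
  have ab: "a \<le> b" using c by auto
  have low': "(b - a) * l \<le> 1" using low by (simp add: l_def mult.commute)
  have iphi: "integrable lborel (\<phi> L)"
    by (rule integral_supported_Icc(1)[of lo hi]) (use out continuous_on_subset[OF cphi] in auto)
  have [measurable]: "\<phi> L \<in> borel_measurable borel" "f \<in> borel_measurable borel" using iphi f by auto
  define K where "K = (\<lambda>t. LINT \<xi>|lborel. \<phi> L \<xi> * osc (t * \<xi>))"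
  have iK: "integrable lborel (\<lambda>\<xi>. \<phi> L \<xi> * osc (t * \<xi>))" for t
    by (rule Bochner_Integration.integrable_bound[OF iphi]) (auto simp: norm_mult)
  have eq: "freq_proj \<phi> L f x = (LINT y|lborel. f y * K (x - y))"
    by (subst freq_proj_eq) (simp_all add: multiplier_fubini[OF iphi f] K_def)
  have Kd: "norm (K (x - y) - K (x - c)) \<le> 12 * 10 ^ 10 * (40 * (l * (b - a))) * bump_scaled (1 / l) (x - c)"
    if y: "y \<in> {a..b}" for y
  proof -
    define u where "u = c - y"
    have u: "\<bar>u\<bar> \<le> b - a" using y c by (auto simp: u_def)
    have u1: "\<bar>u\<bar> * \<bar>u\<bar> \<le> (b - a) / l"
    proof -
      have "\<bar>u\<bar> * \<bar>u\<bar> \<le> (b - a) * (b - a)" using u by (intro mult_mono) auto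
      also have "\<dots> \<le> (b - a) * (1 / l)" using low' l ab by (intro mult_left_mono) (auto simp: field_simps)
      finally show ?thesis by simp
    qed
    let ?k = "2 * pi * \<i> * of_real u"
    have nk: "norm ?k = 2 * pi * \<bar>u\<bar>" by (simp add: norm_mult)
    have pi: "pi < 3.15" using pi_approx by simp
    have cr2: "continuous_on {lo..hi} (\<lambda>\<xi>. ?k * (?k * osc (u * \<xi>)))" by (intro continuous_intros)
    have sf: "smooth_factor l {lo..hi} (\<lambda>\<xi>. osc (u * \<xi>) - 1) (40 * (l * (b - a)))"
      unfolding smooth_factor_def
    proof (intro exI conjI ballI, rule cr2)
      fix \<xi> assume \<xi>: "\<xi> \<in> {lo..hi}"
      show d: "((\<lambda>\<xi>. osc (u * \<xi>) - 1) has_vector_derivative ?k * osc (u * \<xi>)) (at \<xi>)"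
        using has_vector_derivative_diff[OF osc_has_vector_derivative[of u \<xi> UNIV] has_vector_derivative_const[of 1]] by simp
      show "((\<lambda>\<xi>. ?k * osc (u * \<xi>)) has_vector_derivative ?k * (?k * osc (u * \<xi>))) (at \<xi>)"
        by (intro has_vector_derivative_mult_right osc_has_vector_derivative)
      have "norm (osc (u * \<xi>) - 1) \<le> 2 * pi * \<bar>u * \<xi>\<bar>" by (rule norm_osc_minus_1)
      also have "\<dots> \<le> 2 * 4 * ((b - a) * (9 / 4 * l))"
        unfolding abs_mult using u bspec[OF band \<xi>] pi ab by (intro mult_mono) auto
      also have "\<dots> \<le> 40 * (l * (b - a))" using ab l by (simp add: mult.commute)
      finally show "norm (osc (u * \<xi>) - 1) \<le> 40 * (l * (b - a))" .
      have "2 * pi * \<bar>u\<bar> \<le> 40 * (b - a)" using u pi by (intro mult_mono) auto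
      thus "norm (?k * osc (u * \<xi>)) \<le> 40 * (l * (b - a)) / l" using l unfolding norm_mult[of ?k] nk by simp
      have p2: "pi * pi \<le> 3.15 * 3.15" using pi by (intro mult_mono) auto
      have "norm (?k * (?k * osc (u * \<xi>))) = (4 * (pi * pi)) * (\<bar>u\<bar> * \<bar>u\<bar>)"
        unfolding norm_mult[of ?k] nk by (simp add: norm_mult)
      also have "\<dots> \<le> 40 * ((b - a) / l)" using u1 p2 by (intro mult_mono) auto
      also have "\<dots> = 40 * (l * (b - a)) / l\<^sup>2" using l by (simp add: power2_eq_square)
      finally show "norm (?k * (?k * osc (u * \<xi>))) \<le> 40 * (l * (b - a)) / l\<^sup>2" .
    qed
    have "osc ((x - y) * \<xi>) = osc (u * \<xi>) * osc ((x - c) * \<xi>)" for \<xi>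
      unfolding osc_add[symmetric] by (simp add: u_def algebra_simps)
    hence "\<phi> L \<xi> * osc ((x - y) * \<xi>) - \<phi> L \<xi> * osc ((x - c) * \<xi>) = \<phi> L \<xi> * (osc (u * \<xi>) - 1) * osc ((x - c) * \<xi>)" for \<xi>
      by (simp add: algebra_simps)
    hence "K (x - y) - K (x - c) = (LINT \<xi>|lborel. \<phi> L \<xi> * (osc (u * \<xi>) - 1) * osc ((x - c) * \<xi>))"
      unfolding K_def by (subst Bochner_Integration.integral_diff[symmetric, OF iK iK]) simp
    also have "norm \<dots> \<le> 12 * 10 ^ 10 * (40 * (l * (b - a))) * bump_scaled (1 / l) (x - c)"
      by (rule decay[THEN spec, THEN spec, THEN spec, THEN mp, OF sf, THEN conjunct2])
    finally show ?thesis .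
  qed
  define W where "W = 12 * 10 ^ 10 * (40 * (l * (b - a))) * bump_scaled (1 / l) (x - c)"
  have Kb: "norm (K t) \<le> (LINT \<xi>|lborel. norm (\<phi> L \<xi>))" for t
  proof -
    have "norm (K t) \<le> (LINT \<xi>|lborel. norm (\<phi> L \<xi> * osc (t * \<xi>)))" unfolding K_def by (rule integral_norm_bound)
    thus ?thesis by (simp add: norm_mult)
  qed
  have [measurable]: "K \<in> borel_measurable borel" unfolding K_def by measurable
  have ifK: "integrable lborel (\<lambda>y. f y * K (x - y))"
  proof (rule Bochner_Integration.integrable_bound)
    show "integrable lborel (\<lambda>y. norm (f y) * (LINT \<xi>|lborel. norm (\<phi> L \<xi>)))" using f by simp
    show "AE y in lborel. norm (f y * K (x - y)) \<le> norm (norm (f y) * (LINT \<xi>|lborel. norm (\<phi> L \<xi>)))"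
      using Kb order_trans[OF Kb abs_ge_self] by (intro AE_I2) (simp add: norm_mult abs_mult mult_left_mono)
  qed measurable
  have "freq_proj \<phi> L f x = (LINT y|lborel. f y * K (x - y)) - (LINT y|lborel. f y * K (x - c))"
    using mean by (simp add: eq)
  also have "\<dots> = (LINT y|lborel. f y * (K (x - y) - K (x - c)))"
    using f ifK by (subst Bochner_Integration.integral_diff[symmetric]) (auto simp: algebra_simps)
  finally have e: "freq_proj \<phi> L f x = (LINT y|lborel. f y * (K (x - y) - K (x - c)))" .
  have "norm (freq_proj \<phi> L f x) \<le> (LINT y|lborel. norm (f y * (K (x - y) - K (x - c))))"
    unfolding e by (rule integral_norm_bound)
  also have "\<dots> \<le> (LINT y|lborel. norm (f y) * W)"
  proof (rule integral_mono)
    have "integrable lborel (\<lambda>y. f y * K (x - y) - f y * K (x - c))"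
      using f ifK by (intro Bochner_Integration.integrable_diff integrable_mult_left)
    thus "integrable lborel (\<lambda>y. norm (f y * (K (x - y) - K (x - c))))"
      by (intro integrable_norm) (simp add: algebra_simps)
    show "integrable lborel (\<lambda>y. norm (f y) * W)" using f by simp
    fix y show "norm (f y * (K (x - y) - K (x - c))) \<le> norm (f y) * W"
    proof (cases "y \<in> {a..b}")
      case True
      show ?thesis unfolding norm_mult W_def by (intro mult_left_mono Kd[OF True]) simp
    qed (simp add: supp)
  qed
  also have "\<dots> = W * (LINT y|lborel. norm (f y))" by simp
  finally show ?thesis by (simp add: W_def l_def mult_ac)
qed

section \<open>Decomposition into logarithmic levels\<close>

definition level :: "(real \<Rightarrow> complex) \<Rightarrow> real \<Rightarrow> nat" where
  "level f x = nat \<lfloor>ln (exp 1 + norm (f x))\<rfloor>"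

definition piece :: "(real \<Rightarrow> complex) \<Rightarrow> nat \<Rightarrow> real \<Rightarrow> complex" where
  "piece f n x = (if level f x = n then f x else 0)"

text \<open>The pieces have disjoint supports, so at each point the sum of their lifts has at most one nonzero
term.\<close>

definition majorant :: "real \<Rightarrow> (real \<Rightarrow> complex) \<Rightarrow> real \<Rightarrow> real" where
  "majorant d f y = lift d (piece f (level f y)) y"

lemma level_bounds:
  "1 \<le> level f x" "real (level f x) \<le> ln (exp 1 + norm (f x))" "ln (exp 1 + norm (f x)) < real (level f x) + 1"
proof -
  have e: "exp 1 \<le> exp 1 + norm (f x)" by simp
  have "ln (exp 1) \<le> ln (exp 1 + norm (f x))" using e by (subst ln_le_cancel_iff) (auto intro: add_pos_nonneg)
  hence 1: "1 \<le> ln (exp 1 + norm (f x))" by simp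
  thus "1 \<le> level f x" unfolding level_def by linarith
  show "real (level f x) \<le> ln (exp 1 + norm (f x))" "ln (exp 1 + norm (f x)) < real (level f x) + 1"
    unfolding level_def using 1 by linarith+
qed

lemma level_measurable [measurable]:
  assumes [measurable]: "f \<in> borel_measurable borel"
  shows "level f \<in> measurable borel (count_space UNIV)"
  unfolding level_def by measurable

lemma piece_measurable [measurable]:
  assumes [measurable]: "f \<in> borel_measurable borel"
  shows "piece f n \<in> borel_measurable borel"
  unfolding piece_def by measurable

lemma norm_piece_le: "norm (piece f n x) \<le> norm (f x)" by (simp add: piece_def)

lemma norm_piece_bound: "norm (piece f n x) \<le> exp (real n + 1)"
proof (cases "level f x = n")
  case True
  have "exp 1 + norm (f x) = exp (ln (exp 1 + norm (f x)))" by (simp add: add_pos_nonneg)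
  also have "\<dots> \<le> exp (real n + 1)" using level_bounds(3)[of f x] True by simp
  finally have "norm (f x) \<le> exp (real n + 1)" using exp_gt_zero[of "1::real"] by linarith
  thus ?thesis using True by (simp add: piece_def)
qed (simp add: piece_def)

lemma integrable_piece: "integrable lborel f \<Longrightarrow> integrable lborel (piece f n)"
  by (rule Bochner_Integration.integrable_bound) (auto simp: norm_piece_le)

lemma majorant_measurable [measurable]:
  assumes [measurable]: "f \<in> borel_measurable borel"
  shows "majorant d f \<in> borel_measurable borel"
proof -
  have "(\<lambda>y. (\<lambda>n. lift d (piece f n)) (level f y) y) \<in> borel_measurable borel"
    by (rule measurable_compose_countable) measurable
  thus ?thesis by (simp add: majorant_def[abs_def])
qed

lemma lift_bounds:
  assumes d: "0 < d" and w: "integrable lborel w"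
  shows "0 \<le> lift d w y" "lift d w y \<le> 2 * norm (w y)"
proof -
  have [measurable]: "w \<in> borel_measurable borel" using w by auto
  have "0 \<le> trail d (ratio d w) y" "trail d (ratio d w) y \<le> 2"
    by (rule trail_nonneg[where B = 2] trail_le[where B = 2]; use ratio_bounds[OF d w] d in simp)+
  thus "0 \<le> lift d w y" "lift d w y \<le> 2 * norm (w y)"
    using mult_left_mono[of "trail d (ratio d w) y" 2 "norm (w y)"] by (auto simp: lift_def mult.commute)
qed

lemma majorant_bounds:
  assumes d: "0 < d" and f: "integrable lborel f"
  shows "0 \<le> majorant d f y" "majorant d f y \<le> 2 * norm (f y)"
  using lift_bounds[OF d integrable_piece[OF f, of "level f y"], of y] by (auto simp: majorant_def piece_def)

lemma ennreal_majorant: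
  "ennreal (majorant d f y) = (\<Sum>n. ennreal (lift d (piece f n) y))"
proof -
  have "(\<Sum>n. ennreal (lift d (piece f n) y)) = (\<Sum>n\<in>{level f y}. ennreal (lift d (piece f n) y))"
    by (rule suminf_finite) (auto simp: lift_def piece_def)
  thus ?thesis by (simp add: majorant_def)
qed

text \<open>The sum over the levels is infinite, but at each point of the window only one term is nonzero and
the pieces are dominated by \<open>f\<close>.\<close>

lemma slide_sums_pieces:
  assumes f: "integrable lborel f"
  shows "(\<lambda>n. slide d (piece f n) x) sums slide d f x"
proof -
  define g where "g = (\<lambda>n y. indicator {x..<x + d} y *\<^sub>R piece f n y)"
  have ng: "norm (g n y) \<le> norm (piece f n y)" for n y by (simp add: g_def indicator_def)
  have g0: "g n y = 0" if "n \<noteq> level f y" for n y using that by (simp add: g_def piece_def)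
  have ig: "integrable lborel (g n)" for n unfolding g_def by (intro integrable_indicator_Ico integrable_piece f)
  have fin: "finite {n. norm (g n y) \<noteq> 0}" for y
    by (rule finite_subset[of _ "{level f y}"]) (use g0 in auto)
  have "(\<lambda>n. integral\<^sup>L lborel (g n)) sums (LINT y|lborel. (\<Sum>n. g n y))"
  proof (rule sums_integral[OF ig])
    show "AE y in lborel. summable (\<lambda>n. norm (g n y))"
      by (intro AE_I2 summable_finite[of "{level f _}"]) (use g0 in auto)
    show "summable (\<lambda>n. LINT y|lborel. norm (g n y))"
    proof (rule summableI_nonneg_bounded)
      fix N :: nat
      have "(\<Sum>n<N. LINT y|lborel. norm (g n y)) = (LINT y|lborel. (\<Sum>n<N. norm (g n y)))"
        by (rule Bochner_Integration.integral_sum[symmetric]) (use ig in auto)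
      also have "\<dots> \<le> (LINT y|lborel. norm (f y))"
      proof (rule integral_mono)
        show "integrable lborel (\<lambda>y. \<Sum>n<N. norm (g n y))" using ig by auto
        show "integrable lborel (\<lambda>y. norm (f y))" using f by simp
        fix y
        have "(\<Sum>n<N. norm (g n y)) = (\<Sum>n\<in>{..<N} \<inter> {level f y}. norm (g n y))"
          by (rule sum.mono_neutral_right) (use g0 in auto)
        also have "\<dots> \<le> (\<Sum>n\<in>{level f y}. norm (g n y))" by (rule sum_mono2) auto
        also have "\<dots> \<le> norm (f y)" using ng[of "level f y" y] by (simp add: piece_def)
        finally show "(\<Sum>n<N. norm (g n y)) \<le> norm (f y)" .
      qed
      finally show "(\<Sum>n<N. LINT y|lborel. norm (g n y)) \<le> (LINT y|lborel. norm (f y))" .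
    qed simp
  qed
  moreover have "(\<Sum>n. g n y) = indicator {x..<x + d} y *\<^sub>R f y" for y
  proof -
    have "(\<Sum>n. g n y) = (\<Sum>n\<in>{level f y}. g n y)" by (rule suminf_finite) (use g0 in auto)
    thus ?thesis by (simp add: g_def piece_def)
  qed
  ultimately have "(\<lambda>n. integral\<^sup>L lborel (g n)) sums (LINT y|lborel. indicator {x..<x + d} y *\<^sub>R f y)" by simp
  thus ?thesis unfolding slide_def g_def by (rule bounded_linear.sums[OF bounded_linear_scaleR_right])
qed

lemma ennreal_norm_sums_le:
  fixes a :: "nat \<Rightarrow> complex"
  assumes "a sums s"
  shows "ennreal (norm s) \<le> (\<Sum>n. ennreal (norm (a n)))"
proof (rule LIMSEQ_le_const2)
  show "(\<lambda>N. ennreal (norm (\<Sum>n<N. a n))) \<longlonglongrightarrow> ennreal (norm s)"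
    using assms by (intro tendsto_ennrealI tendsto_norm) (simp add: sums_def)
  have "ennreal (norm (\<Sum>n<N. a n)) \<le> (\<Sum>n. ennreal (norm (a n)))" for N
  proof -
    have "ennreal (norm (\<Sum>n<N. a n)) \<le> ennreal (\<Sum>n<N. norm (a n))" by (intro ennreal_leI norm_sum)
    also have "\<dots> = (\<Sum>n<N. ennreal (norm (a n)))" by simp
    also have "\<dots> \<le> (\<Sum>n. ennreal (norm (a n)))" by (rule sum_le_suminf) auto
    finally show ?thesis .
  qed
  thus "\<exists>N. \<forall>n\<ge>N. ennreal (norm (\<Sum>n<n. a n)) \<le> (\<Sum>n. ennreal (norm (a n)))" by blast
qed

text \<open>The increment of \<open>f\<close> is at most the sum of those of its pieces, and each of them is dominated by its
own lift.\<close>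

lemma majorant_convolution:
  assumes d: "0 < d" "d \<le> l" and f: "integrable lborel f"
  shows "(\<integral>\<^sup>+z. ennreal (norm (jump d f z) * bump_scaled l (x - z)) \<partial>lborel)
    \<le> 3 * (\<integral>\<^sup>+y. ennreal (majorant d f y * bump_scaled l (x - y)) \<partial>lborel)"
proof -
  have [measurable]: "f \<in> borel_measurable borel" using f by auto
  have l: "0 < l" using d by simp
  have bp: "0 \<le> bump_scaled l t" for t using bump_scaled_pos[OF l] less_imp_le by blast
  have "(\<integral>\<^sup>+z. ennreal (norm (jump d f z) * bump_scaled l (x - z)) \<partial>lborel)
     \<le> (\<integral>\<^sup>+z. (\<Sum>n. ennreal (norm (jump d (piece f n) z) * bump_scaled l (x - z))) \<partial>lborel)"
  proof (rule nn_integral_mono)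
    fix z
    have "(\<lambda>n. jump d (piece f n) z) sums jump d f z"
      unfolding jump_def by (intro sums_diff slide_sums_pieces f)
    hence "ennreal (norm (jump d f z)) * ennreal (bump_scaled l (x - z))
       \<le> (\<Sum>n. ennreal (norm (jump d (piece f n) z))) * ennreal (bump_scaled l (x - z))"
      by (intro mult_right_mono ennreal_norm_sums_le) simp_all
    also have "\<dots> = (\<Sum>n. ennreal (norm (jump d (piece f n) z)) * ennreal (bump_scaled l (x - z)))"
      by (rule ennreal_suminf_multc[symmetric])
    finally show "ennreal (norm (jump d f z) * bump_scaled l (x - z))
       \<le> (\<Sum>n. ennreal (norm (jump d (piece f n) z) * bump_scaled l (x - z)))"
      using bp by (simp add: ennreal_mult')
  qed
  also have "\<dots> = (\<Sum>n. \<integral>\<^sup>+z. ennreal (norm (jump d (piece f n) z) * bump_scaled l (x - z)) \<partial>lborel)"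
    by (rule nn_integral_suminf) measurable
  also have "\<dots> \<le> (\<Sum>n. 3 * (\<integral>\<^sup>+y. ennreal (lift d (piece f n) y * bump_scaled l (x - y)) \<partial>lborel))"
    by (intro suminf_le lift_convolution d integrable_piece f) auto
  also have "\<dots> = 3 * (\<Sum>n. \<integral>\<^sup>+y. ennreal (lift d (piece f n) y * bump_scaled l (x - y)) \<partial>lborel)"
    by (rule ennreal_suminf_cmult)
  also have "(\<Sum>n. \<integral>\<^sup>+y. ennreal (lift d (piece f n) y * bump_scaled l (x - y)) \<partial>lborel)
     = (\<integral>\<^sup>+y. (\<Sum>n. ennreal (lift d (piece f n) y * bump_scaled l (x - y))) \<partial>lborel)"
    by (rule nn_integral_suminf[symmetric]) measurable
  also have "\<dots> = (\<integral>\<^sup>+y. ennreal (majorant d f y * bump_scaled l (x - y)) \<partial>lborel)"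
  proof (rule nn_integral_cong)
    fix y
    show "(\<Sum>n. ennreal (lift d (piece f n) y * bump_scaled l (x - y))) = ennreal (majorant d f y * bump_scaled l (x - y))"
      using bp by (simp add: ennreal_mult'' ennreal_majorant ennreal_suminf_multc)
  qed
  finally show ?thesis .
qed

text \<open>On the support of \<open>w\<close> the sum over the scales of the squares of the lifts is \<open>|w|\<^sup>2\<close> times this
function.\<close>

definition square_weight :: "real \<Rightarrow> (real \<Rightarrow> complex) \<Rightarrow> real \<Rightarrow> ennreal" where
  "square_weight d w y = (\<Sum>j. ennreal ((trail (d / 2 ^ j) (ratio (d / 2 ^ j) w) y)\<^sup>2))"

lemma square_weight_measurable [measurable]:
  assumes [measurable]: "w \<in> borel_measurable borel"
  shows "square_weight d w \<in> borel_measurable borel"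
  unfolding square_weight_def by measurable

lemma square_weight_energy:
  assumes f: "integrable lborel f" and supp: "\<And>y. y \<notin> {a..b} \<Longrightarrow> f y = 0"
    and ab: "a < b" and d: "0 < d" "d \<le> b - a" and n: "1 \<le> n"
  shows "(\<integral>\<^sup>+y. ennreal (norm (piece f n y)) * square_weight d (piece f n) y \<partial>lborel)
    \<le> ennreal (104 * (real n * (LINT y|lborel. norm (piece f n y)) + exp (- real n) * (b - a)))"
proof -
  let ?w = "piece f n"
  have [measurable]: "f \<in> borel_measurable borel" using f by auto
  have w: "integrable lborel ?w" by (rule integrable_piece[OF f])
  have ws: "?w y = 0" if "y \<notin> {a..b}" for y using supp[OF that] by (simp add: piece_def)
  have dj: "0 < d / 2 ^ j" for j :: nat using d by simp
  have "(\<integral>\<^sup>+y. ennreal (norm (?w y)) * square_weight d ?w y \<partial>lborel)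
     = (\<integral>\<^sup>+y. (\<Sum>j. ennreal (norm (?w y) * (trail (d / 2 ^ j) (ratio (d / 2 ^ j) ?w) y)\<^sup>2)) \<partial>lborel)"
    unfolding square_weight_def ennreal_suminf_cmult[symmetric] ennreal_mult'[OF norm_ge_zero] ..
  also have "\<dots> = (\<Sum>j. \<integral>\<^sup>+y. ennreal (norm (?w y) * (trail (d / 2 ^ j) (ratio (d / 2 ^ j) ?w) y)\<^sup>2) \<partial>lborel)"
    by (rule nn_integral_suminf) measurable
  also have "\<dots> \<le> ennreal (104 * (real n * (LINT y|lborel. norm (?w y)) + exp (- real n) * (b - a)))"
  proof (rule suminf_le_const)
    fix N
    have m: "0 \<le> mass d' ?w x" if "0 < d'" for d' x by (rule slide_nonneg[OF that]) simp
    have "(\<Sum>j<N. \<integral>\<^sup>+y. ennreal (norm (?w y) * (trail (d / 2 ^ j) (ratio (d / 2 ^ j) ?w) y)\<^sup>2) \<partial>lborel)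
       \<le> (\<Sum>j<N. \<integral>\<^sup>+z. ennreal ((norm (jump (d / 2 ^ j) ?w z))\<^sup>2 / mass (d / 2 ^ j) ?w z) \<partial>lborel)"
      by (intro sum_mono lift_energy w dj)
    also have "\<dots> = (\<Sum>j<N. ennreal (LINT z|lborel. (norm (jump (d / 2 ^ j) ?w z))\<^sup>2 / mass (d / 2 ^ j) ?w z))"
      by (intro sum.cong refl nn_integral_eq_integral energy_step(1)[OF w ws norm_piece_bound less_imp_le[OF ab] dj] AE_I2)
        (assumption, rule divide_nonneg_nonneg[OF zero_le_power2 m[OF dj]])
    also have "\<dots> = ennreal (\<Sum>j<N. LINT z|lborel. (norm (jump (d / 2 ^ j) ?w z))\<^sup>2 / mass (d / 2 ^ j) ?w z)"
      by (intro sum_ennreal integral_nonneg_AE AE_I2) (rule divide_nonneg_nonneg[OF zero_le_power2 m[OF dj]])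
    also have "\<dots> \<le> ennreal ((64 * real n + 40) * (LINT y|lborel. norm (?w y)) + 64 * exp (- real n) * (b - a))"
      by (intro ennreal_leI energy_sum[OF w ws norm_piece_bound ab d])
    also have "\<dots> \<le> ennreal (104 * (real n * (LINT y|lborel. norm (?w y)) + exp (- real n) * (b - a)))"
    proof (rule ennreal_leI)
      have "(64 * real n + 40) * (LINT y|lborel. norm (?w y)) \<le> (104 * real n) * (LINT y|lborel. norm (?w y))"
        using n by (intro mult_right_mono integral_nonneg_AE) auto
      moreover have "0 \<le> exp (- real n) * (b - a)" using ab by simp
      ultimately show "(64 * real n + 40) * (LINT y|lborel. norm (?w y)) + 64 * exp (- real n) * (b - a)
         \<le> 104 * (real n * (LINT y|lborel. norm (?w y)) + exp (- real n) * (b - a))"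
        unfolding distrib_left mult.assoc by linarith
    qed
    finally show "(\<Sum>j<N. \<integral>\<^sup>+y. ennreal (norm (?w y) * (trail (d / 2 ^ j) (ratio (d / 2 ^ j) ?w) y)\<^sup>2) \<partial>lborel)
       \<le> ennreal (104 * (real n * (LINT y|lborel. norm (?w y)) + exp (- real n) * (b - a)))" .
  qed simp
  finally show ?thesis .
qed

section \<open>Young functions\<close>

lemma log_power_absorb:
  assumes "0 \<le> s"
  obtains c :: real where "0 < c" "\<And>x. 0 \<le> x \<Longrightarrow> sqrt x * (1 + ln (1 + x)) powr s \<le> c * (1 + x)"
proof -
  define p where "p = max s 1"
  have p: "1 \<le> p" "s \<le> p" by (auto simp: p_def)
  show ?thesis
  proof (rule that[of "(1 + 2 * p) powr p"])
    show "0 < (1 + 2 * p) powr p" using p by simp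
    fix x :: real assume x: "0 \<le> x"
    define y where "y = 1 + x"
    have y: "1 \<le> y" using x by (simp add: y_def)
    have "ln (y powr (1 / (2 * p))) \<le> y powr (1 / (2 * p)) - 1"
      using y by (intro ln_le_minus_one) simp
    hence "ln y / (2 * p) \<le> y powr (1 / (2 * p))" using y by (simp add: ln_powr)
    hence l: "ln y \<le> 2 * p * y powr (1 / (2 * p))" using p by (simp add: field_simps)
    have "1 \<le> y powr (1 / (2 * p))" using y p by (intro ge_one_powr_ge_zero) auto
    hence "1 + ln y \<le> (1 + 2 * p) * y powr (1 / (2 * p))" using l by (simp add: algebra_simps)
    moreover have g: "1 \<le> 1 + ln y" using y by simp
    ultimately have "(1 + ln y) powr p \<le> ((1 + 2 * p) * y powr (1 / (2 * p))) powr p"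
      using p by (intro powr_mono2) auto
    also have "\<dots> = (1 + 2 * p) powr p * y powr (1 / 2)" using p y by (simp add: powr_mult powr_powr)
    finally have 1: "(1 + ln y) powr p \<le> (1 + 2 * p) powr p * sqrt y" using y by (simp add: powr_half_sqrt)
    have "(1 + ln y) powr s \<le> (1 + ln y) powr p" using g p by (intro powr_mono) auto
    hence "sqrt x * (1 + ln y) powr s \<le> sqrt y * ((1 + 2 * p) powr p * sqrt y)"
      using 1 x by (intro mult_mono) (auto simp: y_def)
    also have "\<dots> = (1 + 2 * p) powr p * y" using y by simp
    finally show "sqrt x * (1 + ln (1 + x)) powr s \<le> (1 + 2 * p) powr p * (1 + x)" by (simp add: y_def)
  qed
qed

lemma ln_e_add_ge_1: "0 \<le> t \<Longrightarrow> 1 \<le> ln (exp 1 + (t::real))"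
proof -
  assume "0 \<le> t"
  hence "ln (exp 1) \<le> ln (exp 1 + t)" by (subst ln_le_cancel_iff) (auto intro: add_pos_nonneg)
  thus ?thesis by simp
qed

lemma B_fun_nonneg: "0 \<le> t \<Longrightarrow> 0 \<le> B_fun s t" by (simp add: B_fun_def)

lemma B_fun_mono:
  assumes "0 \<le> s" "0 \<le> t" "t \<le> u" shows "B_fun s t \<le> B_fun s u"
proof -
  have "ln (exp 1 + t) \<le> ln (exp 1 + u)" using assms by (subst ln_le_cancel_iff) (auto intro: add_pos_nonneg)
  thus ?thesis unfolding B_fun_def using assms ln_e_add_ge_1[of t] by (intro mult_mono powr_mono2) auto
qed

lemma B_fun_ge: "0 \<le> s \<Longrightarrow> 0 \<le> t \<Longrightarrow> t \<le> B_fun s t"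
  using mult_left_mono[of 1 "ln (exp 1 + t) powr s" t] ge_one_powr_ge_zero[OF ln_e_add_ge_1]
  by (simp add: B_fun_def)

lemma B_fun_divide:
  assumes "0 \<le> s" "0 \<le> t" "1 \<le> C" shows "B_fun s (t / C) \<le> B_fun s t / C"
proof -
  have le: "t / C \<le> t" using assms by (simp add: divide_le_eq mult_le_cancel_left1)
  have "ln (exp 1 + t / C) \<le> ln (exp 1 + t)" using assms le by (subst ln_le_cancel_iff) (auto intro: add_pos_nonneg)
  moreover have "1 \<le> ln (exp 1 + t / C)" using assms by (intro ln_e_add_ge_1) simp
  ultimately have "t / C * ln (exp 1 + t / C) powr s \<le> t / C * ln (exp 1 + t) powr s"
    using assms by (intro mult_left_mono powr_mono2) auto
  thus ?thesis by (simp add: B_fun_def)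
qed

lemma B_fun_add:
  assumes "0 \<le> s" "0 \<le> t" "0 \<le> u" shows "B_fun s (t + u) \<le> B_fun s (2 * t) + B_fun s (2 * u)"
proof (cases "t \<le> u")
  case True
  have "B_fun s (t + u) \<le> B_fun s (2 * u)" by (rule B_fun_mono) (use assms True in auto)
  thus ?thesis using B_fun_nonneg[of "2 * t" s] assms by simp
next
  case False
  have "B_fun s (t + u) \<le> B_fun s (2 * t)" by (rule B_fun_mono) (use assms False in auto)
  thus ?thesis using B_fun_nonneg[of "2 * u" s] assms by simp
qed

text \<open>With \<open>A = n x\<close>, the logarithm of \<open>e + 4 t \<surd>A\<close> is at most \<open>4 n (1 + ln (1 + x))\<close>, since \<open>ln (e + t)\<close> and
\<open>ln (e + 2 n)\<close> are of order at most \<open>n\<close>. The factor \<open>\<surd>x (1 + ln (1 + x))\<^sup>s\<close> that remains grows more slowly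
than \<open>x\<close>, so the integrability of \<open>|f| A\<close> suffices for every power \<open>s\<close> of the logarithm.\<close>

lemma B_fun_level:
  assumes s: "0 \<le> s"
  obtains K :: real where "0 < K"
    "\<And>t n A. 0 \<le> t \<Longrightarrow> 1 \<le> n \<Longrightarrow> ln (exp 1 + t) < real n + 1 \<Longrightarrow> 0 \<le> A \<Longrightarrow>
      B_fun s (4 * (t * sqrt A)) \<le> K * (real n powr (s + 1 / 2) * t + real n powr (s - 1 / 2) * (t * A))"
proof -
  obtain c :: real where c: "0 < c" "\<And>x. 0 \<le> x \<Longrightarrow> sqrt x * (1 + ln (1 + x)) powr s \<le> c * (1 + x)"
    using log_power_absorb[OF s] by blast
  show ?thesis
  proof (rule that[of "4 * 4 powr s * c"])
    show "0 < 4 * 4 powr s * c" using c by simp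
    fix t A :: real and n :: nat
    assume t: "0 \<le> t" and n: "1 \<le> n" and lt: "ln (exp 1 + t) < real n + 1" and A: "0 \<le> A"
    define x where "x = A / n"
    have n0: "0 < real n" "1 \<le> real n" using n by auto
    have x: "0 \<le> x" using A by (simp add: x_def)
    have Ax: "A = real n * x" using n by (simp add: x_def)
    have e0: "1 \<le> exp (1::real)" by simp
    have e2: "2 \<le> exp (1::real)" using exp_ge_add_one_self[of 1] by simp
    have "0 \<le> (sqrt (real n) - sqrt x)\<^sup>2" by simp
    hence am: "2 * sqrt A \<le> real n + x" using x n0 by (simp add: power2_diff Ax real_sqrt_mult)
    have "exp 1 + 4 * (t * sqrt A) \<le> (exp 1 + t) * (exp 1 + 4 * sqrt A)"
    proof -
      have "exp 1 \<le> exp 1 * exp (1::real)" using mult_left_mono[OF e0, of "exp 1"] by simp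
      moreover have "0 \<le> t * exp 1" "0 \<le> exp 1 * (4 * sqrt A)" using t A by auto
      ultimately show ?thesis unfolding distrib_left distrib_right by linarith
    qed
    also have "\<dots> \<le> (exp 1 + t) * ((exp 1 + 2 * real n) * (1 + x))"
    proof (rule mult_left_mono)
      have "0 \<le> (exp 1 + 2 * real n - 2) * x" using x n0 e2 by (intro mult_nonneg_nonneg) auto
      thus "exp 1 + 4 * sqrt A \<le> (exp 1 + 2 * real n) * (1 + x)" using am by (simp add: algebra_simps)
    qed (use t in simp)
    finally have "ln (exp 1 + 4 * (t * sqrt A)) \<le> ln ((exp 1 + t) * ((exp 1 + 2 * real n) * (1 + x)))"
      using t A x n0 by (subst ln_le_cancel_iff) (auto intro!: add_pos_nonneg mult_pos_pos)
    also have "\<dots> = ln (exp 1 + t) + (ln (exp 1 + 2 * real n) + ln (1 + x))"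
    proof -
      have p: "0 < exp 1 + t" "0 < exp 1 + 2 * real n" "0 < 1 + x"
        using t x by (auto intro: add_pos_nonneg)
      thus ?thesis using mult_pos_pos[OF p(2,3)] by (simp add: ln_mult_pos)
    qed
    also have "\<dots> \<le> (real n + 1) + ((real n + 1) + ln (1 + x))"
    proof -
      have "exp 1 + 2 * real n \<le> exp 1 * (1 + real n)"
        using mult_right_mono[OF e2, of "real n"] by (simp add: algebra_simps)
      also have "\<dots> \<le> exp 1 * exp (real n)" by (intro mult_left_mono exp_ge_add_one_self) auto
      also have "\<dots> = exp (real n + 1)" by (simp add: exp_add)
      finally have "ln (exp 1 + 2 * real n) \<le> ln (exp (real n + 1))"
        using n0 by (subst ln_le_cancel_iff) (auto intro: add_pos_nonneg)
      thus ?thesis using lt by simp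
    qed
    also have "\<dots> \<le> 4 * real n * (1 + ln (1 + x))"
    proof -
      have "0 \<le> (4 * real n - 1) * ln (1 + x)" using x n0 by (intro mult_nonneg_nonneg) auto
      thus ?thesis using n0 by (simp add: algebra_simps)
    qed
    finally have l: "ln (exp 1 + 4 * (t * sqrt A)) \<le> 4 * real n * (1 + ln (1 + x))" .
    have "ln (exp 1 + 4 * (t * sqrt A)) powr s \<le> (4 * real n * (1 + ln (1 + x))) powr s"
      using l s ln_e_add_ge_1[of "4 * (t * sqrt A)"] t A by (intro powr_mono2) auto
    also have "\<dots> = 4 powr s * (real n powr s) * (1 + ln (1 + x)) powr s"
      using n0 x by (simp add: powr_mult)
    finally have "B_fun s (4 * (t * sqrt A)) \<le> 4 * (t * sqrt A) * (4 powr s * (real n powr s) * (1 + ln (1 + x)) powr s)"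
      unfolding B_fun_def using t A by (intro mult_left_mono) auto
    also have "\<dots> = 4 * 4 powr s * t * (real n powr s * sqrt (real n)) * (sqrt x * (1 + ln (1 + x)) powr s)"
      by (simp add: Ax real_sqrt_mult mult_ac)
    also have "\<dots> \<le> 4 * 4 powr s * t * (real n powr s * sqrt (real n)) * (c * (1 + x))"
      using c(2)[OF x] t by (intro mult_left_mono) auto
    also have "real n powr s * sqrt (real n) = real n powr (s + 1 / 2)"
      using n0 by (simp add: powr_add powr_half_sqrt)
    also have "4 * 4 powr s * t * real n powr (s + 1 / 2) * (c * (1 + x))
        = 4 * 4 powr s * c * (real n powr (s + 1 / 2) * t + (real n powr (s + 1 / 2) / real n) * (t * A))"
      using n0 by (simp add: x_def algebra_simps)
    also have "real n powr (s + 1 / 2) / real n = real n powr (s - 1 / 2)"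
      using n0 powr_diff[of "real n" "s + 1 / 2" 1] by simp
    finally show "B_fun s (4 * (t * sqrt A))
       \<le> 4 * 4 powr s * c * (real n powr (s + 1 / 2) * t + real n powr (s - 1 / 2) * (t * A))" .
  qed
qed

lemma ext_top_ennreal: "0 \<le> t \<Longrightarrow> ext_top h (ennreal t) = ennreal (h t)"
  by (simp add: ext_top_def)

lemma ext_top_mono:
  assumes h: "\<And>u v. 0 \<le> u \<Longrightarrow> u \<le> v \<Longrightarrow> h u \<le> h v" and xy: "x \<le> y"
  shows "ext_top h x \<le> ext_top h y"
proof (cases "y = top")
  case False
  hence "x \<noteq> top" using xy top_unique by auto
  moreover have "enn2real x \<le> enn2real y" using xy False by (intro enn2real_mono) (auto simp: top.not_eq_extremum)
  ultimately show ?thesis using False h by (simp add: ext_top_def ennreal_leI)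
qed (simp add: ext_top_def)

text \<open>The factor 2 counts the two intervals \<open>L\<close> of each length, and the summand 4 bounds the squares of the
low frequency terms. The value \<open>A = \<infinity>\<close> is admitted because the sum over the scales may diverge.\<close>

lemma modular_pointwise:
  assumes s: "0 \<le> s"
  obtains K :: real where "0 < K"
    "\<And>t n A. 0 \<le> t \<Longrightarrow> 1 \<le> n \<Longrightarrow> ln (exp 1 + t) < real n + 1 \<Longrightarrow>
      ext_top (B_fun s) (ext_top sqrt (2 * (ennreal (t\<^sup>2) * A) + 4))
      \<le> ennreal (K * real n powr (s + 1 / 2)) * ennreal t + ennreal (K * real n powr (s - 1 / 2)) * (ennreal t * A)
        + ennreal (B_fun s 4)"
proof -
  obtain K :: real where K: "0 < K"
    "\<And>t n A. 0 \<le> t \<Longrightarrow> 1 \<le> n \<Longrightarrow> ln (exp 1 + t) < real n + 1 \<Longrightarrow> 0 \<le> A \<Longrightarrow>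
      B_fun s (4 * (t * sqrt A)) \<le> K * (real n powr (s + 1 / 2) * t + real n powr (s - 1 / 2) * (t * A))"
    using B_fun_level[OF s] by metis
  show ?thesis
  proof (rule that[OF K(1)])
    fix t :: real and n :: nat and A :: ennreal
    assume t: "0 \<le> t" and n: "1 \<le> n" and lt: "ln (exp 1 + t) < real n + 1"
    have kn: "0 < K * real n powr (s - 1 / 2)" using K(1) n by simp
    show "ext_top (B_fun s) (ext_top sqrt (2 * (ennreal (t\<^sup>2) * A) + 4))
      \<le> ennreal (K * real n powr (s + 1 / 2)) * ennreal t + ennreal (K * real n powr (s - 1 / 2)) * (ennreal t * A)
        + ennreal (B_fun s 4)"
    proof (cases "A = top \<and> t \<noteq> 0")
      case True
      hence "ennreal (K * real n powr (s - 1 / 2)) * (ennreal t * A) = top"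
        using t K(1) n by (simp add: ennreal_mult_top)
      thus ?thesis by simp
    next
      case False
      obtain a where a: "0 \<le> a" "ennreal t * A = ennreal (t * a)" "ennreal (t\<^sup>2) * A = ennreal (t\<^sup>2 * a)"
      proof (cases "t = 0")
        case True
        show ?thesis by (rule that[of 0]) (simp_all add: True)
      next
        case t0: False
        hence "A \<noteq> top" using False by simp
        then obtain a where "A = ennreal a" "0 \<le> a" by (cases A) auto
        thus ?thesis using that[of a] t by (simp add: ennreal_mult)
      qed
      have e: "2 * (ennreal (t\<^sup>2) * A) + 4 = ennreal (2 * (t\<^sup>2 * a) + 4)"
        using a t by (simp add: ennreal_mult' flip: ennreal_numeral)
      have "sqrt (2 * (t\<^sup>2 * a) + 4) \<le> 2 * (t * sqrt a) + 2"
      proof (rule real_le_lsqrt)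
        have "(2 * (t * sqrt a) + 2)\<^sup>2 = 4 * (t\<^sup>2 * a) + 4 + 8 * (t * sqrt a)"
          using a by (simp add: power2_sum power_mult_distrib)
        moreover have "0 \<le> t\<^sup>2 * a" "0 \<le> t * sqrt a" using t a by auto
        ultimately show "2 * (t\<^sup>2 * a) + 4 \<le> (2 * (t * sqrt a) + 2)\<^sup>2" by linarith
      qed (use t a in auto)
      hence "B_fun s (sqrt (2 * (t\<^sup>2 * a) + 4)) \<le> B_fun s (2 * (t * sqrt a) + 2)"
        using t a by (intro B_fun_mono s) auto
      also have "\<dots> \<le> B_fun s (2 * (2 * (t * sqrt a))) + B_fun s (2 * 2)"
        using t a by (intro B_fun_add s) auto
      also have "2 * (2 * (t * sqrt a)) = 4 * (t * sqrt a)" by simp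
      also have "B_fun s (4 * (t * sqrt a)) \<le> K * (real n powr (s + 1 / 2) * t + real n powr (s - 1 / 2) * (t * a))"
        by (rule K(2)[OF t n lt a(1)])
      finally have "B_fun s (sqrt (2 * (t\<^sup>2 * a) + 4))
        \<le> K * real n powr (s + 1 / 2) * t + K * real n powr (s - 1 / 2) * (t * a) + B_fun s 4"
        by (simp add: algebra_simps)
      hence "ennreal (B_fun s (sqrt (2 * (t\<^sup>2 * a) + 4)))
        \<le> ennreal (K * real n powr (s + 1 / 2) * t + K * real n powr (s - 1 / 2) * (t * a) + B_fun s 4)"
        by (rule ennreal_leI)
      also have "\<dots> = ennreal (K * real n powr (s + 1 / 2)) * ennreal t + ennreal (K * real n powr (s - 1 / 2)) * (ennreal t * A)
        + ennreal (B_fun s 4)"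
        using t a K(1) B_fun_nonneg[of 4 s] by (simp add: ennreal_mult'[symmetric])
      finally have fin: "ennreal (B_fun s (sqrt (2 * (t\<^sup>2 * a) + 4)))
        \<le> ennreal (K * real n powr (s + 1 / 2)) * ennreal t + ennreal (K * real n powr (s - 1 / 2)) * (ennreal t * A)
        + ennreal (B_fun s 4)" .
      have "ext_top (B_fun s) (ext_top sqrt (ennreal X)) = ennreal (B_fun s (sqrt X))" if "0 \<le> X" for X
        using that by (simp add: ext_top_def)
      moreover have "0 \<le> 2 * (t\<^sup>2 * a) + 4" using a by simp
      ultimately show ?thesis unfolding e using fin by simp
    qed
  qed
qed

section \<open>Sums over dyadic intervals\<close>

lemma infsum_ennreal_le:
  fixes f :: "'a \<Rightarrow> ennreal"
  assumes "\<And>T. finite T \<Longrightarrow> T \<subseteq> A \<Longrightarrow> sum f T \<le> B"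
  shows "infsum f A \<le> B"
  by (subst nonneg_infsum_complete) (auto intro!: SUP_least assms)

lemma sum_dyadic_le:
  fixes c :: "real \<Rightarrow> ennreal"
  assumes "finite K"
  shows "(\<Sum>k\<in>K. c (2 powi k)) \<le> (\<Sum>j. c (2 powi (k0 + int j))) + (\<Sum>j. c (2 powi (k0 - 1 - int j)))"
proof -
  have bd: "(\<Sum>k\<in>K'. c (2 powi k)) \<le> (\<Sum>j. c (2 powi (g j)))"
    if "finite K'" "\<And>k. k \<in> K' \<Longrightarrow> g (h k) = k" for K' g and h :: "int \<Rightarrow> nat"
  proof -
    have inj: "inj_on h K'" by (rule inj_on_inverseI[of _ g]) (use that in auto)
    have "(\<Sum>k\<in>K'. c (2 powi k)) = (\<Sum>j\<in>h ` K'. c (2 powi (g j)))"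
      by (subst sum.reindex[OF inj]) (auto simp: that intro!: sum.cong)
    also have "\<dots> \<le> (\<Sum>j. c (2 powi (g j)))" by (rule sum_le_suminf) (use that in auto)
    finally show ?thesis .
  qed
  have "K = {k\<in>K. k0 \<le> k} \<union> {k\<in>K. k < k0}" by auto
  hence "(\<Sum>k\<in>K. c (2 powi k)) = (\<Sum>k\<in>{k\<in>K. k0 \<le> k} \<union> {k\<in>K. k < k0}. c (2 powi k))" by simp
  also have "\<dots> = (\<Sum>k\<in>{k\<in>K. k0 \<le> k}. c (2 powi k)) + (\<Sum>k\<in>{k\<in>K. k < k0}. c (2 powi k))"
    by (rule sum.union_disjoint) (use assms in auto)
  also have "\<dots> \<le> (\<Sum>j. c (2 powi (k0 + int j))) + (\<Sum>j. c (2 powi (k0 - 1 - int j)))"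
    by (rule add_mono; rule bd[where h = "\<lambda>k. if k0 \<le> k then nat (k - k0) else nat (k0 - 1 - k)"]) (use assms in auto)
  finally show ?thesis .
qed

text \<open>Each dyadic length is attained by one positive and one negative interval. The lengths are
enumerated upwards from \<open>2 powi k0\<close> and downwards below it, so as to separate high from low
frequencies.\<close>

lemma infsum_Lambda1_le:
  fixes c :: "real \<Rightarrow> ennreal"
  shows "(\<Sum>\<^sub>\<infinity>L\<in>Lambda1. c (ilength L))
    \<le> 2 * ((\<Sum>j. c (2 powi (k0 + int j))) + (\<Sum>j. c (2 powi (k0 - 1 - int j))))"
proof (rule infsum_ennreal_le)
  fix T :: "real set set" assume T: "finite T" "T \<subseteq> Lambda1"
  let ?S = "(\<Sum>j. c (2 powi (k0 + int j))) + (\<Sum>j. c (2 powi (k0 - 1 - int j)))"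
  define p where "p = (\<lambda>k::int. {2 powi k ..< 2 powi (k + 1) :: real})"
  define q where "q = (\<lambda>k::int. uminus ` {2 powi k ..< 2 powi (k + 1) :: real})"
  have half: "(\<Sum>L\<in>T'. c (ilength L)) \<le> ?S"
    if T': "finite T'" "T' \<subseteq> range r" and r: "\<And>k. ilength (r k) = 2 powi k" for T' and r :: "int \<Rightarrow> real set"
  proof -
    obtain K where K: "finite K" "T' = r ` K" using finite_subset_image[OF T'] by auto
    have "inj r"
    proof (rule injI)
      fix k k' assume "r k = r k'"
      hence "(2::real) powi k = 2 powi k'" using r by metis
      thus "k = k'"
        using power_int_strict_increasing[of k k' "2::real"] power_int_strict_increasing[of k' k "2::real"]
        by (cases k k' rule: linorder_cases) auto
    qed
    hence "(\<Sum>L\<in>T'. c (ilength L)) = (\<Sum>k\<in>K. c (2 powi k))"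
      unfolding K(2) by (subst sum.reindex) (auto simp: r intro: inj_on_subset)
    thus ?thesis using sum_dyadic_le[OF K(1)] by simp
  qed
  have "T = (T \<inter> range p) \<union> (T - range p)" by auto
  hence "(\<Sum>L\<in>T. c (ilength L)) = (\<Sum>L\<in>(T \<inter> range p) \<union> (T - range p). c (ilength L))" by simp
  also have "\<dots> = (\<Sum>L\<in>T \<inter> range p. c (ilength L)) + (\<Sum>L\<in>T - range p. c (ilength L))"
    by (rule sum.union_disjoint) (use T in auto)
  also have "\<dots> \<le> ?S + ?S"
  proof (rule add_mono)
    show "(\<Sum>L\<in>T \<inter> range p. c (ilength L)) \<le> ?S"
      by (rule half[of _ p]) (use T ilength_dyadic in \<open>auto simp: p_def\<close>)
    show "(\<Sum>L\<in>T - range p. c (ilength L)) \<le> ?S"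
      by (rule half[of _ q]) (use T ilength_dyadic in \<open>auto simp: p_def q_def Lambda1_def\<close>)
  qed
  finally show "(\<Sum>L\<in>T. c (ilength L)) \<le> 2 * ?S" by (simp only: mult_2)
qed

lemma summable_powr_exp:
  "summable (\<lambda>n. real n powr s * exp (- real n))"
proof (rule summable_comparison_test')
  define p where "p = max s 1"
  have p: "1 \<le> p" "s \<le> p" by (auto simp: p_def)
  show "summable (\<lambda>n. (2 * p) powr p * exp (- 1 / 2) ^ n)"
    by (intro summable_mult summable_geometric) simp
  fix n :: nat assume n: "1 \<le> n"
  have "real n / (2 * p) \<le> exp (real n / (2 * p))" using exp_ge_add_one_self[of "real n / (2 * p)"] by linarith
  hence "real n \<le> 2 * p * exp (real n / (2 * p))" using p by (simp add: field_simps)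
  hence "real n powr p \<le> (2 * p * exp (real n / (2 * p))) powr p" using p by (intro powr_mono2) auto
  also have "\<dots> = (2 * p) powr p * exp (real n / 2)" using p by (simp add: powr_mult powr_def[of "exp _"])
  finally have "real n powr p \<le> (2 * p) powr p * exp (real n / 2)" .
  moreover have "real n powr s \<le> real n powr p" using n p by (intro powr_mono) auto
  ultimately have "real n powr s * exp (- real n) \<le> ((2 * p) powr p * exp (real n / 2)) * exp (- real n)"
    by (intro mult_right_mono) auto
  also have "\<dots> = (2 * p) powr p * exp (- 1 / 2) ^ n"
    by (simp add: mult.assoc exp_add[symmetric] exp_of_nat_mult[symmetric])
  finally show "norm (real n powr s * exp (- real n)) \<le> (2 * p) powr p * exp (- 1 / 2) ^ n" by simp
qed

section \<open>The dominating family\<close>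

lemma finite_intervalE:
  assumes "finite_interval J"
  obtains a b where "a < b" "J \<subseteq> {a..b}" "{a<..<b} \<subseteq> J" "ilength J = b - a" "J \<in> sets borel" "J \<subseteq> dilate 5 J"
proof -
  have J: "is_interval J" "bounded J" "0 < ilength J" using assms by (auto simp: finite_interval_def)
  have ne: "J \<noteq> {}" using J(3) by auto
  have bd: "bdd_above J" "bdd_below J" using J(2) by (auto simp: bounded_imp_bdd_above bounded_imp_bdd_below)
  define a b where "a = Inf J" and "b = Sup J"
  have sub: "J \<subseteq> {a..b}" using bd by (auto simp: a_def b_def intro: cInf_lower cSup_upper)
  have sup: "{a<..<b} \<subseteq> J"
  proof
    fix x assume "x \<in> {a<..<b}"
    hence "Inf J < x" "x < Sup J" by (auto simp: a_def b_def)
    then obtain y z where "y \<in> J" "y < x" "z \<in> J" "x < z"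
      using ne bd by (meson cInf_lessD less_cSupD)
    thus "x \<in> J" using J(1) unfolding is_interval_1 by (meson less_imp_le)
  qed
  have "J = {a<..<b} \<union> (J \<inter> {a, b})" using sub sup by force
  moreover have "{a<..<b} \<union> (J \<inter> {a, b}) \<in> sets borel" by (rule sets.Un[OF _ borel_closed[OF finite_imp_closed]]) auto
  ultimately have Jb: "J \<in> sets borel" by metis
  have ab0: "a \<le> b" using ne sub by force
  have Jl: "J \<in> sets lebesgue" using Jb by simp
  have "ilength J \<le> measure lebesgue {a..b}" by (rule measure_mono_fmeasurable[OF sub Jl]) simp
  moreover have "measure lebesgue {a<..<b} \<le> ilength J"
    by (rule measure_mono_fmeasurable[OF sup _ fmeasurableI2[OF _ sub Jl]]) simp_all
  ultimately have len: "ilength J = b - a" using ab0 by simp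
  have ab: "a < b" using J(3) len by simp
  have "J \<subseteq> dilate 5 J"
  proof
    fix x assume x: "x \<in> J"
    define m where "m = (a + b) / 2"
    define y where "y = m + (x - m) / 5"
    have "a \<le> x" "x \<le> b" using x sub by auto
    hence "y \<in> {a<..<b}" using ab by (auto simp: y_def m_def field_simps)
    hence "y \<in> J" using sup by blast
    moreover have "x = m + 5 * (y - m)" by (simp add: y_def field_simps)
    ultimately show "x \<in> dilate 5 J" unfolding dilate_def Let_def a_def[symmetric] b_def[symmetric] m_def[symmetric] by blast
  qed
  thus ?thesis using that ab sub sup len Jb by blast
qed

text \<open>For low frequencies the constant makes the average over \<open>J\<close> equal to the gain \<open>|L| |J|\<close> from the
mean-zero condition times the mean of \<open>|f|\<close>.\<close>

definition family :: "real set \<Rightarrow> (real \<Rightarrow> complex) \<Rightarrow> real set \<Rightarrow> real \<Rightarrow> real" where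
  "family J f L y = (if 1 / ilength J \<le> ilength L then majorant (1 / (4 * ilength L)) f y
     else ilength L * (LINT x|lborel. norm (f x)) * indicator J y)"

lemma family_measurable [measurable]:
  assumes [measurable]: "f \<in> borel_measurable borel" "J \<in> sets borel"
  shows "family J f L \<in> borel_measurable borel"
proof (cases "1 / ilength J \<le> ilength L")
  case True
  hence "family J f L = majorant (1 / (4 * ilength L)) f" by (auto simp: family_def)
  thus ?thesis by simp
next
  case False
  hence "family J f L = (\<lambda>y. ilength L * (LINT x|lborel. norm (f x)) * indicator J y)" by (auto simp: family_def)
  thus ?thesis by simp
qed

lemma ilength_pos: "L \<in> Lambda1 \<Longrightarrow> 0 < ilength L"
  by (rule Lambda1_band) auto

lemma family_nonneg:
  assumes "L \<in> Lambda1" "integrable lborel f"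
  shows "0 \<le> family J f L y"
  unfolding family_def using majorant_bounds(1)[of "1 / (4 * ilength L)" f y] ilength_pos[OF assms(1)] assms(2)
  by (auto intro!: mult_nonneg_nonneg)

lemma family_integrable:
  assumes L: "L \<in> Lambda1" and f: "integrable lborel f" and J: "finite_interval J"
  shows "integrable lborel (family J f L)"
proof -
  obtain a b where J': "J \<subseteq> {a..b}" "J \<in> sets borel" by (rule finite_intervalE[OF J])
  have l: "0 < ilength L" by (rule ilength_pos[OF L])
  have [measurable]: "f \<in> borel_measurable borel" using f by auto
  show ?thesis
  proof (cases "1 / ilength J \<le> ilength L")
    case True
    hence e: "family J f L = majorant (1 / (4 * ilength L)) f" by (auto simp: family_def)
    show ?thesis unfolding e
    proof (rule Bochner_Integration.integrable_bound)
      show "integrable lborel (\<lambda>y. 2 * norm (f y))" using f by simp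
      show "AE y in lborel. norm (majorant (1 / (4 * ilength L)) f y) \<le> norm (2 * norm (f y))"
        using majorant_bounds[of "1 / (4 * ilength L)" f] l f by (intro AE_I2) simp
    qed measurable
  next
    case False
    hence e: "family J f L = (\<lambda>y. ilength L * (LINT x|lborel. norm (f x)) * indicator J y)" by (auto simp: family_def)
    have "emeasure lborel J \<le> emeasure lborel {a..b}" using J' by (intro emeasure_mono) auto
    also have "\<dots> < \<infinity>" by (simp add: emeasure_lborel_Icc_eq)
    finally have "integrable lborel (indicator J :: real \<Rightarrow> real)" using J' by (intro integrable_real_indicator) auto
    thus ?thesis unfolding e by simp
  qed
qed

lemma family_outside:
  assumes "\<And>y. y \<notin> J \<Longrightarrow> f y = 0" "y \<notin> J"
  shows "family J f L y = 0"
  using assms by (simp add: family_def majorant_def lift_def piece_def)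

lemma bump_le_1: "bump x \<le> 1"
proof -
  have "1 \<le> 1 + \<bar>x\<bar>\<^sup>2" by simp
  hence "(1 + \<bar>x\<bar>\<^sup>2) powr (- 3 / 4) \<le> (1 + \<bar>x\<bar>\<^sup>2) powr 0" by (intro powr_mono) auto
  also have "\<dots> = 1" using add_pos_nonneg[of 1 "\<bar>x\<bar>\<^sup>2"] by (subst powr_zero_eq_one) auto
  finally show ?thesis by (simp add: bump_def)
qed

lemma conv_family:
  assumes l: "0 < l" and F: "integrable lborel F" and nn: "\<And>y. 0 \<le> F y"
  shows "conv_exists F (bump_scaled l)" "ennreal (conv F (bump_scaled l) x) = (\<integral>\<^sup>+y. ennreal (F y * bump_scaled l (x - y)) \<partial>lborel)"
    "0 \<le> conv F (bump_scaled l) x"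
proof -
  have [measurable]: "F \<in> borel_measurable borel" using F by auto
  have bp: "0 \<le> bump_scaled l t" for t using bump_scaled_pos[OF l] less_imp_le by blast
  have bb: "bump_scaled l t \<le> inverse l" for t
    unfolding bump_scaled_def using bump_le_1[of "t / l"] l by (simp add: mult_le_cancel_left1)
  have i: "integrable lborel (\<lambda>y. F y * bump_scaled l (x - y))" for x
  proof (rule Bochner_Integration.integrable_bound)
    show "integrable lborel (\<lambda>y. F y * inverse l)" using F by simp
    show "AE y in lborel. norm (F y * bump_scaled l (x - y)) \<le> norm (F y * inverse l)"
      using bp bb nn l by (intro AE_I2) (simp add: abs_mult mult_left_mono)
  qed measurable
  show "conv_exists F (bump_scaled l)"
    unfolding conv_exists_def using i by (auto simp: integrable_completion)
  have e: "conv F (bump_scaled l) x = (LINT y|lborel. F y * bump_scaled l (x - y))"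
    unfolding conv_def by (rule integral_completion) measurable
  show "ennreal (conv F (bump_scaled l) x) = (\<integral>\<^sup>+y. ennreal (F y * bump_scaled l (x - y)) \<partial>lborel)"
    unfolding e by (rule nn_integral_eq_integral[OF i, symmetric]) (use nn bp in simp)
  show "0 \<le> conv F (bump_scaled l) x" unfolding e using nn bp by (intro integral_nonneg_AE) simp
qed

lemma family_dominates:
  obtains K :: real where "0 < K"
    "\<And>M \<phi> J f L x. cutoff_family M \<phi> \<Longrightarrow> 2 \<le> M \<Longrightarrow> finite_interval J \<Longrightarrow> integrable lborel f \<Longrightarrow>
       (\<And>y. y \<notin> J \<Longrightarrow> f y = 0) \<Longrightarrow> L \<in> Lambda1 \<Longrightarrow> L \<in> Lambda1_high J \<or> (LINT y|lborel. f y) = 0 \<Longrightarrow>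
       norm (freq_proj \<phi> L f x) \<le> K * conv (family J f L) (bump_scaled (1 / ilength L)) x"
proof -
  obtain R :: real where R: "0 < R"
    "\<And>M \<phi> L f x. cutoff_family M \<phi> \<Longrightarrow> 2 \<le> M \<Longrightarrow> L \<in> Lambda1 \<Longrightarrow> integrable lborel f \<Longrightarrow>
       ennreal (norm (freq_proj \<phi> L f x)) \<le> ennreal R *
         (\<integral>\<^sup>+y. ennreal (norm (jump (1 / (4 * ilength L)) f y) * bump_scaled (1 / ilength L) (x - y)) \<partial>lborel)"
    using freq_proj_le_jump by blast
  define K where "K = 3 * R + 3 * (480 * 10 ^ 10)"
  show ?thesis
  proof (rule that[of K])
    show "0 < K" using R(1) by (simp add: K_def)
    fix M :: nat and \<phi> J L and f :: "real \<Rightarrow> complex" and x :: real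
    assume cut: "cutoff_family M \<phi>" and M: "2 \<le> M" and J: "finite_interval J" and f: "integrable lborel f"
      and supp: "\<And>y. y \<notin> J \<Longrightarrow> f y = 0" and L: "L \<in> Lambda1" and alt: "L \<in> Lambda1_high J \<or> (LINT y|lborel. f y) = 0"
    obtain a b where ab: "a < b" "J \<subseteq> {a..b}" "{a<..<b} \<subseteq> J" "ilength J = b - a" "J \<in> sets borel"
      by (rule finite_intervalE[OF J])
    have [measurable]: "f \<in> borel_measurable borel" "J \<in> sets borel" using f ab by auto
    define l where "l = ilength L"
    have l: "0 < l" unfolding l_def by (rule ilength_pos[OF L])
    have l': "0 < 1 / l" using l by simp
    let ?c = "conv (family J f L) (bump_scaled (1 / l)) x"
    note cf0 = l' family_integrable[OF L f J] family_nonneg[OF L f]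
    note cf = conv_family(1)[OF cf0] conv_family(2,3)[OF cf0, where x = x]
    show "norm (freq_proj \<phi> L f x) \<le> K * conv (family J f L) (bump_scaled (1 / ilength L)) x"
    proof (cases "1 / ilength J \<le> l")
      case True
      have fam: "family J f L = majorant (1 / (4 * l)) f" using True by (auto simp: family_def l_def)
      have "ennreal (norm (freq_proj \<phi> L f x)) \<le> ennreal R *
         (\<integral>\<^sup>+y. ennreal (norm (jump (1 / (4 * l)) f y) * bump_scaled (1 / l) (x - y)) \<partial>lborel)"
        unfolding l_def by (rule R(2)[OF cut M L f])
      also have "\<dots> \<le> ennreal R * (3 * (\<integral>\<^sup>+y. ennreal (majorant (1 / (4 * l)) f y * bump_scaled (1 / l) (x - y)) \<partial>lborel))"
        by (intro mult_left_mono majorant_convolution f) (use l in \<open>auto simp: field_simps\<close>)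
      also have "\<dots> = ennreal R * (3 * ennreal ?c)" using cf(2) by (simp only: fam)
      also have "\<dots> = ennreal (3 * R * ?c)"
        using R(1) cf(3) by (simp add: ennreal_mult' ennreal_mult'' mult_ac flip: ennreal_numeral)
      finally have "norm (freq_proj \<phi> L f x) \<le> 3 * R * ?c"
        using R(1) cf(3) by (subst (asm) ennreal_le_iff) auto
      also have "\<dots> \<le> K * ?c" using cf(3) by (intro mult_right_mono) (simp_all add: K_def)
      finally show ?thesis by (simp add: l_def)
    next
      case False
      hence mean: "(LINT y|lborel. f y) = 0" using alt by (auto simp: Lambda1_high_def l_def)
      have low: "l * (b - a) \<le> 1" using False ab by (simp add: field_simps)
      define m where "m = (LINT y|lborel. norm (f y))"
      have m: "0 \<le> m" unfolding m_def by (intro integral_nonneg_AE) simp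
      have fam: "family J f L = (\<lambda>y. l * m * indicator J y)" using False by (auto simp: family_def l_def m_def)
      have supp': "f y = 0" if "y \<notin> {a..b}" for y using supp ab that by blast
      have 1: "norm (freq_proj \<phi> L f x) \<le> 480 * 10 ^ 10 * (l * (b - a)) * bump_scaled (1 / l) (x - a) * m"
        unfolding l_def m_def
        by (rule freq_proj_mean_zero[OF cut M L f supp' mean]) (use low ab in \<open>auto simp: l_def\<close>)
      have bp: "0 \<le> bump_scaled (1 / l) t" for t using bump_scaled_pos[OF l'] less_imp_le by blast
      have "ennreal (l * m * (b - a) * (bump_scaled (1 / l) (x - a) / 3))
         = (\<integral>\<^sup>+y. ennreal (l * m * (bump_scaled (1 / l) (x - a) / 3)) * indicator {a<..<b} y \<partial>lborel)"
      proof -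
        have "0 \<le> l * m * (bump_scaled (1 / l) (x - a) / 3)" using l m bp by auto
        hence "ennreal (l * m * (bump_scaled (1 / l) (x - a) / 3)) * ennreal (b - a)
            = ennreal (l * m * (bump_scaled (1 / l) (x - a) / 3) * (b - a))"
          using ab by (intro ennreal_mult''[symmetric]) simp
        moreover have "(\<integral>\<^sup>+y. ennreal (l * m * (bump_scaled (1 / l) (x - a) / 3)) * indicator {a<..<b} y \<partial>lborel)
            = ennreal (l * m * (bump_scaled (1 / l) (x - a) / 3)) * ennreal (b - a)"
          using ab by (subst nn_integral_cmult_indicator) simp_all
        moreover have "l * m * (b - a) * (bump_scaled (1 / l) (x - a) / 3)
            = l * m * (bump_scaled (1 / l) (x - a) / 3) * (b - a)" by simp
        ultimately show ?thesis by metis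
      qed
      also have "\<dots> \<le> (\<integral>\<^sup>+y. ennreal (family J f L y * bump_scaled (1 / l) (x - y)) \<partial>lborel)"
      proof (rule nn_integral_mono)
        fix y
        show "ennreal (l * m * (bump_scaled (1 / l) (x - a) / 3)) * indicator {a<..<b} y
           \<le> ennreal (family J f L y * bump_scaled (1 / l) (x - y))"
        proof (cases "y \<in> {a<..<b}")
          case True
          hence yJ: "y \<in> J" using ab by blast
          have "b - a \<le> 1 / l" using low l by (simp add: field_simps)
          hence "bump_scaled (1 / l) (x - a) / 3 \<le> bump_scaled (1 / l) ((x - a) + (a - y))"
            by (intro bump_scaled_shift l') (use True in auto)
          hence "l * m * (bump_scaled (1 / l) (x - a) / 3) \<le> l * m * bump_scaled (1 / l) (x - y)"
            using l m by (intro mult_left_mono) auto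
          thus ?thesis using True yJ by (simp add: fam ennreal_leI)
        qed simp
      qed
      also have "\<dots> = ennreal ?c" by (rule cf(2)[symmetric])
      finally have 2: "l * m * (b - a) * (bump_scaled (1 / l) (x - a) / 3) \<le> ?c"
        using cf(3) by (subst (asm) ennreal_le_iff) auto
      have "480 * 10 ^ 10 * (l * (b - a)) * bump_scaled (1 / l) (x - a) * m
          = 3 * (480 * 10 ^ 10) * (l * m * (b - a) * (bump_scaled (1 / l) (x - a) / 3))" by simp
      also have "\<dots> \<le> 3 * (480 * 10 ^ 10) * ?c" using 2 by (intro mult_left_mono) auto
      also have "\<dots> \<le> K * ?c" using cf(3) R(1) by (intro mult_right_mono) (simp_all add: K_def)
      finally show ?thesis using 1 by (simp add: l_def)
    qed
  qed
qed

text \<open>The least \<open>k0\<close> with \<open>2 powi k0 \<ge> 1 / |J|\<close> gives the largest scale \<open>d\<close>, and the lengths above it run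
through \<open>d, d/2, d/4, \<dots>\<close>. Below \<open>1 / |J|\<close> the squares of the terms are at most \<open>2\<^sup>-\<^sup>j\<close>, because the mean of \<open>|f|\<close> over
\<open>J\<close> is at most 1.\<close>

lemma square_function_pointwise:
  assumes J: "finite_interval J" and f: "integrable lborel f" and supp: "\<And>y. y \<notin> J \<Longrightarrow> f y = 0"
    and m: "(LINT y|lborel. norm (f y)) \<le> ilength J"
  obtains d where "0 < d" "d \<le> ilength J"
    "\<And>y. square_fun Lambda1 (family J f) y
      \<le> ext_top sqrt (2 * (ennreal ((norm (f y))\<^sup>2) * square_weight d (piece f (level f y)) y) + 4 * indicator J y)"
proof -
  obtain a b where ab: "a < b" "J \<subseteq> {a..b}" "ilength J = b - a" by (rule finite_intervalE[OF J])
  define D where "D = ilength J"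
  have D: "0 < D" using ab by (simp add: D_def)
  define k0 where "k0 = \<lceil>log 2 (1 / D)\<rceil>"
  have pw: "(2::real) powi k = 2 powr real_of_int k" for k by (simp add: powr_real_of_int')
  have k1: "1 / D \<le> 2 powi k0"
  proof -
    have "log 2 (1 / D) \<le> real_of_int k0" by (simp add: k0_def)
    hence "2 powr log 2 (1 / D) \<le> (2::real) powr real_of_int k0" by simp
    thus ?thesis using D by (simp add: pw)
  qed
  have k2: "2 powi (k0 - 1) < 1 / D"
  proof -
    have "real_of_int (k0 - 1) < log 2 (1 / D)" unfolding k0_def by linarith
    hence "(2::real) powr real_of_int (k0 - 1) < 2 powr log 2 (1 / D)" by (subst powr_less_cancel_iff) auto
    thus ?thesis using D by (simp add: pw del: of_int_diff)
  qed
  define P where "P = (2::real) powi k0"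
  have P: "0 < P" by (simp add: P_def)
  define d where "d = 1 / (4 * P)"
  have hi: "(2::real) powi (k0 + int j) = P * 2 ^ j" for j by (simp add: P_def power_int_add)
  have lo: "(2::real) powi (k0 - 1 - int j) = 2 powi (k0 - 1) / 2 ^ j" for j by (simp add: power_int_diff)
  define mm where "mm = (LINT y|lborel. norm (f y))"
  have mm: "0 \<le> mm" "mm \<le> D" using m by (auto simp: mm_def D_def intro: integral_nonneg_AE)
  show ?thesis
  proof (rule that[of d])
    show "0 < d" using P by (simp add: d_def)
    have "1 / D \<le> P" using k1 by (simp add: P_def)
    thus "d \<le> ilength J" using P D by (simp add: d_def field_simps flip: D_def)
    fix y
    define c where "c = (\<lambda>l. ennreal ((if 1 / D \<le> l then majorant (1 / (4 * l)) f y else l * mm * indicator J y)\<^sup>2))"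
    have "(\<Sum>\<^sub>\<infinity>L\<in>Lambda1. ennreal (\<bar>family J f L y\<bar>\<^sup>2)) = (\<Sum>\<^sub>\<infinity>L\<in>Lambda1. c (ilength L))"
      unfolding family_def c_def D_def mm_def power2_abs ..
    also have "\<dots> \<le> 2 * ((\<Sum>j. c (2 powi (k0 + int j))) + (\<Sum>j. c (2 powi (k0 - 1 - int j))))"
      by (rule infsum_Lambda1_le)
    also have "(\<Sum>j. c (2 powi (k0 + int j))) = ennreal ((norm (f y))\<^sup>2) * square_weight d (piece f (level f y)) y"
    proof -
      have "c (2 powi (k0 + int j)) = ennreal ((norm (f y))\<^sup>2)
          * ennreal ((trail (d / 2 ^ j) (ratio (d / 2 ^ j) (piece f (level f y))) y)\<^sup>2)" for j
      proof -
        have "1 / D \<le> P * 2 ^ j"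
          using \<open>1 / D \<le> P\<close> mult_left_mono[of 1 "2 ^ j" P] P by (simp add: order_trans)
        moreover have "1 / (4 * (P * 2 ^ j)) = d / 2 ^ j" by (simp add: d_def)
        ultimately show ?thesis unfolding hi c_def
          by (simp add: majorant_def lift_def piece_def power_mult_distrib ennreal_mult')
      qed
      thus ?thesis by (simp add: square_weight_def)
    qed
    also have "(\<Sum>j. c (2 powi (k0 - 1 - int j))) \<le> 2 * indicator J y"
    proof -
      have "(\<Sum>j. c (2 powi (k0 - 1 - int j))) \<le> (\<Sum>j. ennreal ((1 / 2) ^ j) * indicator J y)"
      proof (rule suminf_le)
        fix j
        define q where "q = (2::real) powi (k0 - 1) / 2 ^ j"
        have "q \<le> (1 / D) / 2 ^ j" unfolding q_def using k2 by (intro divide_right_mono) auto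
        hence q: "0 < q" "q \<le> (1 / D) * (1 / 2) ^ j" by (auto simp: q_def power_one_over)
        have "q \<le> 2 powi (k0 - 1)" 
        proof -
          have "2 powi (k0 - 1) / 2 ^ j \<le> 2 powi (k0 - 1) / (1::real)" by (intro divide_left_mono) auto
          thus ?thesis by (simp add: q_def)
        qed
        hence nq: "\<not> 1 / D \<le> q" using k2 by linarith
        have "q * mm \<le> ((1 / D) * (1 / 2) ^ j) * D" using q mm D by (intro mult_mono) auto
        hence "q * mm \<le> (1 / 2) ^ j" using D by simp
        hence "(q * mm)\<^sup>2 \<le> ((1 / 2) ^ j)\<^sup>2" using q mm by (intro power_mono) auto
        also have "\<dots> \<le> (1 / 2) ^ j" by (simp add: power2_eq_square mult_le_cancel_left1 power_le_one)
        finally have "(q * mm)\<^sup>2 \<le> (1 / 2) ^ j" .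
        thus "c (2 powi (k0 - 1 - int j)) \<le> ennreal ((1 / 2) ^ j) * indicator J y"
          unfolding lo q_def[symmetric] c_def using nq by (auto simp: indicator_def intro: ennreal_leI)
      qed auto
      also have "\<dots> = (\<Sum>j. ennreal ((1 / 2) ^ j)) * indicator J y" by (rule ennreal_suminf_multc)
      also have "(\<Sum>j. ennreal ((1 / 2) ^ j)) = ennreal (\<Sum>j. (1 / 2) ^ j)"
        by (rule suminf_ennreal2) (auto intro: summable_geometric)
      also have "(\<Sum>j. (1 / 2 :: real) ^ j) = 2" by (subst suminf_geometric) auto
      finally show ?thesis by simp
    qed
    finally have "(\<Sum>\<^sub>\<infinity>L\<in>Lambda1. ennreal (\<bar>family J f L y\<bar>\<^sup>2))
       \<le> 2 * (ennreal ((norm (f y))\<^sup>2) * square_weight d (piece f (level f y)) y + 2 * indicator J y)"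
      by (simp add: mult_left_mono)
    also have "\<dots> = 2 * (ennreal ((norm (f y))\<^sup>2) * square_weight d (piece f (level f y)) y) + 4 * indicator J y"
      by (simp add: distrib_left mult.assoc[symmetric])
    finally show "square_fun Lambda1 (family J f) y
      \<le> ext_top sqrt (2 * (ennreal ((norm (f y))\<^sup>2) * square_weight d (piece f (level f y)) y) + 4 * indicator J y)"
      unfolding square_fun_def by (intro ext_top_mono) auto
  qed
qed

section \<open>The modular bound for the square function\<close>

text \<open>The measurable majorant \<open>H\<close> replaces the square function in the integral, so that the measurability
of an infinite sum over \<open>Lambda1\<close> does not have to be discussed.\<close>

definition modular_bound :: "real \<Rightarrow> real \<Rightarrow> bool" where
  "modular_bound s C \<longleftrightarrow> (\<forall>J f. finite_interval J \<longrightarrow> f \<in> borel_measurable borel \<longrightarrow> (\<forall>y. y \<notin> J \<longrightarrow> f y = 0) \<longrightarrow>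
     (\<integral>\<^sup>+y. ennreal (B_fun (s + 1 / 2) (norm (f y))) \<partial>lborel) \<le> ennreal (ilength J) \<longrightarrow>
     integrable lborel f \<and>
     (\<exists>H. H \<in> borel_measurable borel \<and> (\<forall>y. ext_top (B_fun s) (square_fun Lambda1 (family J f) y) \<le> H y)
        \<and> (\<integral>\<^sup>+y. H y \<partial>lborel) \<le> ennreal (C * ilength J)))"

text \<open>Integrate the pointwise bound level by level and insert the energy bound. The term
\<open>n\<^sup>s\<^sup>+\<^sup>1\<^sup>/\<^sup>2 m\<^sub>n\<close> is part of the modular of \<open>f\<close>, and the errors \<open>n\<^sup>s e\<^sup>-\<^sup>n |J|\<close> are summable.\<close>

lemma square_function_modular:
  assumes s: "0 \<le> s"
  obtains C :: real where "1 \<le> C" "modular_bound s C"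
proof -
  obtain K :: real where K: "0 < K"
    "\<And>t n A. 0 \<le> t \<Longrightarrow> 1 \<le> n \<Longrightarrow> ln (exp 1 + t) < real n + 1 \<Longrightarrow>
      ext_top (B_fun s) (ext_top sqrt (2 * (ennreal (t\<^sup>2) * A) + 4))
      \<le> ennreal (K * real n powr (s + 1 / 2)) * ennreal t + ennreal (K * real n powr (s - 1 / 2)) * (ennreal t * A)
        + ennreal (B_fun s 4)"
    by (rule modular_pointwise[OF s]) blast
  define E where "E = (\<Sum>n. real n powr s * exp (- real n))"
  have E: "0 \<le> E" unfolding E_def by (intro suminf_nonneg summable_powr_exp) simp
  define C where "C = 105 * K + 104 * K * E + B_fun s 4 + 1"
  have C: "1 \<le> C" using K(1) E B_fun_nonneg[of 4 s] by (simp add: C_def)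
  show ?thesis
  proof (rule that[OF C], unfold modular_bound_def, intro allI impI)
    fix J and f :: "real \<Rightarrow> complex"
    assume J: "finite_interval J" and [measurable]: "f \<in> borel_measurable borel"
      and supp0: "\<forall>y. y \<notin> J \<longrightarrow> f y = 0"
      and mod: "(\<integral>\<^sup>+y. ennreal (B_fun (s + 1 / 2) (norm (f y))) \<partial>lborel) \<le> ennreal (ilength J)"
    have supp: "f y = 0" if "y \<notin> J" for y using supp0 that by blast
    obtain a b where ab: "a < b" "J \<subseteq> {a..b}" "ilength J = b - a" "J \<in> sets borel" by (rule finite_intervalE[OF J])
    have [measurable]: "J \<in> sets borel" by (rule ab(4))
    have supp': "f y = 0" if "y \<notin> {a..b}" for y using supp ab(2) that by blast
    have mle: "(\<integral>\<^sup>+y. ennreal (norm (f y)) \<partial>lborel) \<le> ennreal (b - a)"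
    proof -
      have "(\<integral>\<^sup>+y. ennreal (norm (f y)) \<partial>lborel) \<le> (\<integral>\<^sup>+y. ennreal (B_fun (s + 1 / 2) (norm (f y))) \<partial>lborel)"
        by (intro nn_integral_mono ennreal_leI B_fun_ge) (use s in auto)
      thus ?thesis using mod ab by simp
    qed
    have f: "integrable lborel f"
      by (rule integrableI_bounded) (use mle in \<open>auto intro: le_less_trans\<close>)
    have m: "(LINT y|lborel. norm (f y)) \<le> ilength J"
      using mle ab nn_integral_eq_integral[OF integrable_norm[OF f]] by simp
    obtain d where d: "0 < d" "d \<le> ilength J"
      and sq: "\<And>y. square_fun Lambda1 (family J f) y
        \<le> ext_top sqrt (2 * (ennreal ((norm (f y))\<^sup>2) * square_weight d (piece f (level f y)) y) + 4 * indicator J y)"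
      using square_function_pointwise[OF J f supp m] by blast
    define w where "w = piece f"
    have [measurable]: "w n \<in> borel_measurable borel" for n unfolding w_def by measurable
    have iw: "integrable lborel (w n)" for n unfolding w_def by (rule integrable_piece[OF f])
    define G where "G = (\<lambda>n y. ennreal (K * real n powr (s + 1 / 2)) * ennreal (norm (w n y))
        + ennreal (K * real n powr (s - 1 / 2)) * (ennreal (norm (w n y)) * square_weight d (w n) y))"
    have [measurable]: "G n \<in> borel_measurable borel" for n unfolding G_def by measurable
    have pt: "ext_top (B_fun s) (square_fun Lambda1 (family J f) y) \<le> (\<Sum>n. G n y) + ennreal (B_fun s 4) * indicator J y" for y
    proof (cases "y \<in> J")
      case False
      have "square_fun Lambda1 (family J f) y = 0"
        using family_outside[OF supp False] by (simp add: square_fun_def ext_top_def)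
      thus ?thesis by (simp add: ext_top_def B_fun_def)
    next
      case True
      let ?n = "level f y"
      have wn: "w ?n y = f y" by (simp add: w_def piece_def)
      have "ext_top (B_fun s) (square_fun Lambda1 (family J f) y)
        \<le> ext_top (B_fun s) (ext_top sqrt (2 * (ennreal ((norm (f y))\<^sup>2) * square_weight d (w ?n) y) + 4))"
        using sq[of y] True by (intro ext_top_mono B_fun_mono s) (auto simp: w_def)
      also have "\<dots> \<le> G ?n y + ennreal (B_fun s 4)"
        unfolding G_def wn using level_bounds(1,3)[of f y] by (intro K(2)) auto
      also have "G ?n y \<le> (\<Sum>n. G n y)"
        using sum_le_suminf[of "\<lambda>n. G n y" "{?n}"] by simp
      finally show ?thesis using True by (simp add: add_right_mono)
    qed
    have e1: "(\<integral>\<^sup>+y. ennreal (norm (w n y)) \<partial>lborel) = ennreal (LINT y|lborel. norm (w n y))" for n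
      by (rule nn_integral_eq_integral) (use iw in auto)
    have bdG: "(\<integral>\<^sup>+y. G n y \<partial>lborel) \<le> (\<integral>\<^sup>+y. ennreal (105 * K * (real n powr (s + 1 / 2) * norm (w n y))) \<partial>lborel)
        + ennreal (104 * K * (b - a) * (real n powr s * exp (- real n)))" for n
    proof (cases "n = 0")
      case True
      have "w 0 y = 0" for y using level_bounds(1)[of f y] by (auto simp: w_def piece_def)
      thus ?thesis by (simp add: True G_def)
    next
      case False
      hence n: "1 \<le> n" by simp
      define I where "I = (LINT y|lborel. norm (w n y))"
      have I: "0 \<le> I" unfolding I_def by (intro integral_nonneg_AE) simp
      have "(\<integral>\<^sup>+y. G n y \<partial>lborel) = ennreal (K * real n powr (s + 1 / 2)) * ennreal I
         + ennreal (K * real n powr (s - 1 / 2)) * (\<integral>\<^sup>+y. ennreal (norm (w n y)) * square_weight d (w n) y \<partial>lborel)"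
        unfolding G_def I_def e1[symmetric] by (subst nn_integral_add) (simp_all add: nn_integral_cmult)
      also have "\<dots> \<le> ennreal (K * real n powr (s + 1 / 2)) * ennreal I
         + ennreal (K * real n powr (s - 1 / 2)) * ennreal (104 * (real n * I + exp (- real n) * (b - a)))"
        unfolding w_def I_def
        by (intro add_left_mono mult_left_mono square_weight_energy f n d(1) supp') (use ab d in auto)
      also have "\<dots> = ennreal (K * real n powr (s + 1 / 2) * I + K * real n powr (s - 1 / 2) * (104 * (real n * I + exp (- real n) * (b - a))))"
        using K(1) I ab by (simp add: ennreal_mult'[symmetric] ennreal_plus[symmetric] del: ennreal_plus)
      also have "\<dots> \<le> ennreal (105 * K * (real n powr (s + 1 / 2)) * I + 104 * K * (b - a) * (real n powr s * exp (- real n)))"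
      proof (rule ennreal_leI)
        have p: "real n powr (s - 1 / 2) * real n = real n powr (s + 1 / 2)"
          using n powr_add[of "real n" "s - 1 / 2" 1] by (simp add: add.commute)
        have "real n powr (s - 1 / 2) \<le> real n powr s" using n by (intro powr_mono) auto
        hence q: "104 * K * (b - a) * (real n powr (s - 1 / 2) * exp (- real n)) \<le> 104 * K * (b - a) * (real n powr s * exp (- real n))"
          using K(1) ab by (intro mult_left_mono mult_right_mono) auto
        have "K * real n powr (s - 1 / 2) * (104 * (real n * I + exp (- real n) * (b - a)))
          = 104 * K * (real n powr (s - 1 / 2) * real n) * I + 104 * K * (b - a) * (real n powr (s - 1 / 2) * exp (- real n))"
          by (simp add: algebra_simps)
        also have "\<dots> \<le> 104 * K * real n powr (s + 1 / 2) * I + 104 * K * (b - a) * (real n powr s * exp (- real n))"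
          unfolding p using q by (rule add_left_mono)
        finally have "K * real n powr (s - 1 / 2) * (104 * (real n * I + exp (- real n) * (b - a)))
          \<le> 104 * K * real n powr (s + 1 / 2) * I + 104 * K * (b - a) * (real n powr s * exp (- real n))" .
        moreover have "K * A * I + X \<le> 105 * K * A * I + Y" if "X \<le> 104 * K * A * I + Y" for X Y A :: real
          using that by (simp add: algebra_simps)
        ultimately show "K * real n powr (s + 1 / 2) * I + K * real n powr (s - 1 / 2) * (104 * (real n * I + exp (- real n) * (b - a)))
          \<le> 105 * K * (real n powr (s + 1 / 2)) * I + 104 * K * (b - a) * (real n powr s * exp (- real n))"
          by blast
      qed
      also have "\<dots> = ennreal (105 * K * (real n powr (s + 1 / 2))) * ennreal I + ennreal (104 * K * (b - a) * (real n powr s * exp (- real n)))"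
        using K(1) I ab by (simp add: ennreal_mult'' ennreal_plus)
      also have "ennreal (105 * K * (real n powr (s + 1 / 2))) * ennreal I
         = (\<integral>\<^sup>+y. ennreal (105 * K * (real n powr (s + 1 / 2) * norm (w n y))) \<partial>lborel)"
        unfolding I_def e1[symmetric]
        by (subst nn_integral_cmult[symmetric]) (auto simp: ennreal_mult''[symmetric] mult.assoc)
      finally show ?thesis .
    qed
    have sumB: "(\<Sum>n. ennreal (105 * K * (real n powr (s + 1 / 2) * norm (w n y)))) \<le> ennreal (105 * K) * ennreal (B_fun (s + 1 / 2) (norm (f y)))" for y
    proof -
      let ?n = "level f y"
      have "(\<Sum>n. ennreal (105 * K * (real n powr (s + 1 / 2) * norm (w n y))))
         = (\<Sum>n\<in>{?n}. ennreal (105 * K * (real n powr (s + 1 / 2) * norm (w n y))))"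
        by (rule suminf_finite) (auto simp: w_def piece_def)
      also have "\<dots> = ennreal (105 * K * (real ?n powr (s + 1 / 2) * norm (f y)))" by (simp add: w_def piece_def)
      also have "\<dots> \<le> ennreal (105 * K * B_fun (s + 1 / 2) (norm (f y)))"
      proof (intro ennreal_leI mult_left_mono)
        have "real ?n powr (s + 1 / 2) \<le> ln (exp 1 + norm (f y)) powr (s + 1 / 2)"
          using level_bounds(2)[of f y] s by (intro powr_mono2) auto
        from mult_left_mono[OF this norm_ge_zero[of "f y"]]
        show "real ?n powr (s + 1 / 2) * norm (f y) \<le> B_fun (s + 1 / 2) (norm (f y))"
          unfolding B_fun_def by (simp only: mult.commute)
      qed (use K in simp)
      finally show ?thesis using K(1) by (simp add: ennreal_mult')
    qed
    let ?H = "\<lambda>y. (\<Sum>n. G n y) + ennreal (B_fun s 4) * indicator J y"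
    have "(\<integral>\<^sup>+y. ?H y \<partial>lborel) = (\<Sum>n. \<integral>\<^sup>+y. G n y \<partial>lborel) + ennreal (B_fun s 4) * emeasure lborel J"
      by (subst nn_integral_add) (simp_all add: nn_integral_suminf nn_integral_cmult_indicator)
    also have "emeasure lborel J \<le> ennreal (b - a)"
    proof -
      have "emeasure lborel J \<le> emeasure lborel {a..b}" using ab by (intro emeasure_mono) auto
      thus ?thesis using ab by simp
    qed
    also have "(\<Sum>n. \<integral>\<^sup>+y. G n y \<partial>lborel) \<le> (\<Sum>n. (\<integral>\<^sup>+y. ennreal (105 * K * (real n powr (s + 1 / 2) * norm (w n y))) \<partial>lborel)
        + ennreal (104 * K * (b - a) * (real n powr s * exp (- real n))))"
      by (rule suminf_le[OF bdG]) auto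
    also have "\<dots> = (\<Sum>n. \<integral>\<^sup>+y. ennreal (105 * K * (real n powr (s + 1 / 2) * norm (w n y))) \<partial>lborel)
        + (\<Sum>n. ennreal (104 * K * (b - a) * (real n powr s * exp (- real n))))"
      by (rule suminf_add[symmetric]) auto
    also have "(\<Sum>n. \<integral>\<^sup>+y. ennreal (105 * K * (real n powr (s + 1 / 2) * norm (w n y))) \<partial>lborel)
        = (\<integral>\<^sup>+y. (\<Sum>n. ennreal (105 * K * (real n powr (s + 1 / 2) * norm (w n y)))) \<partial>lborel)"
      by (rule nn_integral_suminf[symmetric]) measurable
    also have "\<dots> \<le> (\<integral>\<^sup>+y. ennreal (105 * K) * ennreal (B_fun (s + 1 / 2) (norm (f y))) \<partial>lborel)"
      by (rule nn_integral_mono) (rule sumB)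
    also have "\<dots> = ennreal (105 * K) * (\<integral>\<^sup>+y. ennreal (B_fun (s + 1 / 2) (norm (f y))) \<partial>lborel)"
      by (rule nn_integral_cmult) (unfold B_fun_def, measurable)
    also have "\<dots> \<le> ennreal (105 * K) * ennreal (b - a)" using mod ab by (intro mult_left_mono) auto
    also have "(\<Sum>n. ennreal (104 * K * (b - a) * (real n powr s * exp (- real n)))) = ennreal (104 * K * (b - a) * E)"
    proof -
      have "(\<Sum>n. ennreal (104 * K * (b - a) * (real n powr s * exp (- real n))))
         = ennreal (\<Sum>n. 104 * K * (b - a) * (real n powr s * exp (- real n)))"
        by (rule suminf_ennreal2) (use K ab in \<open>auto intro: summable_mult summable_powr_exp\<close>)
      also have "(\<Sum>n. 104 * K * (b - a) * (real n powr s * exp (- real n))) = 104 * K * (b - a) * E"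
        unfolding E_def by (rule suminf_mult[OF summable_powr_exp])
      finally show ?thesis .
    qed
    finally have "(\<integral>\<^sup>+y. ?H y \<partial>lborel)
      \<le> ennreal (105 * K) * ennreal (b - a) + ennreal (104 * K * (b - a) * E) + ennreal (B_fun s 4) * ennreal (b - a)"
      by (simp add: add_mono mult_left_mono)
    also have "\<dots> = ennreal (105 * K * (b - a) + 104 * K * (b - a) * E + B_fun s 4 * (b - a))"
      using K(1) E ab B_fun_nonneg[of 4 s] by (simp add: ennreal_mult'[symmetric] ennreal_plus[symmetric] del: ennreal_plus)
    also have "\<dots> \<le> ennreal (C * ilength J)"
      using ab(1) by (intro ennreal_leI) (simp add: C_def ab(3) algebra_simps)
    finally have "(\<integral>\<^sup>+y. ?H y \<partial>lborel) \<le> ennreal (C * ilength J)" .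
    moreover have "?H \<in> borel_measurable borel" by measurable
    ultimately show "integrable lborel f \<and>
      (\<exists>H. H \<in> borel_measurable borel \<and> (\<forall>y. ext_top (B_fun s) (square_fun Lambda1 (family J f) y) \<le> H y)
        \<and> (\<integral>\<^sup>+y. H y \<partial>lborel) \<le> ennreal (C * ilength J))"
      using f pt by blast
  qed
qed

section \<open>Orlicz norms and the conclusion\<close>

text \<open>Changing the function on a null set affects neither its projections nor its norm, and products of
Borel functions are measurable for the product measure of Fubini's theorem.\<close>

lemma borel_representative:
  fixes f :: "real \<Rightarrow> complex"
  assumes [measurable]: "f \<in> borel_measurable lebesgue"
  obtains g where "g \<in> borel_measurable borel" "AE x in lborel. f x = g x"
proof -
  have "(\<lambda>x. Re (f x)) \<in> borel_measurable lebesgue" and "(\<lambda>x. Im (f x)) \<in> borel_measurable lebesgue"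
    by measurable
  note RI = this[THEN completion_ex_borel_measurable_real]
  obtain u v where u: "u \<in> borel_measurable lborel" "AE x in lborel. Re (f x) = u x"
    and v: "v \<in> borel_measurable lborel" "AE x in lborel. Im (f x) = v x"
    using RI by blast
  have [measurable]: "u \<in> borel_measurable borel" "v \<in> borel_measurable borel" using u(1) v(1) by simp_all
  show ?thesis
  proof (rule that[of "\<lambda>x. of_real (u x) + \<i> * of_real (v x)"])
    show "AE x in lborel. f x = of_real (u x) + \<i> * of_real (v x)"
      using u(2) v(2) by eventually_elim (simp add: complex_eq_iff)
  qed measurable
qed

lemma freq_proj_scale:
  assumes [measurable]: "f \<in> borel_measurable lebesgue" "g \<in> borel_measurable borel"
    and eq: "AE x in lborel. f x = of_real l * g x"
  shows "freq_proj \<phi> L f x = of_real l * freq_proj \<phi> L g x"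
proof -
  have F: "fourier f \<xi> = of_real l * fourier g \<xi>" for \<xi>
  proof -
    have "fourier f \<xi> = (LINT x|lebesgue. of_real l * (g x * exp (- 2 * of_real pi * \<i> * of_real x * of_real \<xi>)))"
      unfolding fourier_def
    proof (rule integral_cong_AE)
      show "AE x in lebesgue. f x * exp (- 2 * of_real pi * \<i> * of_real x * of_real \<xi>)
         = of_real l * (g x * exp (- 2 * of_real pi * \<i> * of_real x * of_real \<xi>))"
        using AE_completion[OF eq] by eventually_elim (simp only: mult.assoc)
      have "(\<lambda>x. exp (- 2 * of_real pi * \<i> * of_real x * of_real \<xi>)) \<in> borel_measurable lebesgue"
        by (rule measurable_completion) measurable
      thus "(\<lambda>x. f x * exp (- 2 * of_real pi * \<i> * of_real x * of_real \<xi>)) \<in> borel_measurable lebesgue"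
        by measurable
      show "(\<lambda>x. of_real l * (g x * exp (- 2 * of_real pi * \<i> * of_real x * of_real \<xi>))) \<in> borel_measurable lebesgue"
        by (rule measurable_completion) measurable
    qed
    thus ?thesis by (simp add: fourier_def)
  qed
  have "\<phi> L \<xi> * fourier f \<xi> * exp (2 * of_real pi * \<i> * of_real x * of_real \<xi>)
     = of_real l * (\<phi> L \<xi> * fourier g \<xi> * exp (2 * of_real pi * \<i> * of_real x * of_real \<xi>))" for \<xi>
    by (simp add: F)
  thus ?thesis unfolding freq_proj_def by (simp only: integral_mult_right_zero)
qed

lemma sum_le_infsum_ennreal:
  fixes f :: "'a \<Rightarrow> ennreal"
  assumes "finite T" "T \<subseteq> A" shows "sum f T \<le> infsum f A"
  using assms by (subst nonneg_infsum_complete) (auto intro!: SUP_upper)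

text \<open>The inequality suffices for the norm, and it follows from finite partial sums alone.\<close>

lemma square_fun_scale_le:
  assumes l: "0 \<le> l"
  shows "square_fun A (\<lambda>L y. l * F L y) x \<le> ennreal l * square_fun A F x"
proof -
  let ?S = "\<Sum>\<^sub>\<infinity>L\<in>A. ennreal (\<bar>F L x\<bar>\<^sup>2)"
  have "(\<Sum>\<^sub>\<infinity>L\<in>A. ennreal (\<bar>l * F L x\<bar>\<^sup>2)) \<le> ennreal (l\<^sup>2) * ?S"
  proof (rule infsum_ennreal_le)
    fix T assume T: "finite T" "T \<subseteq> A"
    have "(\<Sum>L\<in>T. ennreal (\<bar>l * F L x\<bar>\<^sup>2)) = ennreal (l\<^sup>2) * (\<Sum>L\<in>T. ennreal (\<bar>F L x\<bar>\<^sup>2))"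
      unfolding sum_distrib_left by (intro sum.cong refl) (simp add: power_mult_distrib ennreal_mult')
    also have "\<dots> \<le> ennreal (l\<^sup>2) * ?S" by (intro mult_left_mono sum_le_infsum_ennreal T) simp
    finally show "(\<Sum>L\<in>T. ennreal (\<bar>l * F L x\<bar>\<^sup>2)) \<le> ennreal (l\<^sup>2) * ?S" .
  qed
  hence "square_fun A (\<lambda>L y. l * F L y) x \<le> ext_top sqrt (ennreal (l\<^sup>2) * ?S)"
    unfolding square_fun_def by (intro ext_top_mono) auto
  also have "\<dots> = ennreal l * ext_top sqrt ?S"
  proof (cases ?S)
    case (real r)
    have e: "ennreal (l\<^sup>2) * ennreal r = ennreal (l\<^sup>2 * r)" using real by (simp add: ennreal_mult')
    show ?thesis unfolding real(2) e using real(1) l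
      by (subst (1 2) ext_top_ennreal) (simp_all add: real_sqrt_mult ennreal_mult')
  next
    case top
    show ?thesis unfolding top
      by (cases "l = 0") (use l in \<open>simp_all add: ext_top_def ennreal_mult_top\<close>)
  qed
  finally show ?thesis by (simp add: square_fun_def)
qed

lemma square_fun_subset_le:
  assumes "A \<subseteq> B" shows "square_fun A F x \<le> square_fun B F x"
  unfolding square_fun_def
  by (intro ext_top_mono infsum_ennreal_le sum_le_infsum_ennreal) (use assms in auto)

lemma LlogL_norm_mono:
  assumes s: "0 \<le> s" and gh: "\<And>x. g x \<le> h x"
  shows "LlogL_norm s J E g \<le> LlogL_norm s J E h"
  unfolding LlogL_norm_def
proof (rule Inf_superset_mono, safe)
  fix l :: real
  assume l: "0 < l" and le: "(\<integral>\<^sup>+x\<in>E. ext_top (B_fun s) (h x / ennreal l) \<partial>lebesgue) / ennreal (ilength J) \<le> 1"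
  have "(\<integral>\<^sup>+x\<in>E. ext_top (B_fun s) (g x / ennreal l) \<partial>lebesgue) / ennreal (ilength J)
      \<le> (\<integral>\<^sup>+x\<in>E. ext_top (B_fun s) (h x / ennreal l) \<partial>lebesgue) / ennreal (ilength J)"
    by (intro divide_right_mono_ennreal nn_integral_mono mult_right_mono ext_top_mono B_fun_mono s gh) auto
  thus "\<exists>la. ennreal l = ennreal la \<and> 0 < la \<and>
       (\<integral>\<^sup>+x\<in>E. ext_top (B_fun s) (g x / ennreal la) \<partial>lebesgue) / ennreal (ilength J) \<le> 1"
    using l le order_trans by blast
qed

lemma ennreal_divide_le_1D:
  assumes "0 < c" "a / ennreal c \<le> 1" shows "a \<le> ennreal c"
proof (cases a)
  case (real r)
  hence "ennreal (r / c) \<le> 1" using assms by (simp add: divide_ennreal)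
  hence "r / c \<le> 1" using real assms by simp
  thus ?thesis using real assms by (simp add: divide_le_eq ennreal_leI)
next
  case top
  thus ?thesis using assms by (simp add: ennreal_top_divide top_unique)
qed

text \<open>Any number above the norm exceeds some \<open>l\<close> that is admissible in the infimum. Dividing by such an
\<open>l\<close> normalizes the modular without asking whether the infimum is attained.\<close>

lemma LlogL_spaceE:
  assumes J: "finite_interval J" and f: "f \<in> LlogL_space s J" and N: "LlogL_norm s J J (\<lambda>x. ennreal (norm (f x))) < ennreal N"
  obtains l g where "0 < l" "l < N" "g \<in> borel_measurable borel" "\<And>y. y \<notin> J \<Longrightarrow> g y = 0"
    "AE x in lborel. f x = of_real l * g x"
    "(\<integral>\<^sup>+y. ennreal (B_fun s (norm (g y))) \<partial>lborel) \<le> ennreal (ilength J)"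
proof -
  have fm [measurable]: "f \<in> borel_measurable lebesgue" and f0: "\<And>x. x \<notin> J \<Longrightarrow> f x = 0"
    using f by (auto simp: LlogL_space_def)
  obtain l where l: "0 < l" "ennreal l < ennreal N"
    and mod: "(\<integral>\<^sup>+x\<in>J. ext_top (B_fun s) (ennreal (norm (f x)) / ennreal l) \<partial>lebesgue) / ennreal (ilength J) \<le> 1"
    using N unfolding LlogL_norm_def Inf_less_iff by auto
  have [measurable]: "J \<in> sets borel" by (rule finite_intervalE[OF J])
  obtain h where [measurable]: "h \<in> borel_measurable borel" and h: "AE x in lborel. f x = h x"
    by (rule borel_representative[OF fm])
  define g where "g = (\<lambda>x. indicator J x *\<^sub>R h x /\<^sub>R l)"
  have gm: "g \<in> borel_measurable borel" unfolding g_def by measurable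
  have g0: "g y = 0" if "y \<notin> J" for y using that by (simp add: g_def)
  have fg: "AE x in lborel. f x = of_real l * g x"
    using h
  proof eventually_elim
    case (elim x)
    show ?case using l(1) elim f0[of x]
      by (cases "x \<in> J") (auto simp: g_def scaleR_conv_of_real)
  qed
  have J0: "0 < ilength J" using J by (simp add: finite_interval_def)
  have "(\<integral>\<^sup>+y. ennreal (B_fun s (norm (g y))) \<partial>lborel) = (\<integral>\<^sup>+y. ennreal (B_fun s (norm (g y))) \<partial>lebesgue)"
    by (simp add: nn_integral_completion)
  also have "\<dots> = (\<integral>\<^sup>+x\<in>J. ext_top (B_fun s) (ennreal (norm (f x)) / ennreal l) \<partial>lebesgue)"
  proof (rule nn_integral_cong_AE)
    show "AE x in lebesgue. ennreal (B_fun s (norm (g x)))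
       = ext_top (B_fun s) (ennreal (norm (f x)) / ennreal l) * indicator J x"
      using AE_completion[OF fg]
    proof eventually_elim
      case (elim x)
      have "norm (f x) / l = norm (g x)" using elim l(1) by (simp add: norm_mult)
      thus ?case using g0[of x] l(1)
        by (cases "x \<in> J") (auto simp: divide_ennreal ext_top_def B_fun_def)
    qed
  qed
  also have "\<dots> \<le> ennreal (ilength J)" by (rule ennreal_divide_le_1D[OF J0 mod])
  finally have gmod: "(\<integral>\<^sup>+y. ennreal (B_fun s (norm (g y))) \<partial>lborel) \<le> ennreal (ilength J)" .
  have "l < N" using l by (simp add: ennreal_less_iff)
  thus ?thesis using that[OF l(1) _ gm g0 fg gmod] by blast
qed

text \<open>The modular dominates the mean of \<open>|f| / l\<close>, for arbitrarily small \<open>l\<close>.\<close>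

lemma LlogL_norm_eq_0D:
  assumes J: "finite_interval J" and s: "0 \<le> s" and f: "f \<in> LlogL_space s J"
    and N: "LlogL_norm s J J (\<lambda>x. ennreal (norm (f x))) = 0"
  shows "AE x in lborel. f x = 0"
proof -
  obtain h where [measurable]: "h \<in> borel_measurable borel" and h: "AE x in lborel. f x = h x"
    using borel_representative[of f] f by (auto simp: LlogL_space_def)
  have "(\<integral>\<^sup>+y. ennreal (norm (h y)) \<partial>lborel) \<le> 0"
  proof (rule ennreal_le_epsilon)
    fix e :: real assume e: "0 < e"
    have D: "0 < ilength J" using J by (simp add: finite_interval_def)
    have "LlogL_norm s J J (\<lambda>x. ennreal (norm (f x))) < ennreal (e / ilength J)" using N e D by simp
    then obtain l g where l: "0 < l" "l < e / ilength J" and [measurable]: "g \<in> borel_measurable borel"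
      and fg: "AE x in lborel. f x = of_real l * g x"
      and mod: "(\<integral>\<^sup>+y. ennreal (B_fun s (norm (g y))) \<partial>lborel) \<le> ennreal (ilength J)"
      by (rule LlogL_spaceE[OF J f]) blast
    have "(\<integral>\<^sup>+y. ennreal (norm (h y)) \<partial>lborel) = (\<integral>\<^sup>+y. ennreal l * ennreal (norm (g y)) \<partial>lborel)"
    proof (rule nn_integral_cong_AE)
      show "AE y in lborel. ennreal (norm (h y)) = ennreal l * ennreal (norm (g y))"
        using h fg
      proof eventually_elim
        case (elim y)
        hence "h y = of_real l * g y" by simp
        hence "norm (h y) = l * norm (g y)" using l by (simp add: norm_mult)
        thus ?case using l by (simp add: ennreal_mult')
      qed
    qed
    also have "\<dots> \<le> ennreal l * (\<integral>\<^sup>+y. ennreal (B_fun s (norm (g y))) \<partial>lborel)"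
      unfolding nn_integral_cmult[symmetric]
      by (subst nn_integral_cmult) (auto intro!: mult_left_mono nn_integral_mono ennreal_leI B_fun_ge s)
    also have "\<dots> \<le> ennreal l * ennreal (ilength J)" by (intro mult_left_mono mod) simp
    also have "\<dots> \<le> ennreal e" using l D by (simp add: ennreal_mult'[symmetric] ennreal_leI field_simps)
    finally show "(\<integral>\<^sup>+y. ennreal (norm (h y)) \<partial>lborel) \<le> 0 + ennreal e" by simp
  qed
  hence "AE y in lborel. ennreal (norm (h y)) = 0" by (simp add: nn_integral_0_iff_AE)
  thus ?thesis using h by eventually_elim simp
qed

text \<open>By convexity \<open>B (t / C) \<le> B t / C\<close>, so a modular bounded by \<open>C |J|\<close> yields a norm of at most \<open>C\<close>.\<close>

lemma LlogL_norm_scaled_le: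
  assumes s: "0 \<le> s" and J: "finite_interval J" and l: "0 < l" and C: "1 \<le> C"
    and g: "\<And>x. g x \<le> ennreal l * T x"
    and [measurable]: "H \<in> borel_measurable borel" and TH: "\<And>y. ext_top (B_fun s) (T y) \<le> H y"
    and mod: "(\<integral>\<^sup>+y. H y \<partial>lborel) \<le> ennreal (C * ilength J)"
  shows "LlogL_norm s J E g \<le> ennreal (C * l)"
  unfolding LlogL_norm_def
proof (rule Inf_lower, safe, intro exI conjI refl)
  have D: "0 < ilength J" using J by (simp add: finite_interval_def)
  have Cl: "0 < C * l" using C l by simp
  show "0 < C * l" by (rule Cl)
  have pt: "ext_top (B_fun s) (g x / ennreal (C * l)) \<le> ennreal (1 / C) * ext_top (B_fun s) (T x)" for x
  proof (cases "T x")
    case (real t)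
    have "g x / ennreal (C * l) \<le> ennreal (l * t) / ennreal (C * l)"
      using g[of x] real l by (intro divide_right_mono_ennreal) (simp add: ennreal_mult')
    also have "\<dots> = ennreal (t / C)" using real l C by (simp add: divide_ennreal)
    finally have "ext_top (B_fun s) (g x / ennreal (C * l)) \<le> ext_top (B_fun s) (ennreal (t / C))"
      by (intro ext_top_mono B_fun_mono s) auto
    also have "\<dots> = ennreal (B_fun s (t / C))" using real C by (simp add: ext_top_def)
    also have "\<dots> \<le> ennreal (1 / C * B_fun s t)" using B_fun_divide[OF s real(1) C] by (intro ennreal_leI) simp
    also have "\<dots> = ennreal (1 / C) * ext_top (B_fun s) (T x)"
      unfolding real(2) ext_top_ennreal[OF real(1)] by (rule ennreal_mult''[OF B_fun_nonneg[OF real(1)]])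
    finally show ?thesis .
  next
    case top
    thus ?thesis using C by (simp add: ext_top_def ennreal_mult_top)
  qed
  have "(\<integral>\<^sup>+x\<in>E. ext_top (B_fun s) (g x / ennreal (C * l)) \<partial>lebesgue)
     \<le> (\<integral>\<^sup>+x. ext_top (B_fun s) (g x / ennreal (C * l)) \<partial>lebesgue)"
    by (intro nn_integral_mono) (simp add: indicator_def)
  also have "\<dots> \<le> (\<integral>\<^sup>+x. ennreal (1 / C) * H x \<partial>lborel)"
    unfolding nn_integral_completion
    by (intro nn_integral_mono order_trans[OF pt] mult_left_mono TH) simp
  also have "\<dots> = ennreal (1 / C) * (\<integral>\<^sup>+x. H x \<partial>lborel)"
    by (rule nn_integral_cmult) measurable
  also have "\<dots> \<le> ennreal (1 / C) * ennreal (C * ilength J)" by (intro mult_left_mono mod) simp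
  also have "\<dots> = ennreal (ilength J)" using C D by (simp add: ennreal_mult'[symmetric])
  finally have "(\<integral>\<^sup>+x\<in>E. ext_top (B_fun s) (g x / ennreal (C * l)) \<partial>lebesgue) \<le> ennreal (ilength J)" .
  hence "(\<integral>\<^sup>+x\<in>E. ext_top (B_fun s) (g x / ennreal (C * l)) \<partial>lebesgue) / ennreal (ilength J)
     \<le> ennreal (ilength J) / ennreal (ilength J)" by (rule divide_right_mono_ennreal)
  also have "\<dots> = 1" using D by (simp add: divide_ennreal)
  finally show "(\<integral>\<^sup>+x\<in>E. ext_top (B_fun s) (g x / ennreal (C * l)) \<partial>lebesgue) / ennreal (ilength J) \<le> 1" .
qed (rule refl)

text \<open>The levels refer to the normalized function, so the family depends on a choice of scale: it is that of
\<open>f / l\<close>, multiplied by \<open>l\<close>, for some \<open>l\<close> of at most twice the norm.\<close>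

lemma scaled_family:
  fixes C K :: real
  assumes s: "0 \<le> s" and C: "1 \<le> C"
    and modular: "modular_bound s C"
    and dominates: "\<And>J f L x. finite_interval J \<Longrightarrow> integrable lborel f \<Longrightarrow>
       (\<And>y. y \<notin> J \<Longrightarrow> f y = 0) \<Longrightarrow> L \<in> Lambda1 \<Longrightarrow> L \<in> Lambda1_high J \<or> (LINT y|lborel. f y) = 0 \<Longrightarrow>
       norm (freq_proj \<phi> L f x) \<le> K * conv (family J f L) (bump_scaled (1 / ilength L)) x"
    and J: "finite_interval J" and f: "f \<in> LlogL_space (s + 1 / 2) J"
  shows "\<exists>F. admissible_family Lambda1 F \<and> (\<forall>L\<in>Lambda1. \<forall>x. x \<notin> J \<longrightarrow> F L x = 0)
    \<and> (\<forall>L\<in>Lambda1. \<forall>x. L \<in> Lambda1_high J \<or> (LINT x:J|lebesgue. f x) = 0 \<longrightarrow>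
          0 \<le> conv (F L) (bump_scaled (1 / ilength L)) x \<and>
          norm (freq_proj \<phi> L f x) \<le> K * conv (F L) (bump_scaled (1 / ilength L)) x)
    \<and> (\<forall>E. LlogL_norm s J E (square_fun Lambda1 F)
          \<le> ennreal (2 * C) * LlogL_norm (s + 1 / 2) J J (\<lambda>x. ennreal (norm (f x))))"
proof -
  define N where "N = LlogL_norm (s + 1 / 2) J J (\<lambda>x. ennreal (norm (f x)))"
  have fm: "f \<in> borel_measurable lebesgue" and f0: "\<And>x. x \<notin> J \<Longrightarrow> f x = 0" and Nfin: "N < top"
    using f by (auto simp: LlogL_space_def N_def)
  \<comment> \<open>If the norm is positive, some admissible scale lies below twice the norm; if it vanishes,
    the function vanishes almost everywhere and the constant scale 0 serves.\<close>
  have "\<exists>l\<ge>0. \<exists>g. ennreal l \<le> 2 * N \<and> g \<in> borel_measurable borel \<and> (\<forall>y. y \<notin> J \<longrightarrow> g y = 0)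
      \<and> (AE x in lborel. f x = of_real l * g x)
      \<and> (\<integral>\<^sup>+y. ennreal (B_fun (s + 1 / 2) (norm (g y))) \<partial>lborel) \<le> ennreal (ilength J)"
  proof (cases "N = 0")
    case True
    have "AE x in lborel. f x = 0" by (rule LlogL_norm_eq_0D[OF J _ f]) (use s True in \<open>auto simp: N_def\<close>)
    hence "AE x in lborel. f x = of_real 0 * (0::complex)" by simp
    thus ?thesis by (intro exI[of _ 0] exI[of _ "\<lambda>_. 0"] conjI) (auto simp: B_fun_def)
  next
    case False
    then obtain r where r: "N = ennreal r" "0 < r" using Nfin by (cases N) (auto simp: ennreal_eq_0_iff)
    have "LlogL_norm (s + 1 / 2) J J (\<lambda>x. ennreal (norm (f x))) < ennreal (2 * r)"
      using r by (simp add: N_def[symmetric] ennreal_lessI)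
    from LlogL_spaceE[OF J f this] obtain l g where "0 < l" "l < 2 * r" "g \<in> borel_measurable borel"
      "\<And>y. y \<notin> J \<Longrightarrow> g y = 0" "AE x in lborel. f x = of_real l * g x"
      "(\<integral>\<^sup>+y. ennreal (B_fun (s + 1 / 2) (norm (g y))) \<partial>lborel) \<le> ennreal (ilength J)" by blast
    moreover have "ennreal l \<le> 2 * N"
      using \<open>l < 2 * r\<close> r ennreal_leI[of l "2 * r"] by (simp add: ennreal_mult')
    ultimately show ?thesis by (intro exI[of _ l] conjI exI[of _ g]) auto
  qed
  then obtain l g where l: "0 \<le> l" "ennreal l \<le> 2 * N" and gm [measurable]: "g \<in> borel_measurable borel"
    and g0: "\<And>y. y \<notin> J \<Longrightarrow> g y = 0" and fg: "AE x in lborel. f x = of_real l * g x"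
    and gmod: "(\<integral>\<^sup>+y. ennreal (B_fun (s + 1 / 2) (norm (g y))) \<partial>lborel) \<le> ennreal (ilength J)"
    by blast
  have Jm [measurable]: "J \<in> sets borel" by (rule finite_intervalE[OF J])
  obtain H where ig: "integrable lborel g" and H: "H \<in> borel_measurable borel"
      "\<And>y. ext_top (B_fun s) (square_fun Lambda1 (family J g) y) \<le> H y"
      "(\<integral>\<^sup>+y. H y \<partial>lborel) \<le> ennreal (C * ilength J)"
    using modular[unfolded modular_bound_def, rule_format, OF J gm g0 gmod] by blast
  define F where "F = (\<lambda>L y. l * family J g L y)"
  have iF: "integrable lborel (F L)" and nF: "0 \<le> F L y" if "L \<in> Lambda1" for L y
    using family_integrable[OF that ig J] family_nonneg[OF that ig] l by (auto simp: F_def)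
  have lp: "0 < 1 / ilength L" if "L \<in> Lambda1" for L using ilength_pos[OF that] by simp
  have "admissible_family Lambda1 F"
    unfolding admissible_family_def
  proof (intro ballI conjI allI)
    fix L x assume L: "L \<in> Lambda1"
    have "F L \<in> borel_measurable borel" using iF[OF L] by auto
    thus "F L \<in> borel_measurable lebesgue" by (simp add: measurable_completion)
    show "0 \<le> F L x" by (rule nF[OF L])
    show "conv_exists (F L) (bump_scaled (1 / ilength L))" by (rule conv_family(1)[OF lp[OF L] iF[OF L] nF[OF L]])
  qed
  moreover have "\<forall>L\<in>Lambda1. \<forall>x. x \<notin> J \<longrightarrow> F L x = 0"
    using family_outside[OF g0] by (simp add: F_def)
  moreover have "0 \<le> conv (F L) (bump_scaled (1 / ilength L)) x \<and>
      norm (freq_proj \<phi> L f x) \<le> K * conv (F L) (bump_scaled (1 / ilength L)) x"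
    if L: "L \<in> Lambda1" and alt: "L \<in> Lambda1_high J \<or> (LINT x:J|lebesgue. f x) = 0" for L x
  proof
    show "0 \<le> conv (F L) (bump_scaled (1 / ilength L)) x"
      by (rule conv_family(3)[OF lp[OF L] iF[OF L] nF[OF L]])
    have cF: "conv (F L) (bump_scaled (1 / ilength L)) x = l * conv (family J g L) (bump_scaled (1 / ilength L)) x"
      by (simp add: conv_def F_def mult.assoc)
    have pf: "freq_proj \<phi> L f x = of_real l * freq_proj \<phi> L g x" by (rule freq_proj_scale[OF fm gm fg])
    show "norm (freq_proj \<phi> L f x) \<le> K * conv (F L) (bump_scaled (1 / ilength L)) x"
    proof (cases "l = 0")
      case True
      thus ?thesis unfolding pf cF by simp
    next
      case False
      have alt': "L \<in> Lambda1_high J \<or> (LINT y|lborel. g y) = 0"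
      proof (rule disj_forward[OF alt])
        assume m: "(LINT x:J|lebesgue. f x) = 0"
        have "(LINT x:J|lebesgue. f x) = (LINT x|lebesgue. f x)"
          unfolding set_lebesgue_integral_def using f0
          by (intro Bochner_Integration.integral_cong refl) (auto simp: indicator_def)
        also have "\<dots> = (LINT x|lebesgue. of_real l * g x)"
          by (rule integral_cong_AE[OF fm measurable_completion AE_completion[OF fg]]) measurable
        also have "\<dots> = of_real l * (LINT x|lborel. g x)" by (simp add: integral_completion)
        finally show "(LINT y|lborel. g y) = 0" using m False by simp
      qed
      have "norm (freq_proj \<phi> L g x) \<le> K * conv (family J g L) (bump_scaled (1 / ilength L)) x"
        by (rule dominates[OF J ig _ L alt']) (rule g0)
      hence "l * norm (freq_proj \<phi> L g x) \<le> l * (K * conv (family J g L) (bump_scaled (1 / ilength L)) x)"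
        using l(1) by (rule mult_left_mono)
      thus ?thesis unfolding pf cF using l(1) by (simp add: norm_mult mult.left_commute)
    qed
  qed
  moreover have "LlogL_norm s J E (square_fun Lambda1 F) \<le> ennreal (2 * C) * N" for E
  proof (cases "l = 0")
    case True
    have "square_fun Lambda1 F x = 0" for x by (simp add: square_fun_def F_def True ext_top_def)
    hence q0: "square_fun Lambda1 F = (\<lambda>x. 0)" by (rule ext)
    have "LlogL_norm s J E (square_fun Lambda1 F) \<le> 0"
    proof (rule ennreal_le_epsilon)
      fix e :: real assume e: "0 < e"
      have "LlogL_norm s J E (\<lambda>x. 0) \<le> ennreal e"
        unfolding LlogL_norm_def by (rule Inf_lower) (use e in \<open>auto simp: ext_top_def B_fun_def\<close>)
      thus "LlogL_norm s J E (square_fun Lambda1 F) \<le> 0 + ennreal e" by (simp add: q0)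
    qed
    thus ?thesis by (rule order_trans[OF _ zero_le])
  next
    case False
    have "LlogL_norm s J E (square_fun Lambda1 F) \<le> ennreal (C * l)"
      unfolding F_def
      by (rule LlogL_norm_scaled_le[OF s J _ C square_fun_scale_le[OF l(1)] H]) (use l False in simp)
    also have "\<dots> = ennreal C * ennreal l" using l(1) by (rule ennreal_mult'')
    also have "\<dots> \<le> ennreal C * (2 * N)" by (intro mult_left_mono l) simp
    also have "\<dots> = ennreal (2 * C) * N" using C by (simp add: ennreal_mult' mult_ac)
    finally show ?thesis .
  qed
  ultimately show ?thesis unfolding N_def[symmetric] by (intro exI[of _ F] conjI ballI allI impI) simp_all
qed

theorem corollary4p1:
  shows "\<exists>M0\<ge>1. \<exists>C :: real \<Rightarrow> real \<Rightarrow> real.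
    \<forall>M\<ge>M0. \<forall>\<phi>. cutoff_family M \<phi> \<longrightarrow>
    (\<forall>J \<sigma> f. finite_interval J \<longrightarrow> 0 \<le> \<sigma> \<longrightarrow> f \<in> LlogL_space ((\<sigma> + 1) / 2) J \<longrightarrow>
      (\<exists>F. admissible_family (Lambda1_high J) F
         \<and> (\<forall>L\<in>Lambda1_high J. \<forall>x. x \<notin> dilate 5 J \<longrightarrow> F L x = 0)
         \<and> (\<forall>\<gamma>\<ge>1.
              (\<forall>L\<in>Lambda1_high J. \<forall>x.
                 norm (freq_proj \<phi> L f x) \<le> C \<gamma> \<sigma> * conv (F L) (bump_scaled (1 / ilength L)) x)
            \<and> LlogL_norm (\<sigma> / 2) J (dilate \<gamma> J) (square_fun (Lambda1_high J) F)
                \<le> ennreal (C \<gamma> \<sigma>) * LlogL_norm ((\<sigma> + 1) / 2) J J (\<lambda>x. ennreal (norm (f x)))))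
    \<and> ((LINT x:J|lebesgue. f x) = 0 \<longrightarrow>
      (\<exists>F. admissible_family Lambda1 F
         \<and> (\<forall>L\<in>Lambda1_high J. \<forall>x. x \<notin> dilate 5 J \<longrightarrow> F L x = 0)
         \<and> (\<forall>\<gamma>\<ge>1.
              (\<forall>L\<in>Lambda1. \<forall>x.
                 norm (freq_proj \<phi> L f x) \<le> C \<gamma> \<sigma> * conv (F L) (bump_scaled (1 / ilength L)) x)
            \<and> LlogL_norm (\<sigma> / 2) J (dilate \<gamma> J) (square_fun Lambda1 F)
                \<le> ennreal (C \<gamma> \<sigma>) * LlogL_norm ((\<sigma> + 1) / 2) J J (\<lambda>x. ennreal (norm (f x)))))))"
proof -
  obtain K :: real where K: "0 < K" and dom:
    "\<And>M \<phi> J f L x. cutoff_family M \<phi> \<Longrightarrow> 2 \<le> M \<Longrightarrow> finite_interval J \<Longrightarrow> integrable lborel f \<Longrightarrow>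
       (\<And>y. y \<notin> J \<Longrightarrow> f y = 0) \<Longrightarrow> L \<in> Lambda1 \<Longrightarrow> L \<in> Lambda1_high J \<or> (LINT y|lborel. f y) = 0 \<Longrightarrow>
       norm (freq_proj \<phi> L f x) \<le> K * conv (family J f L) (bump_scaled (1 / ilength L)) x"
    by (rule family_dominates) blast
  have "\<forall>s. \<exists>C. 0 \<le> s \<longrightarrow> 1 \<le> C \<and> modular_bound s C"
  proof
    fix s :: real
    show "\<exists>C. 0 \<le> s \<longrightarrow> 1 \<le> C \<and> modular_bound s C"
    proof (cases "0 \<le> s")
      case True
      show ?thesis by (rule square_function_modular[OF True]) auto
    qed simp
  qed
  then obtain Cs where Cs: "\<And>s. 0 \<le> s \<Longrightarrow> 1 \<le> Cs s" "\<And>s. 0 \<le> s \<Longrightarrow> modular_bound s (Cs s)" by metis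
  define C where "C = (\<lambda>(\<gamma> :: real) (\<sigma> :: real). max K (2 * Cs (\<sigma> / 2)))"
  show ?thesis
  proof (intro exI[of _ "2::nat"] exI[of _ C] conjI allI impI)
    fix M :: nat and \<phi> J and \<sigma> :: real and f
    assume M: "2 \<le> M" and cut: "cutoff_family M \<phi>" and J: "finite_interval J" and \<sigma>: "0 \<le> \<sigma>"
      and f: "f \<in> LlogL_space ((\<sigma> + 1) / 2) J"
    have s: "0 \<le> \<sigma> / 2" using \<sigma> by simp
    have half: "(\<sigma> + 1) / 2 = \<sigma> / 2 + 1 / 2" by (simp add: add_divide_distrib)
    obtain F where adm: "admissible_family Lambda1 F"
      and out: "\<forall>L\<in>Lambda1. \<forall>x. x \<notin> J \<longrightarrow> F L x = 0"
      and bd: "\<forall>L\<in>Lambda1. \<forall>x. L \<in> Lambda1_high J \<or> (LINT x:J|lebesgue. f x) = 0 \<longrightarrow>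
          0 \<le> conv (F L) (bump_scaled (1 / ilength L)) x \<and>
          norm (freq_proj \<phi> L f x) \<le> K * conv (F L) (bump_scaled (1 / ilength L)) x"
      and nrm: "\<forall>E. LlogL_norm (\<sigma> / 2) J E (square_fun Lambda1 F)
          \<le> ennreal (2 * Cs (\<sigma> / 2)) * LlogL_norm (\<sigma> / 2 + 1 / 2) J J (\<lambda>x. ennreal (norm (f x)))"
      using scaled_family[OF s Cs[OF s] dom[OF cut M] J f[unfolded half]] by blast
    have high: "Lambda1_high J \<subseteq> Lambda1" by (auto simp: Lambda1_high_def)
    have J5: "J \<subseteq> dilate 5 J" by (rule finite_intervalE[OF J])
    have out5: "\<forall>L\<in>Lambda1_high J. \<forall>x. x \<notin> dilate 5 J \<longrightarrow> F L x = 0" using out high J5 by blast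
    have bdC: "norm (freq_proj \<phi> L f x) \<le> C \<gamma> \<sigma> * conv (F L) (bump_scaled (1 / ilength L)) x"
      if "L \<in> Lambda1" "L \<in> Lambda1_high J \<or> (LINT x:J|lebesgue. f x) = 0" for L x \<gamma>
    proof -
      have c: "0 \<le> conv (F L) (bump_scaled (1 / ilength L)) x"
        "norm (freq_proj \<phi> L f x) \<le> K * conv (F L) (bump_scaled (1 / ilength L)) x"
        using bd that by blast+
      note c(2)
      also have "K * conv (F L) (bump_scaled (1 / ilength L)) x \<le> C \<gamma> \<sigma> * conv (F L) (bump_scaled (1 / ilength L)) x"
        using c(1) by (intro mult_right_mono) (simp_all add: C_def)
      finally show ?thesis .
    qed
    have nrmC: "LlogL_norm (\<sigma> / 2) J E (square_fun Lambda1 F)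
        \<le> ennreal (C \<gamma> \<sigma>) * LlogL_norm ((\<sigma> + 1) / 2) J J (\<lambda>x. ennreal (norm (f x)))" for E \<gamma>
    proof -
      have "ennreal (2 * Cs (\<sigma> / 2)) \<le> ennreal (C \<gamma> \<sigma>)" by (intro ennreal_leI) (simp add: C_def)
      from order_trans[OF nrm[rule_format, of E] mult_right_mono[OF this zero_le]]
      show ?thesis unfolding half .
    qed
    have "admissible_family (Lambda1_high J) F" using adm high unfolding admissible_family_def by blast
    moreover have "LlogL_norm (\<sigma> / 2) J E (square_fun (Lambda1_high J) F)
        \<le> ennreal (C \<gamma> \<sigma>) * LlogL_norm ((\<sigma> + 1) / 2) J J (\<lambda>x. ennreal (norm (f x)))" for E \<gamma>
      by (rule order_trans[OF LlogL_norm_mono[OF s square_fun_subset_le[OF high]] nrmC])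
    ultimately show "\<exists>F. admissible_family (Lambda1_high J) F
         \<and> (\<forall>L\<in>Lambda1_high J. \<forall>x. x \<notin> dilate 5 J \<longrightarrow> F L x = 0)
         \<and> (\<forall>\<gamma>\<ge>1.
              (\<forall>L\<in>Lambda1_high J. \<forall>x.
                 norm (freq_proj \<phi> L f x) \<le> C \<gamma> \<sigma> * conv (F L) (bump_scaled (1 / ilength L)) x)
            \<and> LlogL_norm (\<sigma> / 2) J (dilate \<gamma> J) (square_fun (Lambda1_high J) F)
                \<le> ennreal (C \<gamma> \<sigma>) * LlogL_norm ((\<sigma> + 1) / 2) J J (\<lambda>x. ennreal (norm (f x))))"
      using out5 bdC[OF subsetD[OF high]] by (intro exI[of _ F] conjI allI impI ballI) (simp_all only: simp_thms)
    assume mean: "(LINT x:J|lebesgue. f x) = 0"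
    show "\<exists>F. admissible_family Lambda1 F
         \<and> (\<forall>L\<in>Lambda1_high J. \<forall>x. x \<notin> dilate 5 J \<longrightarrow> F L x = 0)
         \<and> (\<forall>\<gamma>\<ge>1.
              (\<forall>L\<in>Lambda1. \<forall>x.
                 norm (freq_proj \<phi> L f x) \<le> C \<gamma> \<sigma> * conv (F L) (bump_scaled (1 / ilength L)) x)
            \<and> LlogL_norm (\<sigma> / 2) J (dilate \<gamma> J) (square_fun Lambda1 F)
                \<le> ennreal (C \<gamma> \<sigma>) * LlogL_norm ((\<sigma> + 1) / 2) J J (\<lambda>x. ennreal (norm (f x))))"
      using adm out5 bdC[OF _ disjI2[OF mean]] nrmC by (intro exI[of _ F] conjI allI impI ballI) (simp_all only: simp_thms)
  qed simp
qed

end
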